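(* Let $a>0$ and let $\hat{H}_b=\frac12(\hat x\hat p+\hat p\hat x)=\frac{i}{2}\left((b^+)^2-(b^-)^2\right)$ act in the $\mathfrak{osp}(1|2)$ representation space $V=\ell^2(\mathbb{Z}_+)$ with parameter $a$. For every $E\in\mathbb{R}$, $\hat{H}_b$ has the formal eigenvectors, with eigenvalue $E$, $$u_0(E)=\sum_{n=0}^\infty \alpha_{2n}(E)\,e_{2n}, \qquad u_1(E)=\sum_{n=0}^\infty \alpha_{2n+1}(E)\,e_{2n+1},$$ where $$\alpha_{2n}(E) = (-1)^n \sqrt{\frac{(a)_n}{n!}}\;\frac{\left|\Gamma\left(\frac{a+iE}{2}\right)\right|}{\sqrt{2^{2-a}\,\pi\,\Gamma(a)}}\;{}_2F_1\left(-n,\tfrac{a+iE}{2};\,a;\,2\right),$$ $$\alpha_{2n+1}(E) = (-1)^n \sqrt{\frac{(a+1)_n}{n!}}\;\frac{\left|\Gamma\left(\frac{a+1+iE}{2}\right)\right|}{\sqrt{2^{1-a}\,\pi\,\Gamma(a+1)}}\;{}_2F_1\left(-n,\tfrac{a+1+iE}{2};\,a+1;\,2\right).$$ The spectrum of $\hat{H}_b$ in $V$ is $\mathbb{R}$ with multiplicity $2$.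
   Context: Representation space: $V=\ell^2(\mathbb{Z}_+)$ is the Hilbert space of square-summable complex sequences with orthonormal standard basis $e_0,e_1,e_2,\dots$. For $a>0$ the positive discrete series representation of $\mathfrak{osp}(1|2)$ is given by operators $b^\pm$ acting on basis vectors by $$b^+e_{2n}=\sqrt{2(n+a)}\,e_{2n+1},\quad b^-e_{2n}=\sqrt{2n}\,e_{2n-1},\quad b^+e_{2n+1}=\sqrt{2(n+1)}\,e_{2n+2},\quad b^-e_{2n+1}=\sqrt{2(n+a)}\,e_{2n}$$ (with $b^-e_0=0$). Put $\hat x=\frac{b^++b^-}{\sqrt2}$ and $\hat p=\frac{i(b^+-b^-)}{\sqrt2}$. These operators, and polynomials in them, are first defined on the span of the $e_n$ (finite linear combinations); the operator in $V$ is the closure, which is self-adjoint, and "spectrum" refers to it. A formal eigenvector of such an operator $T$ with eigenvalue $E$ is a nonzero formal series $\sum_n c_n e_n$ (not necessarily in $\ell^2$) such that applying $T$ term by term and collecting the (finitely many) contributions to each $e_n$ gives $E\sum_n c_ne_n$. "Spectrum $S$ with multiplicity 2" means uniform spectral multiplicity 2: $V=V_0\oplus V_1$, with $V_0,V_1$ the closed spans of the $e_{2n}$ and of the $e_{2n+1}$, the operator preserves $V_0$ and $V_1$, and on each it has simple spectrum equal to $S$. $(c)_n=c(c+1)\cdots(c+n-1)$ is the Pochhammer symbol, and ${}_2F_1(-n,b;c;z)=\sum_{k=0}^n\frac{(-n)_k(b)_k}{(c)_k\,k!}z^k$. *)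

theory Defs
  imports "HOL-Analysis.Analysis" "HOL-Library.Function_Algebras"
begin

text \<open>
  Formal series \<open>\<Sum>n. c n e\<^sub>n\<close> are coefficient sequences \<^typ>\<open>nat \<Rightarrow> complex\<close>, added and subtracted
  pointwise. The Hilbert spaces are the set \<open>ell2\<close> and its closed subspaces; \<open>ip\<close>, \<open>l2norm\<close> are
  meaningful only for elements of \<open>ell2\<close>. Possibly unbounded operators
  in a Hilbert space are represented by their graphs.
\<close>

type_synonym vec = "nat \<Rightarrow> complex"
type_synonym oper = "(vec \<times> vec) set"

definition cscale :: "complex \<Rightarrow> vec \<Rightarrow> vec" where
  "cscale z f = (\<lambda>m. z * f m)"

definition ell2 :: "vec set" where
  "ell2 = {f. summable (\<lambda>n. (cmod (f n))\<^sup>2)}"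

definition ip :: "vec \<Rightarrow> vec \<Rightarrow> complex" where
  "ip f g = (\<Sum>n. cnj (f n) * g n)"

definition l2norm :: "vec \<Rightarrow> real" where
  "l2norm f = sqrt (\<Sum>n. (cmod (f n))\<^sup>2)"

definition basis_vec :: "nat \<Rightarrow> vec" where
  "basis_vec n = (\<lambda>m. if m = n then 1 else 0)"

definition lin_span :: "vec set \<Rightarrow> vec set" where
  "lin_span S = {(\<Sum>v\<in>F. cscale (c v) v) | F c. finite F \<and> F \<subseteq> S}"

definition l2_closure :: "vec set \<Rightarrow> vec set" where
  "l2_closure S = {f \<in> ell2. \<exists>s. (\<forall>k. s k \<in> S) \<and> (\<lambda>k. l2norm (s k - f)) \<longlonglongrightarrow> 0}"

definition closed_span :: "vec set \<Rightarrow> vec set" where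
  "closed_span S = l2_closure (lin_span S)"

definition orthogonal_direct_sum :: "vec set \<Rightarrow> vec set \<Rightarrow> vec set \<Rightarrow> bool" where
  "orthogonal_direct_sum H W0 W1 \<longleftrightarrow>
     H = {f0 + f1 | f0 f1. f0 \<in> W0 \<and> f1 \<in> W1} \<and>
     W0 \<inter> W1 = {0} \<and> (\<forall>f\<in>W0. \<forall>g\<in>W1. ip f g = 0)"


subsection \<open>Operators in a Hilbert space\<close>

definition graph_on :: "vec set \<Rightarrow> (vec \<Rightarrow> vec) \<Rightarrow> oper" where
  "graph_on D T = {(f, T f) | f. f \<in> D}"

definition op_closure :: "oper \<Rightarrow> oper" where
  "op_closure A = {(f, g). f \<in> ell2 \<and> g \<in> ell2 \<and>
     (\<exists>s t. (\<forall>k. (s k, t k) \<in> A) \<and> (\<lambda>k. l2norm (s k - f)) \<longlonglongrightarrow> 0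
                                \<and> (\<lambda>k. l2norm (t k - g)) \<longlonglongrightarrow> 0)}"

definition adjoint_in :: "vec set \<Rightarrow> oper \<Rightarrow> oper" where
  "adjoint_in H A = {(f, g). f \<in> H \<and> g \<in> H \<and> (\<forall>(h, k)\<in>A. ip k f = ip h g)}"

text \<open>Density of the domain makes the adjoint single-valued, so a self-adjoint graph is
  automatically the graph of a linear operator.\<close>

definition selfadjoint_in :: "vec set \<Rightarrow> oper \<Rightarrow> bool" where
  "selfadjoint_in H A \<longleftrightarrow> A \<subseteq> H \<times> H \<and> H \<subseteq> l2_closure (Domain A) \<and> A = adjoint_in H A"

text \<open>A number \<open>z\<close> is in the resolvent set if \<open>A - z\<close> is a bijection from the domain of \<open>A\<close> onto
  \<open>H\<close> with bounded inverse; \<open>(A - z) f = h\<close> reads \<open>(f, h + cscale z f) \<in> A\<close>.\<close>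

definition resolvent_set :: "vec set \<Rightarrow> oper \<Rightarrow> complex set" where
  "resolvent_set H A = {z. (\<forall>h\<in>H. \<exists>!f. (f, h + cscale z f) \<in> A) \<and>
     (\<exists>C. \<forall>(f, g)\<in>A. l2norm f \<le> C * l2norm (g - cscale z f))}"

definition spectrum :: "vec set \<Rightarrow> oper \<Rightarrow> complex set" where
  "spectrum H A = - resolvent_set H A"

definition part_in :: "vec set \<Rightarrow> oper \<Rightarrow> oper" where
  "part_in W A = A \<inter> (W \<times> W)"

text \<open>For an unbounded operator, preserving both summands includes that its domain is the sum
  of its intersections with the summands.\<close>

definition preserves_summands :: "oper \<Rightarrow> vec set \<Rightarrow> vec set \<Rightarrow> bool" where
  "preserves_summands A W0 W1 \<longleftrightarrow>
     A = {(f0 + f1, g0 + g1) | f0 f1 g0 g1. (f0, g0) \<in> part_in W0 A \<and> (f1, g1) \<in> part_in W1 A}"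


subsection \<open>Spectral measures and simple spectrum\<close>

definition orthogonal_projection_in :: "vec set \<Rightarrow> (vec \<Rightarrow> vec) \<Rightarrow> bool" where
  "orthogonal_projection_in H Q \<longleftrightarrow>
     (\<forall>f\<in>H. Q f \<in> H \<and> Q (Q f) = Q f) \<and>
     (\<forall>f\<in>H. \<forall>g\<in>H. Q (f + g) = Q f + Q g \<and> ip (Q f) g = ip f (Q g)) \<and>
     (\<forall>z. \<forall>f\<in>H. Q (cscale z f) = cscale z (Q f))"

definition projection_valued_measure :: "vec set \<Rightarrow> (real set \<Rightarrow> vec \<Rightarrow> vec) \<Rightarrow> bool" where
  "projection_valued_measure H P \<longleftrightarrow>
     (\<forall>M\<in>sets borel. orthogonal_projection_in H (P M)) \<and>
     (\<forall>f\<in>H. P UNIV f = f) \<and>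
     (\<forall>M :: nat \<Rightarrow> real set. range M \<subseteq> sets borel \<longrightarrow> disjoint_family M \<longrightarrow>
        (\<forall>f\<in>H. (\<lambda>k. l2norm ((\<Sum>i<k. P (M i) f) - P (\<Union>i. M i) f)) \<longlonglongrightarrow> 0))"

text \<open>The scalar measure \<open>M \<mapsto> \<langle>f, P M f\<rangle> = \<parallel>P M f\<parallel>\<^sup>2\<close>.\<close>

definition scalar_measure :: "(real set \<Rightarrow> vec \<Rightarrow> vec) \<Rightarrow> vec \<Rightarrow> real measure" where
  "scalar_measure P f = measure_of UNIV (sets borel) (\<lambda>M. ennreal ((l2norm (P M f))\<^sup>2))"

text \<open>\<open>P\<close> is the spectral measure of the self-adjoint operator \<open>A\<close>, i.e. \<open>A = \<integral>t dP(t)\<close>. The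
  quadratic form determines the linear operator \<open>A\<close> by polarization.\<close>

definition spectral_measure_of :: "vec set \<Rightarrow> oper \<Rightarrow> (real set \<Rightarrow> vec \<Rightarrow> vec) \<Rightarrow> bool" where
  "spectral_measure_of H A P \<longleftrightarrow>
     selfadjoint_in H A \<and> projection_valued_measure H P \<and>
     Domain A = {f \<in> H. integrable (scalar_measure P f) (\<lambda>t. t\<^sup>2)} \<and>
     (\<forall>(f, g)\<in>A. ip f g = complex_of_real (\<integral>t. t \<partial>scalar_measure P f))"

text \<open>A self-adjoint operator has simple spectrum if it has a generating (cyclic) vector \<open>g\<close>:
  the vectors \<open>P M g\<close>, \<open>M\<close> Borel, span a dense subspace.\<close>

definition simple_spectrum :: "vec set \<Rightarrow> oper \<Rightarrow> bool" where
  "simple_spectrum H A \<longleftrightarrow> selfadjoint_in H A \<and>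
     (\<exists>P. spectral_measure_of H A P \<and> (\<exists>g\<in>H. closed_span {P M g | M. M \<in> sets borel} = H))"

definition V0 :: "vec set" where
  "V0 = closed_span (range (\<lambda>n. basis_vec (2 * n)))"

definition V1 :: "vec set" where
  "V1 = closed_span (range (\<lambda>n. basis_vec (2 * n + 1)))"

definition spectrum_with_multiplicity_two :: "oper \<Rightarrow> complex set \<Rightarrow> bool" where
  "spectrum_with_multiplicity_two A S \<longleftrightarrow>
     selfadjoint_in ell2 A \<and> spectrum ell2 A = S \<and>
     orthogonal_direct_sum ell2 V0 V1 \<and> preserves_summands A V0 V1 \<and>
     (\<forall>W\<in>{V0, V1}. simple_spectrum W (part_in W A) \<and> spectrum W (part_in W A) = S)"


subsection \<open>The representation\<close>

definition fin_span :: "vec set" where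
  "fin_span = lin_span (range basis_vec)"

text \<open>The linear map on \<open>fin_span\<close> with \<open>basis_vec n \<mapsto> B n\<close>.\<close>

definition linear_ext :: "(nat \<Rightarrow> vec) \<Rightarrow> vec \<Rightarrow> vec" where
  "linear_ext B f = (\<Sum>n | f n \<noteq> 0. cscale (f n) (B n))"

definition b_plus :: "real \<Rightarrow> vec \<Rightarrow> vec" where
  "b_plus a = linear_ext (\<lambda>m.
     if even m then cscale (sqrt (2 * (real (m div 2) + a))) (basis_vec (m + 1))
     else cscale (sqrt (2 * (real (m div 2) + 1))) (basis_vec (m + 1)))"

definition b_minus :: "real \<Rightarrow> vec \<Rightarrow> vec" where
  "b_minus a = linear_ext (\<lambda>m.
     if m = 0 then 0
     else if even m then cscale (sqrt (2 * real (m div 2))) (basis_vec (m - 1))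
     else cscale (sqrt (2 * (real (m div 2) + a))) (basis_vec (m - 1)))"

lemma linear_ext_basis_vec [simp]: "linear_ext B (basis_vec n) = B n"
proof -
  have "{m. basis_vec n m \<noteq> 0} = {n}"
    by (auto simp: basis_vec_def)
  then show ?thesis
    by (simp add: linear_ext_def) (simp add: basis_vec_def cscale_def)
qed

lemma b_plus_e:
  "b_plus a (basis_vec (2 * n)) = cscale (sqrt (2 * (real n + a))) (basis_vec (2 * n + 1))"
  "b_plus a (basis_vec (2 * n + 1)) = cscale (sqrt (2 * (real n + 1))) (basis_vec (2 * n + 2))"
  by (simp_all add: b_plus_def)

lemma b_minus_e:
  "b_minus a (basis_vec 0) = 0"
  "n > 0 \<Longrightarrow> b_minus a (basis_vec (2 * n)) = cscale (sqrt (2 * real n)) (basis_vec (2 * n - 1))"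
  "b_minus a (basis_vec (2 * n + 1)) = cscale (sqrt (2 * (real n + a))) (basis_vec (2 * n))"
  by (simp_all add: b_minus_def fun_eq_iff)

definition x_op :: "real \<Rightarrow> vec \<Rightarrow> vec" where
  "x_op a f = cscale (1 / sqrt 2) (b_plus a f + b_minus a f)"

definition p_op :: "real \<Rightarrow> vec \<Rightarrow> vec" where
  "p_op a f = cscale (\<i> / sqrt 2) (b_plus a f - b_minus a f)"

definition H_b :: "real \<Rightarrow> vec \<Rightarrow> vec" where
  "H_b a f = cscale (1 / 2) (x_op a (p_op a f) + p_op a (x_op a f))"

text \<open>The operator in \<open>ell2\<close>: the closure of \<open>H_b a\<close> on finite linear combinations.\<close>

definition H_b_closed :: "real \<Rightarrow> oper" where
  "H_b_closed a = op_closure (graph_on fin_span (H_b a))"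

definition formal_eigenvector :: "(vec \<Rightarrow> vec) \<Rightarrow> complex \<Rightarrow> vec \<Rightarrow> bool" where
  "formal_eigenvector T E c \<longleftrightarrow> c \<noteq> 0 \<and>
     (\<forall>m. finite {n. T (basis_vec n) m \<noteq> 0} \<and>
          (\<Sum>n | T (basis_vec n) m \<noteq> 0. c n * T (basis_vec n) m) = E * c m)"


subsection \<open>The coefficients\<close>

text \<open>\<open>hyp2F1_neg n b c z\<close> is the terminating series with upper parameters \<open>-n\<close> and \<open>b\<close>.\<close>

definition hyp2F1_neg :: "nat \<Rightarrow> complex \<Rightarrow> complex \<Rightarrow> complex \<Rightarrow> complex" where
  "hyp2F1_neg n b c z =
     (\<Sum>k\<le>n. pochhammer (- of_nat n) k * pochhammer b k / (pochhammer c k * fact k) * z ^ k)"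

definition alpha_even :: "real \<Rightarrow> real \<Rightarrow> nat \<Rightarrow> complex" where
  "alpha_even a E n =
     (-1) ^ n * complex_of_real (sqrt (pochhammer a n / fact n)) *
     complex_of_real (cmod (Gamma ((a + \<i> * E) / 2)) / sqrt (2 powr (2 - a) * pi * Gamma a)) *
     hyp2F1_neg n ((a + \<i> * E) / 2) a 2"

definition alpha_odd :: "real \<Rightarrow> real \<Rightarrow> nat \<Rightarrow> complex" where
  "alpha_odd a E n =
     (-1) ^ n * complex_of_real (sqrt (pochhammer (a + 1) n / fact n)) *
     complex_of_real (cmod (Gamma ((a + 1 + \<i> * E) / 2)) / sqrt (2 powr (1 - a) * pi * Gamma (a + 1))) *
     hyp2F1_neg n ((a + 1 + \<i> * E) / 2) (a + 1) 2"

definition u0 :: "real \<Rightarrow> real \<Rightarrow> vec" where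
  "u0 a E = (\<lambda>m. if even m then alpha_even a E (m div 2) else 0)"

definition u1 :: "real \<Rightarrow> real \<Rightarrow> vec" where
  "u1 a E = (\<lambda>m. if odd m then alpha_odd a E (m div 2) else 0)"

end

theory Submission
  imports Defs "HOL-Probability.Probability" "HOL-Complex_Analysis.Complex_Analysis"
begin

text \<open>
  On each of \<open>V0\<close> and \<open>V1\<close> the operator is, up to the phases \<open>(-\<i>)\<^sup>n\<close>, the Jacobi matrix with weights
  \<open>A n = sqrt ((n + 1) (n + c))\<close>, where \<open>c = a\<close> or \<open>c = a + 1\<close>. Linear growth of the weights makes finite
  sequences a core, so the closure is the maximal operator and is self-adjoint.

  The formal eigenvectors are Meixner-Pollaczek polynomials in \<open>E\<close>, orthogonal for the weight
  \<open>|\<Gamma>(b)|\<^sup>2\<close> with \<open>b = (c + \<i>E)/2\<close>: shifting the contour in the integral of \<open>\<Gamma>(b + k) \<Gamma>(c - b + 1)\<close> by \<open>b \<mapsto> b + 1\<close>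
  gives \<open>2 L((b)\<^sub>k\<^sub>+\<^sub>1) = (c + k) L((b)\<^sub>k)\<close> for the integration functional \<open>L\<close>, hence \<open>L((b)\<^sub>k) = (c)\<^sub>k L(1) / 2\<^sup>k\<close> and
  \<open>L(\<^sub>2F\<^sub>1(-n, b; c; 2)) = (1 - 1)\<^sup>n L(1)\<close>. The weight decays exponentially, so polynomials are complete, and
  expansion in them maps the operator unitarily to multiplication by \<open>E\<close>. The weight is positive
  everywhere, so that operator has spectrum \<open>\<real>\<close>, and it is simple because the constant function \<open>1\<close> is
  cyclic.
\<close>

subsection \<open>Square-summable sequences\<close>

text \<open>Exact orthogonality is needed only in the zeroth row: multiplication by the coordinate
  is symmetric, so the three-term recurrence carries the integrals of the polynomials to their whole
  Gram matrix. The real obstacle is that the coordinate is unbounded. If \<open>v\<close> has the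
  coefficients that \<open>x * u\<close> ought to have, it is not known beforehand that
  \<open>x * u\<close> is square integrable. Moments are therefore shown to determine functions that
  are merely integrable against an exponential, a class that survives multiplication by powers at
  the cost of a smaller exponent. The polynomials enter conjugated, because coefficients are inner
  products, conjugate-linear in the first argument, and it is the coefficients that must obey the
  eigenvector equation. The decay of Gamma has a single source, the reflection formula on the line
  Re z = 1/2; the functional equation moves it to the lines Re z = N + 1/2, and a monotonicity in
  the real part fills in the strips between them.\<close>

lemma ell2D: "f \<in> ell2 \<Longrightarrow> summable (\<lambda>n. (cmod (f n))\<^sup>2)"
  by (simp add: ell2_def)

lemma L2_set_le_l2norm:
  assumes "f \<in> ell2"
  shows "L2_set (\<lambda>i. cmod (f i)) {..<n} \<le> l2norm f"
  unfolding L2_set_def l2norm_def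
  by (intro real_sqrt_le_mono sum_le_suminf) (use ell2D[OF assms] in auto)

lemma l2norm_nonneg [simp]: "l2norm f \<ge> 0" if "f \<in> ell2"
  using ell2D[OF that] by (simp add: l2norm_def suminf_nonneg)

text \<open>A bound on all finite sections gives membership and the norm estimate together, so
  Minkowski's inequality can be taken from the finite \<open>L2_set\<close>.\<close>

lemma l2norm_leI:
  assumes "\<And>n. L2_set (\<lambda>i. cmod (f i)) {..<n} \<le> C"
  shows "f \<in> ell2" "l2norm f \<le> C"
proof -
  have "C \<ge> 0" using assms[of 0] by simp
  have *: "(\<Sum>i<n. (cmod (f i))\<^sup>2) \<le> C\<^sup>2" for n
    using assms[of n] \<open>C \<ge> 0\<close> by (auto simp: L2_set_def intro: sqrt_le_D)
  show "f \<in> ell2"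
    unfolding ell2_def using * by (auto intro!: summableI_nonneg_bounded)
  then show "l2norm f \<le> C"
    unfolding l2norm_def using * \<open>C \<ge> 0\<close>
    by (intro real_le_lsqrt suminf_le_const suminf_nonneg ell2D) auto
qed

lemma l2norm_power2: "f \<in> ell2 \<Longrightarrow> (l2norm f)\<^sup>2 = (\<Sum>n. (cmod (f n))\<^sup>2)"
  by (simp add: l2norm_def suminf_nonneg ell2D)

lemma assumes "f \<in> ell2" "g \<in> ell2"
  shows ell2_add [simp]: "f + g \<in> ell2" and l2norm_triangle: "l2norm (f + g) \<le> l2norm f + l2norm g"
proof -
  have "L2_set (\<lambda>i. cmod ((f + g) i)) {..<n} \<le> l2norm f + l2norm g" for n
  proof -
    have "L2_set (\<lambda>i. cmod ((f + g) i)) {..<n} \<le> L2_set (\<lambda>i. cmod (f i) + cmod (g i)) {..<n}"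
      by (intro L2_set_mono) (auto simp: norm_triangle_ineq)
    also have "\<dots> \<le> L2_set (\<lambda>i. cmod (f i)) {..<n} + L2_set (\<lambda>i. cmod (g i)) {..<n}"
      by (rule L2_set_triangle_ineq)
    finally show ?thesis
      using L2_set_le_l2norm[OF assms(1), of n] L2_set_le_l2norm[OF assms(2), of n] by linarith
  qed
  then show "f + g \<in> ell2" "l2norm (f + g) \<le> l2norm f + l2norm g"
    using l2norm_leI by blast+
qed

lemma ell2_cscale [simp]: "f \<in> ell2 \<Longrightarrow> cscale z f \<in> ell2"
  by (simp add: ell2_def cscale_def norm_mult power_mult_distrib summable_mult)

lemma ell2_zero [simp]: "0 \<in> ell2" and l2norm_zero [simp]: "l2norm 0 = 0"
  by (simp_all add: ell2_def l2norm_def)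

lemma cscale_simps:
  "cscale z (f + g) = cscale z f + cscale z g" "cscale z (f - g) = cscale z f - cscale z g"
  "cscale z (cscale w f) = cscale (z * w) f" "cscale 1 f = f" "cscale 0 f = 0" "cscale z 0 = 0"
  "cscale (z + w) f = cscale z f + cscale w f" "cscale (z - w) f = cscale z f - cscale w f"
  by (auto simp: cscale_def fun_eq_iff algebra_simps)

lemma diff_conv_cscale: "f - g = f + cscale (- 1) g"
  by (auto simp: cscale_def fun_eq_iff)

lemma ell2_diff [simp]: "f \<in> ell2 \<Longrightarrow> g \<in> ell2 \<Longrightarrow> f - g \<in> ell2"
  by (simp add: diff_conv_cscale)

lemma component_le_l2norm: "f \<in> ell2 \<Longrightarrow> cmod (f m) \<le> l2norm f"
  using L2_set_le_l2norm[of f "Suc m"] member_le_L2_set[of "{..<Suc m}" m "\<lambda>i. cmod (f i)"] by simp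

lemma l2norm_eq_0: "f \<in> ell2 \<Longrightarrow> l2norm f = 0 \<longleftrightarrow> f = 0"
  using component_le_l2norm[of f] by (metis ext l2norm_zero norm_le_zero_iff zero_fun_apply)

lemma ip_summable:
  assumes "f \<in> ell2" "g \<in> ell2"
  shows "summable (\<lambda>n. cmod (cnj (f n) * g n))"
    and "(\<Sum>n. cmod (cnj (f n) * g n)) \<le> l2norm f * l2norm g"
proof -
  have *: "(\<Sum>i<n. cmod (cnj (f i) * g i)) \<le> l2norm f * l2norm g" for n
  proof -
    have "(\<Sum>i<n. cmod (cnj (f i) * g i)) = (\<Sum>i<n. \<bar>cmod (f i)\<bar> * \<bar>cmod (g i)\<bar>)"
      by (simp add: norm_mult)
    also have "\<dots> \<le> L2_set (\<lambda>i. cmod (f i)) {..<n} * L2_set (\<lambda>i. cmod (g i)) {..<n}"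
      by (rule L2_set_mult_ineq)
    also have "\<dots> \<le> l2norm f * l2norm g"
      by (intro mult_mono L2_set_le_l2norm assms L2_set_nonneg l2norm_nonneg)
    finally show ?thesis .
  qed
  show "summable (\<lambda>n. cmod (cnj (f n) * g n))"
    by (rule summableI_nonneg_bounded[OF _ *]) auto
  then show "(\<Sum>n. cmod (cnj (f n) * g n)) \<le> l2norm f * l2norm g"
    using * by (intro suminf_le_const) auto
qed

lemma Cauchy_Schwarz_ip:
  assumes "f \<in> ell2" "g \<in> ell2"
  shows "cmod (ip f g) \<le> l2norm f * l2norm g"
  unfolding ip_def using summable_norm[OF ip_summable(1)[OF assms]] ip_summable(2)[OF assms] by linarith

lemma ip_add_right: "f \<in> ell2 \<Longrightarrow> g \<in> ell2 \<Longrightarrow> h \<in> ell2 \<Longrightarrow> ip f (g + h) = ip f g + ip f h"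
  unfolding ip_def using suminf_add[OF summable_norm_cancel summable_norm_cancel, OF ip_summable(1) ip_summable(1), of f g f h]
  by (simp add: algebra_simps)

lemma ip_cscale_right: "f \<in> ell2 \<Longrightarrow> g \<in> ell2 \<Longrightarrow> ip f (cscale z g) = z * ip f g"
  unfolding ip_def cscale_def using suminf_mult[OF summable_norm_cancel, OF ip_summable(1), of f g z]
  by (simp add: algebra_simps)

lemma ip_commute: "f \<in> ell2 \<Longrightarrow> g \<in> ell2 \<Longrightarrow> ip g f = cnj (ip f g)"
  unfolding ip_def
  using sums_cnj[THEN iffD2, OF summable_sums[OF summable_norm_cancel, OF ip_summable(1)], of f g]
  by (auto dest!: sums_unique simp: mult.commute)

lemma ip_diff_right: "f \<in> ell2 \<Longrightarrow> g \<in> ell2 \<Longrightarrow> h \<in> ell2 \<Longrightarrow> ip f (g - h) = ip f g - ip f h"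
  by (simp add: diff_conv_cscale ip_add_right ip_cscale_right)

lemma ip_self: "f \<in> ell2 \<Longrightarrow> ip f f = of_real ((l2norm f)\<^sup>2)"
  by (simp add: l2norm_power2 ip_def suminf_of_real ell2D complex_norm_square mult.commute flip: of_real_power)

lemma ip_tendsto_right:
  assumes "\<And>k. s k \<in> ell2" "f \<in> ell2" "g \<in> ell2" "(\<lambda>k. l2norm (s k - f)) \<longlonglongrightarrow> 0"
  shows "(\<lambda>k. ip g (s k)) \<longlonglongrightarrow> ip g f"
proof -
  have "(\<lambda>k. ip g (s k) - ip g f) \<longlonglongrightarrow> 0"
  proof (rule Lim_null_comparison)
    show "\<forall>\<^sub>F k in sequentially. norm (ip g (s k) - ip g f) \<le> l2norm g * l2norm (s k - f)"
      using Cauchy_Schwarz_ip[of g "s _ - f"] assms by (auto simp: ip_diff_right[symmetric])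
    show "(\<lambda>k. l2norm g * l2norm (s k - f)) \<longlonglongrightarrow> 0"
      using tendsto_mult_right_zero[OF assms(4)] by simp
  qed
  then show ?thesis by (simp add: LIM_zero_iff)
qed

lemma ip_tendsto_left:
  assumes "\<And>k. s k \<in> ell2" "f \<in> ell2" "g \<in> ell2" "(\<lambda>k. l2norm (s k - f)) \<longlonglongrightarrow> 0"
  shows "(\<lambda>k. ip (s k) g) \<longlonglongrightarrow> ip f g"
  using tendsto_cnj[OF ip_tendsto_right[OF assms]] assms by (simp flip: ip_commute)

lemma ip_basis_vec: "ip (basis_vec m) f = f m"
proof -
  have "(\<lambda>n. cnj (basis_vec m n) * f n) = (\<lambda>n. if n = m then f n else 0)"
    by (auto simp: basis_vec_def)
  then show ?thesis
    using sums_single[of m f] unfolding ip_def by (simp add: sums_iff)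
qed

lemma component_tendsto:
  assumes "\<And>k. s k \<in> ell2" "f \<in> ell2" "(\<lambda>k. l2norm (s k - f)) \<longlonglongrightarrow> 0"
  shows "(\<lambda>k. s k m) \<longlonglongrightarrow> f m"
proof -
  have "(\<lambda>k. s k m - f m) \<longlonglongrightarrow> 0"
    by (rule Lim_null_comparison[OF _ assms(3)])
       (use component_le_l2norm[of "s _ - f" m] assms in auto)
  then show ?thesis by (simp add: LIM_zero_iff)
qed

section \<open>Linear spans and coordinate subspaces\<close>

lemma sum_apply: "(\<Sum>i\<in>I. f i) m = (\<Sum>i\<in>I. f i m)" for f :: "'i \<Rightarrow> vec"
  by (induction I rule: infinite_finite_induct) auto

lemma lin_spanI:
  assumes "finite F" "F \<subseteq> S"
  shows "(\<Sum>v\<in>F. cscale (c v) v) \<in> lin_span S"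
  using assms by (auto simp: lin_span_def)

lemma lin_span_base: "v \<in> S \<Longrightarrow> cscale z v \<in> lin_span S"
  using lin_spanI[of "{v}" S "\<lambda>_. z"] by simp

lemma lin_span_0: "0 \<in> lin_span S"
  using lin_spanI[of "{}" S] by simp

lemma lin_span_add:
  assumes "f \<in> lin_span S" "g \<in> lin_span S"
  shows "f + g \<in> lin_span S"
proof -
  obtain F c where F: "finite F" "F \<subseteq> S" "f = (\<Sum>v\<in>F. cscale (c v) v)"
    using assms(1) by (auto simp: lin_span_def)
  obtain G d where G: "finite G" "G \<subseteq> S" "g = (\<Sum>v\<in>G. cscale (d v) v)"
    using assms(2) by (auto simp: lin_span_def)
  let ?c = "\<lambda>v. if v \<in> F then c v else 0" and ?d = "\<lambda>v. if v \<in> G then d v else 0"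
  have "f = (\<Sum>v\<in>F \<union> G. cscale (?c v) v)"
    unfolding F(3) by (rule sum.mono_neutral_cong_left) (use F G in \<open>auto simp: cscale_simps\<close>)
  moreover have "g = (\<Sum>v\<in>F \<union> G. cscale (?d v) v)"
    unfolding G(3) by (rule sum.mono_neutral_cong_left) (use F G in \<open>auto simp: cscale_simps\<close>)
  ultimately have "f + g = (\<Sum>v\<in>F \<union> G. cscale (?c v + ?d v) v)"
    by (simp add: cscale_simps(7) sum.distrib)
  then show ?thesis
    using lin_spanI[of "F \<union> G" S "\<lambda>v. ?c v + ?d v"] F G by auto
qed

lemma lin_span_sum: "(\<And>i. i \<in> I \<Longrightarrow> f i \<in> lin_span S) \<Longrightarrow> (\<Sum>i\<in>I. f i) \<in> lin_span S"
  by (induction I rule: infinite_finite_induct) (auto simp: lin_span_0 lin_span_add)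

text \<open>\<open>V0\<close>, \<open>V1\<close> and the whole space are all of this form, so
  self-adjointness can be proved once, for index sets invariant under the shift by 2.\<close>

definition ell2_on :: "nat set \<Rightarrow> vec set" where
  "ell2_on K = {f \<in> ell2. \<forall>m. m \<notin> K \<longrightarrow> f m = 0}"

lemma ell2_on_UNIV: "ell2_on UNIV = ell2"
  by (simp add: ell2_on_def)

lemma ell2_on_ell2: "f \<in> ell2_on K \<Longrightarrow> f \<in> ell2"
  by (simp add: ell2_on_def)

lemma finite_support_ell2: "finite {m. f m \<noteq> 0} \<Longrightarrow> f \<in> ell2"
  unfolding ell2_def by (auto intro!: summable_finite[where N = "{m. f m \<noteq> 0}"])

lemma lin_span_basis_vec:
  "lin_span (basis_vec ` K) = {f. finite {m. f m \<noteq> 0} \<and> {m. f m \<noteq> 0} \<subseteq> K}"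
proof (intro set_eqI iffI)
  fix f assume "f \<in> lin_span (basis_vec ` K)"
  then obtain F c where F: "finite F" "F \<subseteq> basis_vec ` K" "f = (\<Sum>v\<in>F. cscale (c v) v)"
    by (auto simp: lin_span_def)
  then obtain I where I: "I \<subseteq> K" "finite I" "F = basis_vec ` I"
    by (meson finite_subset_image)
  have "f m = 0" if "m \<notin> I" for m
    using that by (auto simp: F(3) I(3) sum_apply cscale_def basis_vec_def intro!: sum.neutral)
  then have "{m. f m \<noteq> 0} \<subseteq> I" by auto
  then show "f \<in> {f. finite {m. f m \<noteq> 0} \<and> {m. f m \<noteq> 0} \<subseteq> K}"
    using I finite_subset by auto
next
  fix f :: vec assume "f \<in> {f. finite {m. f m \<noteq> 0} \<and> {m. f m \<noteq> 0} \<subseteq> K}"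
  then have f: "finite {m. f m \<noteq> 0}" "{m. f m \<noteq> 0} \<subseteq> K" by auto
  have "f = (\<Sum>n | f n \<noteq> 0. cscale (f n) (basis_vec n))"
  proof
    fix m
    show "f m = (\<Sum>n | f n \<noteq> 0. cscale (f n) (basis_vec n)) m"
      using f(1) by (auto simp: sum_apply cscale_def basis_vec_def if_distrib cong: if_cong)
  qed
  also have "\<dots> \<in> lin_span (basis_vec ` K)"
    using f by (intro lin_span_sum lin_span_base) auto
  finally show "f \<in> lin_span (basis_vec ` K)" .
qed

lemma truncation_tendsto:
  assumes "f \<in> ell2"
  shows "(\<lambda>N. l2norm ((\<lambda>m. if m < N then f m else 0) - f)) \<longlonglongrightarrow> 0"
proof -
  have eq: "l2norm ((\<lambda>m. if m < N then f m else 0) - f) = sqrt (\<Sum>n. (cmod (f (n + N)))\<^sup>2)" for N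
  proof -
    let ?g = "\<lambda>n. (cmod (((\<lambda>m. if m < N then f m else 0) - f) n))\<^sup>2"
    have "summable (\<lambda>n. ?g (n + N))"
      using summable_ignore_initial_segment[OF ell2D[OF assms], of N] by simp
    then have "summable ?g" by (rule summable_iff_shift[of ?g N, THEN iffD1])
    then have "suminf ?g = (\<Sum>n. ?g (n + N)) + (\<Sum>i<N. ?g i)"
      by (rule suminf_split_initial_segment)
    then show ?thesis by (simp add: l2norm_def)
  qed
  show ?thesis
    unfolding eq using tendsto_real_sqrt[OF suminf_exist_split2[OF ell2D[OF assms]]] by simp
qed

lemma closed_span_basis_vec: "closed_span (basis_vec ` K) = ell2_on K"
proof (intro set_eqI iffI)
  fix f assume "f \<in> closed_span (basis_vec ` K)"
  then obtain s where f: "f \<in> ell2" and s: "\<And>k. s k \<in> lin_span (basis_vec ` K)"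
    and lim: "(\<lambda>k. l2norm (s k - f)) \<longlonglongrightarrow> 0"
    by (auto simp: closed_span_def l2_closure_def)
  have s': "s k \<in> ell2" "m \<notin> K \<Longrightarrow> s k m = 0" for k m
    using s[of k] by (auto simp: lin_span_basis_vec finite_support_ell2)
  have "f m = 0" if "m \<notin> K" for m
    using component_tendsto[OF s'(1) f lim, of m] s'(2)[OF that] by (simp add: LIMSEQ_const_iff)
  then show "f \<in> ell2_on K" using f by (simp add: ell2_on_def)
next
  fix f assume f: "f \<in> ell2_on K"
  have "(\<lambda>m. if m < N then f m else 0) \<in> lin_span (basis_vec ` K)" for N
  proof -
    have "finite {m. (if m < N then f m else 0) \<noteq> 0}"
      by (rule finite_subset[of _ "{..<N}"]) auto
    then show ?thesis using f by (auto simp: lin_span_basis_vec ell2_on_def split: if_splits)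
  qed
  then show "f \<in> closed_span (basis_vec ` K)"
    using truncation_tendsto[of f] f
    by (auto simp: closed_span_def l2_closure_def ell2_on_def
             intro!: exI[of _ "\<lambda>N m. if m < N then f m else 0"])
qed

lemma fin_span_iff: "f \<in> fin_span \<longleftrightarrow> finite {m. f m \<noteq> 0}"
  by (simp add: fin_span_def lin_span_basis_vec)

abbreviation residue_class :: "nat \<Rightarrow> nat set" where
  "residue_class j \<equiv> {m. m mod 2 = j}"

lemma V_eq: "V0 = ell2_on (residue_class 0)" "V1 = ell2_on (residue_class 1)"
proof -
  have range: "range (\<lambda>n. 2 * n + j) = residue_class j" if "j < 2" for j :: nat
  proof (intro set_eqI iffI)
    show "m \<in> range (\<lambda>n. 2 * n + j)" if "m \<in> residue_class j" for m
      using that by (intro range_eqI[where x = "m div 2"]) (simp, presburger)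
  qed (use that in auto)
  have "closed_span (range (\<lambda>n. basis_vec (2 * n + j))) = ell2_on (residue_class j)" if "j < 2" for j
    unfolding range[OF that, symmetric] closed_span_basis_vec[symmetric] image_image ..
  from this[of 0] this[of 1] show "V0 = ell2_on (residue_class 0)" "V1 = ell2_on (residue_class 1)"
    unfolding V0_def V1_def by simp_all
qed

lemma residue_class_add_2: "m + 2 \<in> residue_class j \<longleftrightarrow> m \<in> residue_class j"
  by simp

subsection \<open>The ladder operators and the maximal Jacobi operator\<close>

lemma ell2_mono:
  assumes "g \<in> ell2" "\<And>m. cmod (f m) \<le> cmod (g m)"
  shows "f \<in> ell2"
  unfolding ell2_def
  by (auto intro!: summable_comparison_test'[OF ell2D[OF assms(1)], of 0] power_mono assms(2))

lemma ell2_shift: 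
  assumes "f \<in> ell2"
  shows "(\<lambda>m. f (m + k)) \<in> ell2" "(\<lambda>m. if m < k then 0 else f (m - k)) \<in> ell2"
proof -
  show "(\<lambda>m. f (m + k)) \<in> ell2"
    using summable_ignore_initial_segment[OF ell2D[OF assms], of k] by (simp add: ell2_def)
  have "summable (\<lambda>m. (cmod (if m + k < k then 0 else f (m + k - k)))\<^sup>2)"
    using ell2D[OF assms] by simp
  then show "(\<lambda>m. if m < k then 0 else f (m - k)) \<in> ell2"
    unfolding ell2_def
    using summable_iff_shift[of "\<lambda>m. (cmod (if m < k then 0 else f (m - k)))\<^sup>2" k] by simp
qed

text \<open>Dominated convergence for the counting measure: one square-summable majorant upgrades
  convergence of the components to convergence in norm.\<close>

lemma l2norm_dominated_tendsto:
  assumes "g \<in> ell2" "\<And>k m. cmod (s k m) \<le> cmod (g m)" "\<And>m. (\<lambda>k. s k m) \<longlonglongrightarrow> 0"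
  shows "(\<lambda>k. l2norm (s k)) \<longlonglongrightarrow> 0"
proof -
  have "(\<lambda>k. \<integral>m. (cmod (s k m))\<^sup>2 \<partial>count_space UNIV) \<longlonglongrightarrow> (\<integral>m. 0 \<partial>count_space (UNIV :: nat set))"
  proof (rule integral_dominated_convergence[where w = "\<lambda>m. (cmod (g m))\<^sup>2"])
    show "integrable (count_space UNIV) (\<lambda>m. (cmod (g m))\<^sup>2)"
      using ell2D[OF assms(1)] by (simp add: integrable_count_space_nat_iff)
    show "AE m in count_space UNIV. (\<lambda>k. (cmod (s k m))\<^sup>2) \<longlonglongrightarrow> 0"
      using tendsto_norm_zero[OF assms(3)] by simp
  qed (auto intro!: power_mono assms(2))
  moreover have "(\<integral>m. (cmod (s k m))\<^sup>2 \<partial>count_space UNIV) = (\<Sum>m. (cmod (s k m))\<^sup>2)" for k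
    using ell2D[OF ell2_mono[OF assms(1,2)]]
    by (intro integral_count_space_nat) (simp add: integrable_count_space_nat_iff)
  ultimately show ?thesis
    unfolding l2norm_def using tendsto_real_sqrt by fastforce
qed

lemma ip_add_left: "f \<in> ell2 \<Longrightarrow> g \<in> ell2 \<Longrightarrow> h \<in> ell2 \<Longrightarrow> ip (f + g) h = ip f h + ip g h"
  by (metis complex_cnj_add ell2_add ip_add_right ip_commute)

lemma ip_cscale_left: "f \<in> ell2 \<Longrightarrow> g \<in> ell2 \<Longrightarrow> ip (cscale z f) g = cnj z * ip f g"
  by (metis complex_cnj_mult ell2_cscale ip_cscale_right ip_commute)

lemma ip_zero_left [simp]: "ip 0 f = 0"
  by (simp add: ip_def)

lemma basis_vec_ell2 [simp]: "basis_vec m \<in> ell2"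
  by (rule finite_support_ell2) (simp add: basis_vec_def)

text \<open>The matrix entry of \<open>b_plus\<close> from index \<open>m\<close> to
  \<open>m + 1\<close>, and equally that of \<open>b_minus\<close> from \<open>m + 1\<close> to
  \<open>m\<close>; parity decides between \<open>a\<close> and 1.\<close>

definition ladder_coeff :: "real \<Rightarrow> nat \<Rightarrow> real" where
  "ladder_coeff a m = sqrt (2 * (real (m div 2) + (if even m then a else 1)))"

definition jacobi_weight :: "real \<Rightarrow> nat \<Rightarrow> real" where
  "jacobi_weight a m = ladder_coeff a m * ladder_coeff a (Suc m) / 2"

text \<open>Total on all sequences, since each component involves at most two entries. Finite
  vectors, formal eigenvectors and the maximal domain can thus share one expression. The guard
  \<open>m < 2\<close> keeps truncated subtraction from producing a spurious entry.\<close>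

definition jacobi_op :: "real \<Rightarrow> vec \<Rightarrow> vec" where
  "jacobi_op a f = (\<lambda>m. \<i> * ((if m < 2 then 0 else complex_of_real (jacobi_weight a (m - 2)) * f (m - 2))
     - complex_of_real (jacobi_weight a m) * f (m + 2)))"

lemma linear_ext_apply: "linear_ext B f m = (\<Sum>n | f n \<noteq> 0. f n * B n m)"
  by (simp add: linear_ext_def sum_apply cscale_def)

lemma b_plus_apply:
  assumes "f \<in> fin_span"
  shows "b_plus a f m = (if m = 0 then 0 else complex_of_real (ladder_coeff a (m - 1)) * f (m - 1))"
proof (cases m)
  case (Suc l)
  have "b_plus a f m = (\<Sum>n | f n \<noteq> 0. if n = l then f n * complex_of_real (ladder_coeff a n) else 0)"
    unfolding b_plus_def linear_ext_apply
    by (intro sum.cong) (auto simp: Suc basis_vec_def cscale_def ladder_coeff_def)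
  then show ?thesis using assms by (simp add: Suc fin_span_iff)
qed (auto simp: b_plus_def linear_ext_apply basis_vec_def cscale_def intro!: sum.neutral)

lemma b_minus_apply:
  assumes "f \<in> fin_span"
  shows "b_minus a f m = complex_of_real (ladder_coeff a m) * f (m + 1)"
proof -
  have "b_minus a f m = (\<Sum>n | f n \<noteq> 0. if n = m + 1 then f n * complex_of_real (ladder_coeff a m) else 0)"
    unfolding b_minus_def linear_ext_apply
  proof (intro sum.cong refl)
    fix n
    show "f n * (if n = 0 then 0
        else if even n then cscale (complex_of_real (sqrt (2 * real (n div 2)))) (basis_vec (n - 1))
        else cscale (complex_of_real (sqrt (2 * (real (n div 2) + a)))) (basis_vec (n - 1))) m =
      (if n = m + 1 then f n * complex_of_real (ladder_coeff a m) else 0)"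
      by (cases n) (auto simp: basis_vec_def cscale_def ladder_coeff_def algebra_simps)
  qed
  then show ?thesis using assms by (simp add: fin_span_iff)
qed

lemma fin_spanI: "(\<And>m. m \<ge> N \<Longrightarrow> f m = 0) \<Longrightarrow> f \<in> fin_span"
  unfolding fin_span_iff by (rule finite_subset[of _ "{..<N}"]) (auto simp: not_le[symmetric])

lemma fin_span_bound:
  assumes "f \<in> fin_span" shows "\<exists>N. \<forall>m\<ge>N. f m = 0"
proof -
  obtain N where "\<forall>m\<in>{m. f m \<noteq> 0}. m < N"
    using assms unfolding fin_span_iff finite_nat_set_iff_bounded by blast
  then show ?thesis by (intro exI[of _ N]) auto
qed

lemma fin_span_b:
  assumes "f \<in> fin_span"
  shows "b_plus a f \<in> fin_span" "b_minus a f \<in> fin_span"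
proof -
  obtain N where "\<forall>m\<ge>N. f m = 0" using fin_span_bound[OF assms] by blast
  then show "b_plus a f \<in> fin_span" "b_minus a f \<in> fin_span"
    by (auto intro!: fin_spanI[of "Suc N"] simp: b_plus_apply b_minus_apply assms)
qed

lemma fin_span_xp:
  assumes "f \<in> fin_span"
  shows "x_op a f \<in> fin_span" "p_op a f \<in> fin_span"
proof -
  obtain N where "\<forall>m\<ge>N. f m = 0" using fin_span_bound[OF assms] by blast
  then show "x_op a f \<in> fin_span" "p_op a f \<in> fin_span"
    by (auto intro!: fin_spanI[of "Suc N"] simp: x_op_def p_op_def cscale_def b_plus_apply b_minus_apply assms)
qed

text \<open>The mixed products of \<open>b_plus\<close> and \<open>b_minus\<close> occur in
  \<open>x p\<close> and \<open>p x\<close> with opposite signs and cancel. Finite support is what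
  makes \<open>linear_ext\<close> act componentwise.\<close>

lemma H_b_conv_ladder:
  assumes "f \<in> fin_span"
  shows "H_b a f = cscale (\<i> / 2) (b_plus a (b_plus a f) - b_minus a (b_minus a f))"
proof
  fix m
  have "complex_of_real (sqrt 2) * complex_of_real (sqrt 2) = 2"
    by (simp flip: of_real_mult)
  then have s: "complex_of_real (sqrt 2) * (complex_of_real (sqrt 2) * x) = 2 * x" for x
    by (simp flip: mult.assoc)
  show "H_b a f m = cscale (\<i> / 2) (b_plus a (b_plus a f) - b_minus a (b_minus a f)) m"
    unfolding H_b_def cscale_def plus_fun_apply x_op_def[of a "p_op a f"] p_op_def[of a "x_op a f"]
    by (simp add: b_plus_apply b_minus_apply fin_span_b fin_span_xp assms)
       (auto simp: x_op_def p_op_def cscale_def b_plus_apply b_minus_apply assms field_simps s)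
qed

lemma H_b_conv_jacobi_op:
  assumes "f \<in> fin_span"
  shows "H_b a f = jacobi_op a f"
proof
  fix m
  consider "m = 0" | "m = 1" | k where "m = Suc (Suc k)"
    by (cases m; cases "m - 1") auto
  then show "H_b a f m = jacobi_op a f m"
    by cases (simp_all add: H_b_conv_ladder assms cscale_def b_plus_apply b_minus_apply fin_span_b
      jacobi_op_def jacobi_weight_def algebra_simps)
qed

lemma jacobi_op_simps:
  "jacobi_op a 0 = 0"
  "jacobi_op a (f + g) = jacobi_op a f + jacobi_op a g"
  "jacobi_op a (cscale z f) = cscale z (jacobi_op a f)"
  by (auto simp: jacobi_op_def cscale_def fun_eq_iff algebra_simps)

lemma jacobi_op_basis_vec:
  "jacobi_op a (basis_vec m) = cscale (\<i> * complex_of_real (jacobi_weight a m)) (basis_vec (m + 2)) +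
     (if m < 2 then 0 else cscale (- \<i> * complex_of_real (jacobi_weight a (m - 2))) (basis_vec (m - 2)))"
  by (auto simp: jacobi_op_def cscale_def basis_vec_def fun_eq_iff)

text \<open>Row \<open>m\<close> of the matrix has entries only in columns \<open>m - 2\<close> and
  \<open>m + 2\<close>, so the sum demanded by \<open>formal_eigenvector\<close> is the component
  \<open>m\<close> of \<open>jacobi_op\<close>.\<close>

lemma formal_eigenvector_H_b:
  assumes "c \<noteq> 0" "jacobi_op a c = cscale E c"
  shows "formal_eigenvector (H_b a) E c"
  unfolding formal_eigenvector_def
proof (intro conjI allI assms(1))
  fix m
  have H: "H_b a (basis_vec n) = jacobi_op a (basis_vec n)" for n
    by (rule H_b_conv_jacobi_op) (auto intro!: fin_spanI[of "Suc n"] simp: basis_vec_def)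
  let ?S = "{n. H_b a (basis_vec n) m \<noteq> 0}"
  let ?T = "{m + 2} \<union> (if m < 2 then {} else {m - 2})"
  have S: "?S \<subseteq> ?T"
    unfolding H by (auto simp: jacobi_op_def basis_vec_def split: if_splits)
  then show "finite ?S" by (rule finite_subset) auto
  have "(\<Sum>n\<in>?S. c n * H_b a (basis_vec n) m) = (\<Sum>n\<in>?T. c n * H_b a (basis_vec n) m)"
    using S by (intro sum.mono_neutral_left) auto
  also have "\<dots> = jacobi_op a c m"
    unfolding H by (auto simp: jacobi_op_def basis_vec_def algebra_simps)
  finally show "(\<Sum>n\<in>?S. c n * H_b a (basis_vec n) m) = E * c m"
    using assms(2) by (simp add: cscale_def)
qed

section \<open>The maximal operator, its core and self-adjointness\<close>

definition jacobi_max :: "real \<Rightarrow> nat set \<Rightarrow> oper" where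
  "jacobi_max a K = {(f, jacobi_op a f) | f. f \<in> ell2_on K \<and> jacobi_op a f \<in> ell2}"

lemma ip_jacobi_op_basis_vec:
  assumes "f \<in> ell2"
  shows "ip (jacobi_op a (basis_vec m)) f = jacobi_op a f m"
  unfolding jacobi_op_basis_vec
  using assms by (auto simp: ip_add_left ip_cscale_left ip_basis_vec jacobi_op_def algebra_simps)

lemma jacobi_op_fin_span: 
  assumes "s \<in> fin_span" shows "jacobi_op a s \<in> fin_span"
proof -
  obtain N where "\<forall>m\<ge>N. s m = 0" using fin_span_bound[OF assms] by blast
  then show ?thesis
    by (auto intro!: fin_spanI[of "Suc (Suc N)"] simp: jacobi_op_def)
qed

lemma fin_span_ell2: "s \<in> fin_span \<Longrightarrow> s \<in> ell2"
  by (simp add: fin_span_iff finite_support_ell2)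

text \<open>Summation by parts has no boundary term here because one argument is finite; the other
  may be any element of the maximal domain. Linearity reduces the claim to basis vectors.\<close>

lemma ip_jacobi_op_fin_span:
  assumes "s \<in> fin_span" "f \<in> ell2" "jacobi_op a f \<in> ell2"
  shows "ip (jacobi_op a s) f = ip s (jacobi_op a f)"
proof -
  \<comment> \<open>The memberships are carried through the induction because \<open>ip\<close> is
    additive only on \<open>ell2\<close>.\<close>
  have *: "jacobi_op a (\<Sum>v\<in>F. cscale (c v) v) \<in> ell2 \<and> (\<Sum>v\<in>F. cscale (c v) v) \<in> ell2 \<and>
      ip (jacobi_op a (\<Sum>v\<in>F. cscale (c v) v)) f = ip (\<Sum>v\<in>F. cscale (c v) v) (jacobi_op a f)"
    if "finite F" "F \<subseteq> range basis_vec" for F c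
    using that
  proof (induction F rule: finite_induct)
    case (insert v F)
    then obtain m where m: "v = basis_vec m" by auto
    have J: "jacobi_op a v \<in> ell2"
      unfolding m by (intro fin_span_ell2 jacobi_op_fin_span fin_spanI[of "Suc m"]) (auto simp: basis_vec_def)
    have *: "ip (jacobi_op a v) f = ip v (jacobi_op a f)"
      by (simp add: m ip_jacobi_op_basis_vec assms ip_basis_vec)
    let ?r = "\<Sum>w\<in>F. cscale (c w) w"
    have eq: "(\<Sum>w\<in>insert v F. cscale (c w) w) = cscale (c v) v + ?r"
      using insert by (intro sum.insert)
    have v: "v \<in> ell2" by (simp add: m)
    have IH: "jacobi_op a ?r \<in> ell2" "?r \<in> ell2" "ip (jacobi_op a ?r) f = ip ?r (jacobi_op a f)"
      using insert by auto
    show ?case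
      unfolding eq jacobi_op_simps
      by (simp only: IH J v assms ell2_add ell2_cscale ip_add_left ip_cscale_left) (simp add: *)
  qed (simp add: jacobi_op_simps)
  show ?thesis
    using assms(1) * by (auto simp: fin_span_def lin_span_def)
qed

text \<open>Arithmetic-geometric mean inequality for the two radicands, whose sum is linear in the
  index.\<close>

lemma jacobi_weight_bounds:
  assumes "a > 0"
  shows "0 < jacobi_weight a m" "jacobi_weight a m \<le> real m + 1 + a"
proof -
  let ?p = "\<lambda>m. 2 * (real (m div 2) + (if even m then a else 1))"
  have p: "?p m > 0" "?p (Suc m) > 0" "?p m + ?p (Suc m) \<le> 4 * (real m + 1 + a)"
    using assms by (auto elim!: evenE oddE)
  then show "0 < jacobi_weight a m" by (simp add: jacobi_weight_def ladder_coeff_def)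
  have "sqrt (?p m) * sqrt (?p (Suc m)) \<le> (?p m + ?p (Suc m)) / 2"
    using p arith_geo_mean_sqrt[of "?p m" "?p (Suc m)"] by (simp add: real_sqrt_mult)
  then show "jacobi_weight a m \<le> real m + 1 + a"
    using p(3) by (simp add: jacobi_weight_def ladder_coeff_def)
qed

text \<open>The weights grow linearly, so their products with the increments of the cutoff stay bounded:
  this is why finite sequences form a core.\<close>

lemma jacobi_max_core:
  assumes "a > 0" "f \<in> ell2" "jacobi_op a f \<in> ell2"
  shows "\<exists>s. (\<forall>k. s k \<in> fin_span \<and> (\<forall>m. f m = 0 \<longrightarrow> s k m = 0)) \<and> (\<lambda>k. l2norm (s k - f)) \<longlonglongrightarrow> 0 \<and>
    (\<lambda>k. l2norm (jacobi_op a (s k) - jacobi_op a f)) \<longlonglongrightarrow> 0"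
proof -
  \<comment> \<open>A piecewise linear cutoff: 1 up to \<open>k + 1\<close>, 0 from
    \<open>2 * (k + 1)\<close> on, with slope of size \<open>1 / (k + 1)\<close> between.\<close>
  define \<theta> :: "nat \<Rightarrow> nat \<Rightarrow> real" where "\<theta> k m = max 0 (min 1 (2 - real m / real (Suc k)))" for k m
  define s where "s k m = of_real (\<theta> k m) * f m" for k m
  \<comment> \<open>On the range \<open>m \<le> 2 * (k + 1)\<close> the weight is at most
    \<open>(3 + a) * (k + 1)\<close>, and an increment over two indices is at most
    \<open>2 / (k + 1)\<close>; \<open>c\<close> is the product of the two bounds.\<close>
  define c where "c = 2 * (3 + a)"
  have \<theta>_bound: "0 \<le> \<theta> k m" "\<theta> k m \<le> 1" for k m
    by (auto simp: \<theta>_def)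
  have cut: "cmod (complex_of_real (\<theta> k m - 1)) \<le> 1" for k m
    unfolding norm_of_real using \<theta>_bound[of k m] by linarith
  have \<theta>_one: "\<theta> k m = 1" if "m \<le> k" for k m
    using that by (auto simp: \<theta>_def field_simps)
  have \<theta>_zero: "\<theta> k m = 0" if "m \<ge> 2 * Suc k" for k m
  proof -
    have "real (2 * Suc k) \<le> real m" using that by linarith
    then show ?thesis by (auto simp: \<theta>_def field_simps)
  qed
  have incr: "jacobi_weight a m * \<bar>\<theta> k (m + 2) - \<theta> k m\<bar> \<le> c" for k m
  proof (cases "m \<ge> 2 * Suc k")
    case True
    then show ?thesis using \<theta>_zero[of k m] \<theta>_zero[of k "m + 2"] assms(1) by (simp add: c_def)
  next
    case False
    then have m: "real m \<le> 2 * real (Suc k)" by linarith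
    have "\<bar>\<theta> k (m + 2) - \<theta> k m\<bar> \<le> \<bar>real (m + 2) / real (Suc k) - real m / real (Suc k)\<bar>"
      unfolding \<theta>_def by linarith
    also have "\<dots> = 2 / real (Suc k)"
      by (simp add: diff_divide_distrib[symmetric])
    finally have "jacobi_weight a m * \<bar>\<theta> k (m + 2) - \<theta> k m\<bar> \<le> (real m + 1 + a) * (2 / real (Suc k))"
      using jacobi_weight_bounds[OF assms(1), of m] assms(1) by (intro mult_mono) auto
    also have "\<dots> \<le> ((3 + a) * real (Suc k)) * (2 / real (Suc k))"
    proof (intro mult_right_mono)
      have arith: "real m + 1 + a \<le> (3 + a) * r" if "1 \<le> r" "a * 1 \<le> a * r" "real m \<le> 2 * r" for r
        using that unfolding distrib_right by linarith
      have "1 \<le> real (Suc k)" "a * 1 \<le> a * real (Suc k)" using assms(1) by auto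
      then show "real m + 1 + a \<le> (3 + a) * real (Suc k)"
        using m arith[of "real (Suc k)"] by blast
    qed auto
    also have "\<dots> = c" by (simp add: c_def)
    finally show ?thesis .
  qed
  \<comment> \<open>The majorant, independent of \<open>k\<close>: two shifted copies of
    \<open>f\<close> dominate the terms with increments of the cutoff, the image of \<open>f\<close>
    dominates the remaining one.\<close>
  define g :: vec where "g m = (if m < 2 then 0 else of_real c * of_real (cmod (f (m - 2)))) +
    of_real c * of_real (cmod (f (m + 2))) + of_real (cmod (jacobi_op a f m))" for m
  have c0: "c \<ge> 0" using assms(1) by (simp add: c_def)
  have g: "g \<in> ell2"
  proof -
    let ?f1 = "\<lambda>m. if m < 2 then 0 else f (m - 2)" and ?f2 = "\<lambda>m. f (m + 2)"
    have "(\<lambda>m. complex_of_real (cmod (h m))) \<in> ell2" if "h \<in> ell2" for h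
      using that by (rule ell2_mono) auto
    then have "cscale c (\<lambda>m. complex_of_real (cmod (?f1 m))) + cscale c (\<lambda>m. complex_of_real (cmod (?f2 m)))
       + (\<lambda>m. complex_of_real (cmod (jacobi_op a f m))) \<in> ell2"
      using assms ell2_shift[OF assms(2), of 2] by auto
    also have "cscale c (\<lambda>m. complex_of_real (cmod (?f1 m))) + cscale c (\<lambda>m. complex_of_real (cmod (?f2 m)))
       + (\<lambda>m. complex_of_real (cmod (jacobi_op a f m))) = g"
      by (auto simp: g_def cscale_def fun_eq_iff)
    finally show ?thesis .
  qed
  have g_norm: "cmod (g m) = (if m < 2 then 0 else c * cmod (f (m - 2))) + c * cmod (f (m + 2)) +
     cmod (jacobi_op a f m)" for m
  proof -
    have "g m = of_real ((if m < 2 then 0 else c * cmod (f (m - 2))) + c * cmod (f (m + 2)) +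
     cmod (jacobi_op a f m))" by (simp add: g_def)
    then show ?thesis using c0 by (simp only: norm_of_real) (auto intro!: abs_of_nonneg)
  qed
  \<comment> \<open>Discrete product rule: weights meet only increments of the cutoff, and what is
    left is the image multiplied by the cutoff minus 1.\<close>
  have comm: "(jacobi_op a (s k) - jacobi_op a f) m = 
     \<i> * ((if m < 2 then 0 else jacobi_weight a (m - 2) * (\<theta> k (m - 2) - \<theta> k m) * f (m - 2))
     - jacobi_weight a m * (\<theta> k (m + 2) - \<theta> k m) * f (m + 2)) + (\<theta> k m - 1) * jacobi_op a f m" for k m
    by (simp add: jacobi_op_def s_def algebra_simps)
  have "cmod ((jacobi_op a (s k) - jacobi_op a f) m) \<le> cmod (g m)" for k m
  proof -
    have incr': "jacobi_weight a (m - 2) * \<bar>\<theta> k m - \<theta> k (m - 2)\<bar> \<le> c" if "\<not> m < 2"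
      using incr[of "m - 2" k] that by (metis le_add_diff_inverse2 not_less)
    have n1: "cmod (if m < 2 then 0 else jacobi_weight a (m - 2) * (\<theta> k (m - 2) - \<theta> k m) * f (m - 2))
       \<le> (if m < 2 then 0 else c * cmod (f (m - 2)))"
      using incr' jacobi_weight_bounds[OF assms(1), of "m - 2"]
      by (auto simp: norm_mult abs_minus_commute norm_of_real simp flip: of_real_diff intro!: mult_right_mono)
    have n2: "cmod (jacobi_weight a m * (\<theta> k (m + 2) - \<theta> k m) * f (m + 2)) \<le> c * cmod (f (m + 2))"
      using incr[of m k] jacobi_weight_bounds[OF assms(1), of "m"]
      by (auto simp: norm_mult norm_of_real simp flip: of_real_diff intro!: mult_right_mono)
    have n3: "cmod ((\<theta> k m - 1) * jacobi_op a f m) \<le> 1 * cmod (jacobi_op a f m)"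
      unfolding norm_mult by (rule mult_right_mono[OF cut norm_ge_zero])
    have tri: "cmod (\<i> * (X - Y) + Z) \<le> cmod X + cmod Y + cmod Z" for X Y Z
      using norm_triangle_ineq[of "\<i> * (X - Y)" Z] norm_triangle_ineq4[of X Y] by (simp add: norm_mult)
    show ?thesis
      unfolding comm g_norm by (rule order_trans[OF tri]) (intro add_mono n1 n2 n3[unfolded mult_1])
  qed
  moreover have "(\<lambda>k. (jacobi_op a (s k) - jacobi_op a f) m) \<longlonglongrightarrow> 0" for m
    by (rule tendsto_eventually, rule eventually_sequentiallyI[of "m + 2"]) (simp only: comm, simp add: \<theta>_one)
  ultimately have "(\<lambda>k. l2norm (jacobi_op a (s k) - jacobi_op a f)) \<longlonglongrightarrow> 0"
    by (intro l2norm_dominated_tendsto[OF g])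
  moreover have "(\<lambda>k. l2norm (s k - f)) \<longlonglongrightarrow> 0"
  proof (rule l2norm_dominated_tendsto[OF assms(2)])
    have eq: "(s k - f) m = (\<theta> k m - 1) * f m" for k m
      by (simp add: s_def algebra_simps)
    show "cmod ((s k - f) m) \<le> cmod (f m)" for k m
    proof -
      have "cmod ((\<theta> k m - 1) * f m) \<le> 1 * cmod (f m)"
        unfolding norm_mult by (rule mult_right_mono[OF cut norm_ge_zero])
      then show ?thesis unfolding eq by simp
    qed
    show "(\<lambda>k. (s k - f) m) \<longlonglongrightarrow> 0" for m
      by (rule tendsto_eventually, rule eventually_sequentiallyI[of m]) (simp only: eq, simp add: \<theta>_one)
  qed
  moreover have "s k \<in> fin_span" for k
    by (rule fin_spanI[of "2 * Suc k"]) (simp add: s_def \<theta>_zero)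
  ultimately show ?thesis by (intro exI[of _ s]) (auto simp: s_def)
qed

text \<open>Each component of \<open>jacobi_op\<close> depends continuously on finitely many
  entries, so norm limits of graph points stay in the maximal graph. The converse is the core
  property.\<close>

lemma H_b_closed_eq:
  assumes "a > 0"
  shows "H_b_closed a = jacobi_max a UNIV"
proof (intro set_eqI iffI; clarify)
  fix f g assume "(f, g) \<in> H_b_closed a"
  then obtain s t where fg: "f \<in> ell2" "g \<in> ell2" and st: "\<And>k. (s k, t k) \<in> graph_on fin_span (H_b a)"
    and lim: "(\<lambda>k. l2norm (s k - f)) \<longlonglongrightarrow> 0" "(\<lambda>k. l2norm (t k - g)) \<longlonglongrightarrow> 0"
    by (auto simp: H_b_closed_def op_closure_def)
  have s: "s k \<in> fin_span" "t k = jacobi_op a (s k)" for k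
    using st[of k] by (auto simp: graph_on_def H_b_conv_jacobi_op)
  have "g m = jacobi_op a f m" for m
  proof (rule LIMSEQ_unique)
    show "(\<lambda>k. t k m) \<longlonglongrightarrow> g m"
      by (rule component_tendsto) (use fg lim s jacobi_op_fin_span fin_span_ell2 in auto)
    have "(\<lambda>k. s k m) \<longlonglongrightarrow> f m" for m
      by (rule component_tendsto) (use fg lim s fin_span_ell2 in auto)
    then show "(\<lambda>k. t k m) \<longlonglongrightarrow> jacobi_op a f m"
      unfolding s(2) jacobi_op_def by (auto intro!: tendsto_intros)
  qed
  then have "g = jacobi_op a f" by auto
  then show "(f, g) \<in> jacobi_max a UNIV"
    using fg by (auto simp: jacobi_max_def ell2_on_UNIV)
next
  fix f g assume "(f, g) \<in> jacobi_max a UNIV"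
  then have f: "f \<in> ell2" "g = jacobi_op a f" "g \<in> ell2"
    by (auto simp: jacobi_max_def ell2_on_UNIV)
  then obtain s where "\<And>k. s k \<in> fin_span" "(\<lambda>k. l2norm (s k - f)) \<longlonglongrightarrow> 0"
    "(\<lambda>k. l2norm (jacobi_op a (s k) - g)) \<longlonglongrightarrow> 0"
    using jacobi_max_core[OF assms, of f] by auto
  then show "(f, g) \<in> H_b_closed a"
    unfolding H_b_closed_def op_closure_def graph_on_def mem_Collect_eq prod.case using f(1,3)
    by (intro conjI exI[of _ s] exI[of _ "\<lambda>k. jacobi_op a (s k)"]) (auto simp: H_b_conv_jacobi_op)
qed

lemma shift_closed_diff_2:
  fixes m :: nat
  assumes "\<And>m. m + 2 \<in> K \<longleftrightarrow> m \<in> K" "\<not> m < 2"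
  shows "m - 2 \<in> K \<longleftrightarrow> m \<in> K"
  using assms(1)[of "m - 2"] assms(2) by (metis le_add_diff_inverse2 not_less)

lemma jacobi_op_vanishes:
  assumes "\<And>m. m + 2 \<in> K \<longleftrightarrow> m \<in> K" "f \<in> ell2_on K" "m \<notin> K"
  shows "jacobi_op a f m = 0"
proof -
  have "m + 2 \<notin> K" using assms(1,3) by blast
  moreover have "m - 2 \<notin> K" if "\<not> m < 2"
    using shift_closed_diff_2[OF assms(1) that] assms(3) by blast
  ultimately show ?thesis
    using assms(2) by (auto simp: jacobi_op_def ell2_on_def)
qed

text \<open>Testing the adjoint relation on basis vectors forces \<open>g\<close> to be the termwise
  image of \<open>f\<close>, so the adjoint lies in the maximal operator. Conversely, symmetry
  passes from finite vectors to the whole domain along the core. Shift invariance of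
  \<open>K\<close> keeps images supported in \<open>K\<close>.\<close>

lemma selfadjoint_jacobi_max:
  assumes "a > 0" and K: "\<And>m. m + 2 \<in> K \<longleftrightarrow> m \<in> K"
  shows "selfadjoint_in (ell2_on K) (jacobi_max a K)"
proof -
  note van = jacobi_op_vanishes[OF K, where a = a]
  have span: "(s, jacobi_op a s) \<in> jacobi_max a K" if "s \<in> lin_span (basis_vec ` K)" for s
  proof -
    have "s \<in> fin_span" "s \<in> ell2_on K"
      using that by (auto simp: lin_span_basis_vec fin_span_iff ell2_on_def finite_support_ell2)
    then show ?thesis using jacobi_op_fin_span fin_span_ell2 by (auto simp: jacobi_max_def)
  qed
  show ?thesis
    unfolding selfadjoint_in_def
  proof (intro conjI)
    show "jacobi_max a K \<subseteq> ell2_on K \<times> ell2_on K"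
      using van by (auto simp: jacobi_max_def) (auto simp: ell2_on_def)
    have "lin_span (basis_vec ` K) \<subseteq> Domain (jacobi_max a K)"
      using span by blast
    then show "ell2_on K \<subseteq> l2_closure (Domain (jacobi_max a K))"
      unfolding closed_span_basis_vec[symmetric] closed_span_def l2_closure_def by blast
    show "jacobi_max a K = adjoint_in (ell2_on K) (jacobi_max a K)"
    proof (intro set_eqI iffI; clarify)
      fix f g assume fg: "(f, g) \<in> adjoint_in (ell2_on K) (jacobi_max a K)"
      then have f: "f \<in> ell2_on K" "g \<in> ell2_on K" by (auto simp: adjoint_in_def)
      have "g m = jacobi_op a f m" for m
      proof (cases "m \<in> K")
        case True
        then have "(basis_vec m, jacobi_op a (basis_vec m)) \<in> jacobi_max a K"
          using lin_span_base[of "basis_vec m" _ 1] by (intro span) (auto simp: cscale_simps)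
        then have "ip (jacobi_op a (basis_vec m)) f = ip (basis_vec m) g"
          using fg by (auto simp: adjoint_in_def)
        then show ?thesis using f by (simp add: ip_basis_vec ip_jacobi_op_basis_vec ell2_on_ell2)
      next
        case False
        then show ?thesis using van f by (auto simp: ell2_on_def)
      qed
      then have "g = jacobi_op a f" by auto
      then show "(f, g) \<in> jacobi_max a K"
        using f by (auto simp: jacobi_max_def ell2_on_ell2)
    next
      fix f g assume "(f, g) \<in> jacobi_max a K"
      then have f: "f \<in> ell2_on K" "g = jacobi_op a f" "jacobi_op a f \<in> ell2"
        by (auto simp: jacobi_max_def)
      then have g: "g \<in> ell2_on K" using van by (auto simp: ell2_on_def)
      have "ip (jacobi_op a h) f = ip h (jacobi_op a f)"
        if h: "h \<in> ell2" "jacobi_op a h \<in> ell2" for h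
      proof -
        obtain s where s: "\<And>k. s k \<in> fin_span" "(\<lambda>k. l2norm (s k - h)) \<longlonglongrightarrow> 0"
          "(\<lambda>k. l2norm (jacobi_op a (s k) - jacobi_op a h)) \<longlonglongrightarrow> 0"
          using jacobi_max_core[OF assms(1) h] by auto
        show ?thesis
        proof (rule LIMSEQ_unique)
          show "(\<lambda>k. ip (jacobi_op a (s k)) f) \<longlonglongrightarrow> ip (jacobi_op a h) f"
            by (rule ip_tendsto_left) (use s h f jacobi_op_fin_span fin_span_ell2 ell2_on_ell2 in auto)
          have "(\<lambda>k. ip (s k) (jacobi_op a f)) \<longlonglongrightarrow> ip h (jacobi_op a f)"
            by (rule ip_tendsto_left) (use s h f jacobi_op_fin_span fin_span_ell2 ell2_on_ell2 in auto)
          then show "(\<lambda>k. ip (jacobi_op a (s k)) f) \<longlonglongrightarrow> ip h (jacobi_op a f)"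
            using s f by (simp add: ip_jacobi_op_fin_span ell2_on_ell2)
        qed
      qed
      then show "(f, g) \<in> adjoint_in (ell2_on K) (jacobi_max a K)"
        using f g by (auto simp: adjoint_in_def jacobi_max_def ell2_on_ell2)
    qed
  qed
qed

section \<open>Splitting the operator along shift-invariant index sets\<close>

lemma part_in_jacobi_max:
  assumes K: "\<And>m. m + 2 \<in> K \<longleftrightarrow> m \<in> K"
  shows "part_in (ell2_on K) (jacobi_max a UNIV) = jacobi_max a K"
  using jacobi_op_vanishes[OF K, where a = a]
  by (auto simp: part_in_def jacobi_max_def) (auto simp: ell2_on_def)

definition restrict_to :: "nat set \<Rightarrow> vec \<Rightarrow> vec" where
  "restrict_to K f = (\<lambda>m. if m \<in> K then f m else 0)"

lemma restrict_to_ell2_on: "f \<in> ell2 \<Longrightarrow> restrict_to K f \<in> ell2_on K"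
  using ell2_mono[of f "restrict_to K f"] by (auto simp: ell2_on_def restrict_to_def)

lemma restrict_to_residue_class: "restrict_to (residue_class 0) f + restrict_to (residue_class 1) f = f"
  by (auto simp: restrict_to_def fun_eq_iff)

lemma jacobi_op_restrict_to:
  assumes K: "\<And>m. m + 2 \<in> K \<longleftrightarrow> m \<in> K"
  shows "jacobi_op a (restrict_to K f) = restrict_to K (jacobi_op a f)"
proof
  fix m
  have "m - 2 \<in> K \<longleftrightarrow> m \<in> K" if "\<not> m < 2"
    using shift_closed_diff_2[OF K that] .
  with K[of m] show "jacobi_op a (restrict_to K f) m = restrict_to K (jacobi_op a f) m"
    by (auto simp: jacobi_op_def restrict_to_def)
qed

lemma jacobi_max_restrict_to:
  assumes K: "\<And>m. m + 2 \<in> K \<longleftrightarrow> m \<in> K" and fg: "(f, g) \<in> jacobi_max a UNIV"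
  shows "(restrict_to K f, restrict_to K g) \<in> jacobi_max a K"
  using fg restrict_to_ell2_on[of _ K] ell2_on_ell2 jacobi_op_restrict_to[of K, OF K]
  by (auto simp: jacobi_max_def ell2_on_UNIV)

lemma jacobi_max_add:
  "(f0, g0) \<in> jacobi_max a K \<Longrightarrow> (f1, g1) \<in> jacobi_max a L \<Longrightarrow> (f0 + f1, g0 + g1) \<in> jacobi_max a UNIV"
  by (auto simp: jacobi_max_def ell2_on_def jacobi_op_simps)

lemma ip_disjoint:
  assumes "f \<in> ell2_on K" "g \<in> ell2_on L" "K \<inter> L = {}"
  shows "ip f g = 0"
proof -
  have "cnj (f n) * g n = 0" for n
    using assms by (auto simp: ell2_on_def)
  then have "(\<lambda>n. cnj (f n) * g n) = (\<lambda>_. 0)" by blast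
  then show ?thesis by (simp add: ip_def)
qed

lemma orthogonal_direct_sum_parity: "orthogonal_direct_sum ell2 V0 V1"
  unfolding orthogonal_direct_sum_def V_eq
proof (intro conjI ballI)
  show "ell2 = {f0 + f1 |f0 f1. f0 \<in> ell2_on (residue_class 0) \<and> f1 \<in> ell2_on (residue_class 1)}"
  proof -
    have "\<exists>f0 f1. f = f0 + f1 \<and> f0 \<in> ell2_on (residue_class 0) \<and> f1 \<in> ell2_on (residue_class 1)"
      if "f \<in> ell2" for f
      using restrict_to_residue_class[of f, symmetric] restrict_to_ell2_on[OF that] by blast
    then show ?thesis using ell2_add[OF ell2_on_ell2 ell2_on_ell2] by auto
  qed
  show "ell2_on (residue_class 0) \<inter> ell2_on (residue_class 1) = {0}"
  proof -
    have "f = 0" if "f \<in> ell2_on (residue_class 0)" "f \<in> ell2_on (residue_class 1)" for f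
    proof
      fix m :: nat
      show "f m = 0 m" using that by (cases "m mod 2 = 0") (auto simp: ell2_on_def)
    qed
    then show ?thesis by (auto simp: ell2_on_def)
  qed
  show "ip f g = 0" if "f \<in> ell2_on (residue_class 0)" "g \<in> ell2_on (residue_class 1)" for f g
    by (rule ip_disjoint[OF that]) (simp add: disjoint_iff)
qed

lemma preserves_summands_jacobi_max: "preserves_summands (jacobi_max a UNIV) V0 V1"
  unfolding preserves_summands_def V_eq part_in_jacobi_max[OF residue_class_add_2]
proof (intro set_eqI iffI; clarify)
  fix f g assume "(f, g) \<in> jacobi_max a UNIV"
  note jacobi_max_restrict_to[OF residue_class_add_2 this]
  then show "\<exists>f0 f1 g0 g1. (f, g) = (f0 + f1, g0 + g1) \<and>
     (f0, g0) \<in> jacobi_max a (residue_class 0) \<and> (f1, g1) \<in> jacobi_max a (residue_class 1)"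
    using restrict_to_residue_class by metis
qed (rule jacobi_max_add)

subsection \<open>Determinacy under exponential moments\<close>

lemma borel_measurable_cnj [measurable (raw)]:
  "f \<in> borel_measurable M \<Longrightarrow> (\<lambda>x. cnj (f x)) \<in> borel_measurable M"
  by (rule measurable_compose[OF _ borel_measurable_continuous_onI]) (auto intro: continuous_intros)

text \<open>Levy's uniqueness theorem concerns probability measures, so positive and negative part
  are normalised by their mass. Frequency 0 shows that the two masses agree; if the common mass is
  0, both parts vanish already.\<close>

lemma AE_eq_0_if_Fourier_eq_0_real:
  fixes h :: "real \<Rightarrow> real"
  assumes M: "finite_measure M" "sets M = sets borel" and h: "integrable M h"
    and zero: "\<And>t. (CLINT x|M. iexp (t * x) * h x) = 0"
  shows "AE x in M. h x = 0"
proof -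
  interpret finite_measure M by (rule M)
  note [measurable_cong] = M(2)
  have [measurable]: "h \<in> borel_measurable M" using h by auto
  define p where "p x = max 0 (h x)" for x
  define n where "n x = max 0 (- h x)" for x
  have [measurable]: "p \<in> borel_measurable M" "n \<in> borel_measurable M"
    unfolding p_def n_def by measurable
  have h_eq: "h x = p x - n x" and pos: "p x \<ge> 0" "n x \<ge> 0" for x
    by (auto simp: p_def n_def)
  have int: "integrable M p" "integrable M n"
    by (auto intro!: Bochner_Integration.integrable_bound[OF h] simp: p_def n_def)
  have int_iexp: "integrable M (\<lambda>x. iexp (t * x) * complex_of_real (f x))"
    if "integrable M f" for f :: "real \<Rightarrow> real" and t
    using that by (intro Bochner_Integration.integrable_bound[OF that]) (auto simp: norm_mult)
  have eq: "(CLINT x|M. iexp (t * x) * p x) = (CLINT x|M. iexp (t * x) * n x)" for t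
  proof -
    have "(CLINT x|M. iexp (t * x) * p x) - (CLINT x|M. iexp (t * x) * n x)
      = (CLINT x|M. iexp (t * x) * h x)"
      unfolding Bochner_Integration.integral_diff[OF int_iexp[OF int(1)] int_iexp[OF int(2)], symmetric]
      by (intro Bochner_Integration.integral_cong) (auto simp: h_eq right_diff_distrib)
    then show ?thesis using zero by simp
  qed
  define c where "c = (LINT x|M. p x)"
  have "complex_of_real (LINT x|M. p x) = complex_of_real (LINT x|M. n x)"
    using eq[of 0] by simp
  then have c2: "c = (LINT x|M. n x)" by (simp add: c_def)
  have "c \<ge> 0" using pos by (simp add: c_def)
  show ?thesis
  proof (cases "c = 0")
    case True
    then have "AE x in M. p x = 0" "AE x in M. n x = 0"
      using integral_nonneg_eq_0_iff_AE[OF int(1)] integral_nonneg_eq_0_iff_AE[OF int(2)] pos c2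
      by (auto simp: c_def)
    then show ?thesis by eventually_elim (simp add: h_eq)
  next
    case False
    then have "c > 0" using \<open>c \<ge> 0\<close> by simp
    have dist: "real_distribution (density M (\<lambda>x. ennreal (f x / c)))"
      and chr: "char (density M (\<lambda>x. ennreal (f x / c))) t = (CLINT x|M. iexp (t * x) * f x) / c"
      if f: "integrable M f" "\<And>x. f x \<ge> 0" "(LINT x|M. f x) = c" for f t
    proof -
      have [measurable]: "f \<in> borel_measurable M" using f by auto
      show "real_distribution (density M (\<lambda>x. ennreal (f x / c)))"
      proof (intro real_distribution.intro prob_spaceI real_distribution_axioms.intro)
        have "(\<integral>\<^sup>+x. ennreal (f x / c) \<partial>M) = ennreal (LINT x|M. f x / c)"
          using f \<open>c > 0\<close> by (intro nn_integral_eq_integral) auto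
        then show "emeasure (density M (\<lambda>x. ennreal (f x / c))) (space (density M (\<lambda>x. ennreal (f x / c)))) = 1"
          using f \<open>c > 0\<close> by (simp add: emeasure_density cong: nn_integral_cong)
      qed (use M in auto)
      have "char (density M (\<lambda>x. ennreal (f x / c))) t = (CLINT x|M. (f x / c) *\<^sub>R iexp (t * x))"
        unfolding char_def using f \<open>c > 0\<close> by (subst integral_density) auto
      also have "\<dots> = (CLINT x|M. (iexp (t * x) * f x) / c)"
        by (intro Bochner_Integration.integral_cong) (auto simp: scaleR_conv_of_real)
      finally show "char (density M (\<lambda>x. ennreal (f x / c))) t = (CLINT x|M. iexp (t * x) * f x) / c"
        by simp
    qed
    have "density M (\<lambda>x. ennreal (p x / c)) = density M (\<lambda>x. ennreal (n x / c))"
      using dist[OF int(1) pos(1)] dist[OF int(2) pos(2)] chr[OF int(1) pos(1)] chr[OF int(2) pos(2)] eq c2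
      by (intro Levy_uniqueness) (auto simp: c_def)
    then have "AE x in M. ennreal (p x / c) = ennreal (n x / c)"
      by (subst (asm) density_unique_iff) auto
    then show ?thesis
      by eventually_elim (use pos \<open>c > 0\<close> in \<open>auto simp: h_eq\<close>)
  qed
qed

text \<open>Conjugation turns frequency \<open>t\<close> into \<open>-t\<close>, so the transform of
  the real part vanishes too; the imaginary part is the real part of
  \<open>- \<i> * h\<close>.\<close>

lemma AE_eq_0_if_Fourier_eq_0:
  fixes h :: "real \<Rightarrow> complex"
  assumes M: "finite_measure M" "sets M = sets borel" and h: "integrable M h"
    and zero: "\<And>t. (CLINT x|M. iexp (t * x) * h x) = 0"
  shows "AE x in M. h x = 0"
proof -
  note [measurable_cong] = M(2)
  have Re: "AE x in M. Re (g x) = 0"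
    if g: "integrable M g" and zero: "\<And>t. (CLINT x|M. iexp (t * x) * g x) = 0" for g :: "real \<Rightarrow> complex"
  proof -
    have [measurable]: "g \<in> borel_measurable M" using g by auto
    have zero': "(CLINT x|M. iexp (t * x) * cnj (g x)) = 0" for t
    proof -
      have "(CLINT x|M. iexp (t * x) * cnj (g x)) = (CLINT x|M. cnj (iexp (- t * x) * g x))"
        by (intro Bochner_Integration.integral_cong) (auto simp: exp_cnj)
      also have "\<dots> = cnj (CLINT x|M. iexp (- t * x) * g x)" by (rule Bochner_Integration.integral_cnj)
      finally show ?thesis using zero[of "- t"] by simp
    qed
    have int: "integrable M (\<lambda>x. iexp (t * x) * g x)" "integrable M (\<lambda>x. iexp (t * x) * cnj (g x))" for t
      by (auto intro!: Bochner_Integration.integrable_bound[OF g] simp: norm_mult)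
    have "(CLINT x|M. iexp (t * x) * Re (g x)) = 0" for t
    proof -
      have "(CLINT x|M. iexp (t * x) * Re (g x)) = (CLINT x|M. (iexp (t * x) * g x + iexp (t * x) * cnj (g x)) / 2)"
        by (intro Bochner_Integration.integral_cong) (auto simp: complex_add_cnj simp flip: distrib_left)
      then show ?thesis using int zero zero' by simp
    qed
    then show ?thesis
      using g by (intro AE_eq_0_if_Fourier_eq_0_real[OF M]) auto
  qed
  have "(CLINT x|M. iexp (t * x) * (- \<i> * h x)) = 0" for t
  proof -
    have "(CLINT x|M. iexp (t * x) * (- \<i> * h x)) = (CLINT x|M. - \<i> * (iexp (t * x) * h x))"
      by (intro Bochner_Integration.integral_cong) auto
    also have "\<dots> = - \<i> * (CLINT x|M. iexp (t * x) * h x)" by (rule integral_mult_right_zero)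
    finally show ?thesis using zero by simp
  qed
  then have "AE x in M. Re (- \<i> * h x) = 0"
    using h by (intro Re) auto
  moreover have "AE x in M. Re (h x) = 0" by (rule Re[OF h zero])
  ultimately show ?thesis by eventually_elim (simp add: complex_eq_iff)
qed

lemma power_div_fact_le_exp:
  fixes x :: real
  assumes "x \<ge> 0"
  shows "x ^ k / fact k \<le> exp x"
proof -
  have "(\<Sum>i\<in>{k}. x ^ i /\<^sub>R fact i) \<le> exp x"
    unfolding exp_def using assms by (intro sum_le_suminf summable_exp_generic) auto
  then show ?thesis by (simp add: field_simps)
qed

text \<open>Half of the exponent absorbs the power, as a single term of the exponential series is at
  most the whole series.\<close>

lemma power_mult_exp_le:
  fixes x :: real
  assumes "\<epsilon> > 0"
  shows "\<bar>x\<bar> ^ k * exp (\<epsilon> / 2 * \<bar>x\<bar>) \<le> fact k / (\<epsilon> / 2) ^ k * exp (\<epsilon> * \<bar>x\<bar>)"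
proof -
  have "(\<epsilon> / 2 * \<bar>x\<bar>) ^ k / fact k \<le> exp (\<epsilon> / 2 * \<bar>x\<bar>)"
    using assms by (intro power_div_fact_le_exp) auto
  then have "\<bar>x\<bar> ^ k \<le> fact k / (\<epsilon> / 2) ^ k * exp (\<epsilon> / 2 * \<bar>x\<bar>)"
    using assms unfolding power_mult_distrib by (simp add: field_simps)
  then have "\<bar>x\<bar> ^ k * exp (\<epsilon> / 2 * \<bar>x\<bar>) \<le> fact k / (\<epsilon> / 2) ^ k * exp (\<epsilon> / 2 * \<bar>x\<bar>) * exp (\<epsilon> / 2 * \<bar>x\<bar>)"
    by (intro mult_right_mono) auto
  also have "\<dots> = fact k / (\<epsilon> / 2) ^ k * exp (\<epsilon> * \<bar>x\<bar>)"
    by (simp flip: exp_add)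
  finally show ?thesis .
qed

text \<open>Exponential integrability lets vanishing moments propagate along the Fourier transform in
  steps of length at most \<open>\<epsilon> / 2\<close>.\<close>

lemma AE_eq_0_if_moments_eq_0:
  fixes h :: "real \<Rightarrow> complex"
  assumes M: "finite_measure M" "sets M = sets borel" and "\<epsilon> > 0"
    and h: "h \<in> borel_measurable M" "integrable M (\<lambda>x. exp (\<epsilon> * \<bar>x\<bar>) * cmod (h x))"
    and zero: "\<And>k. (CLINT x|M. complex_of_real x ^ k * h x) = 0"
  shows "AE x in M. h x = 0"
proof -
  note [measurable_cong] = M(2)
  note [measurable] = h(1)
  have int: "integrable M (\<lambda>x. \<bar>x\<bar> ^ k * exp (\<epsilon> / 2 * \<bar>x\<bar>) * cmod (h x))" for k
  proof (rule Bochner_Integration.integrable_bound)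
    show "integrable M (\<lambda>x. fact k / (\<epsilon> / 2) ^ k * (exp (\<epsilon> * \<bar>x\<bar>) * cmod (h x)))"
      using h by simp
    show "AE x in M. norm (\<bar>x\<bar> ^ k * exp (\<epsilon> / 2 * \<bar>x\<bar>) * cmod (h x))
        \<le> norm (fact k / (\<epsilon> / 2) ^ k * (exp (\<epsilon> * \<bar>x\<bar>) * cmod (h x)))"
      using mult_right_mono[OF power_mult_exp_le[OF \<open>\<epsilon> > 0\<close>, of _ k], of "cmod (h _)"] \<open>\<epsilon> > 0\<close>
      by (auto simp: abs_mult mult_ac)
  qed measurable
  have int': "integrable M (\<lambda>x. x ^ k * iexp (t * x) * h x)" for k t
  proof (rule Bochner_Integration.integrable_bound[OF int[of k]])
    have "\<bar>x\<bar> ^ k * 1 * cmod (h x) \<le> \<bar>x\<bar> ^ k * exp (\<epsilon> / 2 * \<bar>x\<bar>) * cmod (h x)" for x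
      using \<open>\<epsilon> > 0\<close> by (intro mult_right_mono mult_left_mono) auto
    then show "AE x in M. norm (x ^ k * iexp (t * x) * h x)
      \<le> norm (\<bar>x\<bar> ^ k * exp (\<epsilon> / 2 * \<bar>x\<bar>) * cmod (h x))"
      by (auto simp: norm_mult norm_power)
  qed measurable
  have step: "(CLINT x|M. x ^ k * iexp ((t + s) * x) * h x) = 0"
    if t: "\<And>k. (CLINT x|M. x ^ k * iexp (t * x) * h x) = 0" and s: "\<bar>s\<bar> \<le> \<epsilon> / 2" for t s k
  proof -
    \<comment> \<open>Expanding the factor for frequency \<open>s\<close> makes each term a constant
      times the moment of order \<open>k + j\<close> at frequency \<open>t\<close>, which vanishes;
      the rest of the step justifies termwise integration.\<close>
    define f where "f j x = x ^ k * iexp (t * x) * h x * ((\<i> * s * x) ^ j /\<^sub>R fact j)" for j and x :: real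
    have f_sums: "(\<lambda>j. f j x) sums (x ^ k * iexp ((t + s) * x) * h x)" for x
    proof -
      have "(\<lambda>j. f j x) sums (x ^ k * iexp (t * x) * h x * exp (\<i> * s * x))"
        unfolding f_def by (intro sums_mult exp_converges)
      then show ?thesis by (simp add: algebra_simps exp_add)
    qed
    have f_eq: "f j x = (\<i> * s) ^ j /\<^sub>R fact j * (x ^ (k + j) * iexp (t * x) * h x)" for j x
      by (simp add: f_def power_add power_mult_distrib)
    have f_norm: "cmod (f j x) = \<bar>x\<bar> ^ k * cmod (h x) * (\<bar>s * x\<bar> ^ j /\<^sub>R fact j)" for j x
      by (simp add: f_def norm_mult norm_power abs_mult power_mult_distrib)
    have "(\<lambda>j. integral\<^sup>L M (f j)) sums (\<integral>x. (\<Sum>j. f j x) \<partial>M)"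
    proof (rule sums_integral)
      show fint: "integrable M (f j)" for j
        unfolding f_eq using int'[of "k + j" t] by (intro integrable_mult_right) simp
      show "AE x in M. summable (\<lambda>j. norm (f j x))"
        unfolding f_norm by (intro AE_I2 summable_mult summable_exp_generic)
      show "summable (\<lambda>j. \<integral>x. norm (f j x) \<partial>M)"
      proof (rule summableI_nonneg_bounded)
        fix n
        have "(\<Sum>j<n. \<integral>x. norm (f j x) \<partial>M) = (\<integral>x. (\<Sum>j<n. norm (f j x)) \<partial>M)"
          using fint by (subst Bochner_Integration.integral_sum) auto
        also have "\<dots> \<le> (\<integral>x. \<bar>x\<bar> ^ k * exp (\<epsilon> / 2 * \<bar>x\<bar>) * cmod (h x) \<partial>M)"
        proof (rule integral_mono)
          fix x
          \<comment> \<open>Here the restriction on \<open>s\<close> enters: all partial sums stay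
            below the exponential weight whose product with \<open>h\<close> and any power is
            integrable.\<close>
          have "(\<Sum>j<n. \<bar>s * x\<bar> ^ j /\<^sub>R fact j) \<le> exp \<bar>s * x\<bar>"
            unfolding exp_def by (intro sum_le_suminf summable_exp_generic) auto
          also have "\<dots> \<le> exp (\<epsilon> / 2 * \<bar>x\<bar>)"
            using mult_right_mono[OF s, of "\<bar>x\<bar>"] by (simp add: abs_mult)
          finally have "\<bar>x\<bar> ^ k * cmod (h x) * (\<Sum>j<n. \<bar>s * x\<bar> ^ j /\<^sub>R fact j)
              \<le> \<bar>x\<bar> ^ k * cmod (h x) * exp (\<epsilon> / 2 * \<bar>x\<bar>)"
            by (intro mult_left_mono) auto
          then show "(\<Sum>j<n. norm (f j x)) \<le> \<bar>x\<bar> ^ k * exp (\<epsilon> / 2 * \<bar>x\<bar>) * cmod (h x)"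
            unfolding f_norm by (simp add: sum_distrib_left mult_ac)
        qed (use int fint in auto)
        finally show "(\<Sum>j<n. \<integral>x. norm (f j x) \<partial>M) \<le> (\<integral>x. \<bar>x\<bar> ^ k * exp (\<epsilon> / 2 * \<bar>x\<bar>) * cmod (h x) \<partial>M)" .
      qed auto
    qed
    moreover have "integral\<^sup>L M (f j) = 0" for j
    proof -
      have "integral\<^sup>L M (f j) = (\<i> * s) ^ j /\<^sub>R fact j * (CLINT x|M. x ^ (k + j) * iexp (t * x) * h x)"
        unfolding f_eq of_real_power by (rule integral_mult_right_zero)
      then show ?thesis using t by simp
    qed
    ultimately have "(\<integral>x. (\<Sum>j. f j x) \<partial>M) = 0"
      by (simp add: sums_iff)
    then show ?thesis using f_sums by (simp add: sums_iff)
  qed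
  have "(CLINT x|M. iexp (t * x) * h x) = 0" for t
  proof -
    \<comment> \<open>Equal steps of admissible length lead from frequency 0, where the moments
      vanish by assumption, to \<open>t\<close>.\<close>
    obtain N :: nat where N: "2 * \<bar>t\<bar> / \<epsilon> < real N" using reals_Archimedean2 by blast
    then have "N > 0" using \<open>\<epsilon> > 0\<close> by (cases N) (auto simp: field_simps)
    have small: "\<bar>t / N\<bar> \<le> \<epsilon> / 2"
      using N \<open>N > 0\<close> \<open>\<epsilon> > 0\<close> by (simp add: field_simps)
    have "(CLINT x|M. x ^ k * iexp ((real j * (t / N)) * x) * h x) = 0" for j k
    proof (induction j arbitrary: k)
      case 0
      then show ?case using zero by simp
    next
      case (Suc j)
      have "real (Suc j) * (t / N) = real j * (t / N) + t / N"
        by (simp only: of_nat_Suc distrib_right mult_1_left add.commute)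
      then show ?case using step[OF Suc small, of k] by presburger
    qed
    from this[of 0 N] show ?thesis using \<open>N > 0\<close> by simp
  qed
  moreover have "integrable M h" using int'[of 0 0] by simp
  ultimately show ?thesis by (intro AE_eq_0_if_Fourier_eq_0[OF M])
qed

subsection \<open>Square-integrable functions and orthonormal polynomials\<close>

lemma mult_le_sum_squares:
  fixes a b :: real
  assumes "a \<ge> 0" "b \<ge> 0"
  shows "a * b \<le> a\<^sup>2 + b\<^sup>2"
  using sum_squares_bound[of a b] mult_nonneg_nonneg[OF assms] by linarith

text \<open>Functions rather than classes modulo null sets; the identification is made explicitly
  through equality almost everywhere.\<close>

definition L2 :: "real measure \<Rightarrow> (real \<Rightarrow> complex) set" where
  "L2 M = {g \<in> borel_measurable M. integrable M (\<lambda>x. (cmod (g x))\<^sup>2)}"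

lemma L2_measurable: "g \<in> L2 M \<Longrightarrow> g \<in> borel_measurable M"
  and L2D: "g \<in> L2 M \<Longrightarrow> integrable M (\<lambda>x. (cmod (g x))\<^sup>2)"
  by (auto simp: L2_def)

lemma L2_mono:
  assumes "g \<in> L2 M" "f \<in> borel_measurable M" "\<And>x. cmod (f x) \<le> cmod (g x)"
  shows "f \<in> L2 M"
proof -
  have "integrable M (\<lambda>x. (cmod (f x))\<^sup>2)"
    using assms(2,3) L2_measurable[OF assms(1)]
    by (intro Bochner_Integration.integrable_bound[OF L2D[OF assms(1)]])
       (auto intro: power_mono)
  then show ?thesis using assms by (simp add: L2_def)
qed

lemma L2_add:
  assumes "f \<in> L2 M" "g \<in> L2 M"
  shows "(\<lambda>x. f x + g x) \<in> L2 M"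
proof -
  have [measurable]: "f \<in> borel_measurable M" "g \<in> borel_measurable M"
    using assms by (auto simp: L2_def)
  have "integrable M (\<lambda>x. (cmod (f x + g x))\<^sup>2)"
  proof (rule Bochner_Integration.integrable_bound)
    show "integrable M (\<lambda>x. 2 * (cmod (f x))\<^sup>2 + 2 * (cmod (g x))\<^sup>2)"
      using assms by (auto simp: L2_def)
    have "(cmod (f x + g x))\<^sup>2 \<le> 2 * (cmod (f x))\<^sup>2 + 2 * (cmod (g x))\<^sup>2" for x
    proof -
      have "(cmod (f x + g x))\<^sup>2 \<le> (cmod (f x) + cmod (g x))\<^sup>2"
        by (intro power_mono norm_triangle_ineq) auto
      then show ?thesis
        using sum_squares_bound[of "cmod (f x)" "cmod (g x)"] by (simp add: power2_sum)
    qed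
    then show "AE x in M. norm ((cmod (f x + g x))\<^sup>2) \<le> norm (2 * (cmod (f x))\<^sup>2 + 2 * (cmod (g x))\<^sup>2)"
      by auto
  qed measurable
  then show ?thesis by (simp add: L2_def)
qed

lemma L2_cmult:
  "f \<in> L2 M \<Longrightarrow> (\<lambda>x. c * f x) \<in> L2 M"
  by (auto simp: L2_def norm_mult power_mult_distrib)

lemma L2_diff:
  assumes "f \<in> L2 M" "g \<in> L2 M"
  shows "(\<lambda>x. f x - g x) \<in> L2 M"
  using L2_add[OF assms(1) L2_cmult[OF assms(2), of "-1"]] by simp

lemma L2_sum:
  "(\<And>i. i \<in> I \<Longrightarrow> f i \<in> L2 M) \<Longrightarrow> (\<lambda>x. \<Sum>i\<in>I. f i x) \<in> L2 M"
  by (induction I rule: infinite_finite_induct) (auto simp: L2_add, auto simp: L2_def)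

lemma L2_prod:
  assumes "f \<in> L2 M" "g \<in> L2 M"
  shows "integrable M (\<lambda>x. cnj (f x) * g x)"
proof -
  have [measurable]: "f \<in> borel_measurable M" "g \<in> borel_measurable M"
    using assms by (auto simp: L2_def)
  show ?thesis
  proof (rule Bochner_Integration.integrable_bound)
    show "integrable M (\<lambda>x. (cmod (f x))\<^sup>2 + (cmod (g x))\<^sup>2)"
      using assms by (auto simp: L2_def)
    have "cmod (f x) * cmod (g x) \<le> (cmod (f x))\<^sup>2 + (cmod (g x))\<^sup>2" for x
      by (intro mult_le_sum_squares) auto
    then show "AE x in M. norm (cnj (f x) * g x) \<le> norm ((cmod (f x))\<^sup>2 + (cmod (g x))\<^sup>2)"
      by (auto simp: norm_mult)
  qed measurable
qed

definition inner_L2 :: "real measure \<Rightarrow> (real \<Rightarrow> complex) \<Rightarrow> (real \<Rightarrow> complex) \<Rightarrow> complex" where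
  "inner_L2 M f g = (CLINT x|M. cnj (f x) * g x)"

lemma inner_L2_self: "inner_L2 M f f = (LINT x|M. (cmod (f x))\<^sup>2)"
proof -
  have "cnj (f x) * f x = complex_of_real ((cmod (f x))\<^sup>2)" for x
    by (metis complex_norm_square mult.commute)
  then show ?thesis unfolding inner_L2_def by (simp del: of_real_power)
qed

lemma inner_L2_commute: "inner_L2 M g f = cnj (inner_L2 M f g)"
proof -
  have "inner_L2 M g f = (CLINT x|M. cnj (cnj (f x) * g x))"
    unfolding inner_L2_def by (intro Bochner_Integration.integral_cong) auto
  also have "\<dots> = cnj (CLINT x|M. cnj (f x) * g x)"
    by (rule Bochner_Integration.integral_cnj)
  finally show ?thesis by (simp add: inner_L2_def)
qed

lemma inner_L2_add:
  assumes "f \<in> L2 M" "g \<in> L2 M" "h \<in> L2 M"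
  shows "inner_L2 M f (\<lambda>x. g x + h x) = inner_L2 M f g + inner_L2 M f h"
  using L2_prod[OF assms(1,2)] L2_prod[OF assms(1,3)]
  by (simp add: inner_L2_def distrib_left)

lemma inner_L2_cmult: "inner_L2 M f (\<lambda>x. c * g x) = c * inner_L2 M f g"
  by (simp add: inner_L2_def mult.left_commute[of _ c])

lemma inner_L2_diff:
  assumes "f \<in> L2 M" "g \<in> L2 M" "h \<in> L2 M"
  shows "inner_L2 M f (\<lambda>x. g x - h x) = inner_L2 M f g - inner_L2 M f h"
  using L2_prod[OF assms(1,2)] L2_prod[OF assms(1,3)]
  by (simp add: inner_L2_def right_diff_distrib)

lemma inner_L2_sum:
  assumes "f \<in> L2 M" "\<And>i. i \<in> I \<Longrightarrow> g i \<in> L2 M"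
  shows "inner_L2 M f (\<lambda>x. \<Sum>i\<in>I. g i x) = (\<Sum>i\<in>I. inner_L2 M f (g i))"
  using L2_prod[OF assms(1) assms(2)]
  by (simp add: inner_L2_def sum_distrib_left Bochner_Integration.integral_sum)

text \<open>Pythagoras: after removal of the component along the unit vector \<open>e\<close>, the
  residual is orthogonal to \<open>e\<close>.\<close>

lemma norm_diff_projection:
  assumes e: "e \<in> L2 M" "inner_L2 M e e = 1" and g: "g \<in> L2 M"
  shows "(LINT x|M. (cmod (g x - inner_L2 M e g * e x))\<^sup>2) =
    (LINT x|M. (cmod (g x))\<^sup>2) - (cmod (inner_L2 M e g))\<^sup>2"
proof -
  define c where "c = inner_L2 M e g"
  have ce: "(\<lambda>x. c * e x) \<in> L2 M" using e(1) by (rule L2_cmult)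
  let ?d = "\<lambda>x. g x - c * e x"
  have d: "?d \<in> L2 M" using g ce by (rule L2_diff)
  have "inner_L2 M e ?d = 0"
    unfolding inner_L2_diff[OF e(1) g ce] inner_L2_cmult e(2) by (simp add: c_def)
  then have "inner_L2 M ?d e = 0" by (subst inner_L2_commute) simp
  then have "inner_L2 M ?d ?d = inner_L2 M ?d g"
    by (simp add: inner_L2_diff[OF d g ce] inner_L2_cmult)
  also have "\<dots> = cnj (inner_L2 M g ?d)" by (rule inner_L2_commute)
  also have "\<dots> = cnj (inner_L2 M g g) - cnj (c * inner_L2 M g e)"
    by (simp add: inner_L2_diff[OF g g ce] inner_L2_cmult)
  also have "inner_L2 M g e = cnj c" unfolding c_def by (rule inner_L2_commute)
  finally have "complex_of_real (LINT x|M. (cmod (?d x))\<^sup>2) =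
      complex_of_real ((LINT x|M. (cmod (g x))\<^sup>2) - (cmod c)\<^sup>2)"
    unfolding inner_L2_self using complex_norm_square[of c] by simp
  then show ?thesis unfolding c_def of_real_eq_iff .
qed

section \<open>Orthonormal polynomials generated by a three-term recurrence\<close>

locale jacobi_measure = finite_measure M for M :: "real measure" +
  fixes \<delta> :: real and \<psi> :: "nat \<Rightarrow> real \<Rightarrow> complex" and A :: "nat \<Rightarrow> real"
  assumes sets_M [measurable_cong, simp]: "sets M = sets borel"
    and \<delta>: "\<delta> > 0" and exp_moment: "integrable M (\<lambda>x. exp (\<delta> * \<bar>x\<bar>))"
    and \<psi>_0: "\<psi> 0 x = 1"
    and A_pos: "A n > 0"
    and recurrence: "x * \<psi> n x = \<i> * (A n * \<psi> (Suc n) x - (if n = 0 then 0 else A (n - 1) * \<psi> (n - 1) x))"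
    and integral_\<psi>: "(CLINT x|M. \<psi> n x) = (if n = 0 then 1 else 0)"
begin

lemma \<psi>_Suc: "\<psi> (Suc n) x = (- \<i> * x * \<psi> n x + (if n = 0 then 0 else A (n - 1) * \<psi> (n - 1) x)) / A n"
proof -
  have "A n * \<psi> (Suc n) x = - \<i> * (x * \<psi> n x) + (if n = 0 then 0 else A (n - 1) * \<psi> (n - 1) x)"
    unfolding recurrence by (simp add: algebra_simps)
  then show ?thesis using A_pos[of n] by (simp add: field_simps)
qed

lemma \<psi>_measurable [measurable]: "\<psi> n \<in> borel_measurable borel"
proof (induction n rule: less_induct)
  case (less n)
  show ?case
  proof (cases n)
    case 0
    then have "\<psi> n = (\<lambda>_. 1)" by (auto simp: \<psi>_0)
    then show ?thesis by simp
  next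
    case (Suc k)
    have [measurable]: "\<psi> k \<in> borel_measurable borel" "\<psi> (k - 1) \<in> borel_measurable borel"
      using less Suc by auto
    have "\<psi> n = (\<lambda>x. (- \<i> * x * \<psi> k x + (if k = 0 then 0 else A (k - 1) * \<psi> (k - 1) x)) / A k)"
      unfolding Suc \<psi>_Suc ..
    then show ?thesis by simp
  qed
qed

text \<open>The rate must vary in the induction: each multiplication by \<open>x\<close> in the
  recurrence is paid for with half of the exponent.\<close>

lemma \<psi>_growth: "\<epsilon> > 0 \<Longrightarrow> \<exists>C\<ge>0. \<forall>x. cmod (\<psi> n x) \<le> C * exp (\<epsilon> * \<bar>x\<bar>)"
proof (induction n arbitrary: \<epsilon> rule: less_induct)
  case (less n)
  show ?case
  proof (cases n)
    case 0
    then show ?thesis using less.prems by (intro exI[of _ 1]) (auto simp: \<psi>_0)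
  next
    case (Suc k)
    obtain C where C: "C \<ge> 0" "\<And>x. cmod (\<psi> k x) \<le> C * exp (\<epsilon> / 2 * \<bar>x\<bar>)"
      using less.IH[of k "\<epsilon> / 2"] less.prems Suc by auto
    obtain D where D: "D \<ge> 0" "\<And>x. cmod (\<psi> (k - 1) x) \<le> D * exp (\<epsilon> * \<bar>x\<bar>)"
      using less.IH[of "k - 1" \<epsilon>] less.prems Suc by fastforce
    have "cmod (\<psi> n x) \<le> (2 / \<epsilon> * C + A (k - 1) * D) / A k * exp (\<epsilon> * \<bar>x\<bar>)" for x
    proof -
      have "\<bar>x\<bar> * exp (\<epsilon> / 2 * \<bar>x\<bar>) \<le> 2 / \<epsilon> * exp (\<epsilon> * \<bar>x\<bar>)"
        using power_mult_exp_le[OF less.prems, of x 1] by simp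
      then have "C * (\<bar>x\<bar> * exp (\<epsilon> / 2 * \<bar>x\<bar>)) \<le> C * (2 / \<epsilon> * exp (\<epsilon> * \<bar>x\<bar>))"
        using C(1) by (intro mult_left_mono)
      moreover have "\<bar>x\<bar> * cmod (\<psi> k x) \<le> \<bar>x\<bar> * (C * exp (\<epsilon> / 2 * \<bar>x\<bar>))"
        using C(2) by (intro mult_left_mono) auto
      ultimately have 1: "\<bar>x\<bar> * cmod (\<psi> k x) \<le> 2 / \<epsilon> * C * exp (\<epsilon> * \<bar>x\<bar>)"
        by (simp add: mult_ac)
      have 2: "A (k - 1) * cmod (\<psi> (k - 1) x) \<le> A (k - 1) * D * exp (\<epsilon> * \<bar>x\<bar>)"
        using D(2)[of x] A_pos[of "k - 1"] by simp
      have "cmod (- \<i> * x * \<psi> k x + (if k = 0 then 0 else A (k - 1) * \<psi> (k - 1) x)) \<le>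
          \<bar>x\<bar> * cmod (\<psi> k x) + A (k - 1) * cmod (\<psi> (k - 1) x)"
        using A_pos[of "k - 1"] by (intro norm_triangle_mono) (auto simp: norm_mult)
      then have "cmod (- \<i> * x * \<psi> k x + (if k = 0 then 0 else A (k - 1) * \<psi> (k - 1) x)) \<le>
          (2 / \<epsilon> * C + A (k - 1) * D) * exp (\<epsilon> * \<bar>x\<bar>)"
        using 1 2 by (simp add: distrib_right)
      then show ?thesis
        unfolding Suc \<psi>_Suc norm_divide using A_pos[of k] by (simp add: divide_right_mono)
    qed
    moreover have "(2 / \<epsilon> * C + A (k - 1) * D) / A k \<ge> 0"
      using C(1) D(1) A_pos[of k] A_pos[of "k - 1"] less.prems by simp
    ultimately show ?thesis by blast
  qed
qed

lemma \<psi>_L2 [simp]: "\<psi> n \<in> L2 M"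
proof -
  obtain C where C: "C \<ge> 0" "\<And>x. cmod (\<psi> n x) \<le> C * exp (\<delta> / 2 * \<bar>x\<bar>)"
    using \<psi>_growth[of "\<delta> / 2" n] \<delta> by auto
  have "integrable M (\<lambda>x. (cmod (\<psi> n x))\<^sup>2)"
  proof (rule Bochner_Integration.integrable_bound)
    show "integrable M (\<lambda>x. C\<^sup>2 * exp (\<delta> * \<bar>x\<bar>))" using exp_moment by simp
    have "(cmod (\<psi> n x))\<^sup>2 \<le> C\<^sup>2 * exp (\<delta> * \<bar>x\<bar>)" for x
    proof -
      have "(cmod (\<psi> n x))\<^sup>2 \<le> (C * exp (\<delta> / 2 * \<bar>x\<bar>))\<^sup>2" by (intro power_mono C(2)) auto
      also have "\<dots> = C\<^sup>2 * exp (\<delta> * \<bar>x\<bar>)"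
        by (simp add: power_mult_distrib power2_eq_square flip: exp_add)
      finally show ?thesis .
    qed
    then show "AE x in M. norm ((cmod (\<psi> n x))\<^sup>2) \<le> norm (C\<^sup>2 * exp (\<delta> * \<bar>x\<bar>))" by simp
  qed measurable
  then show ?thesis by (simp add: L2_def)
qed

text \<open>Passes from square integrability to the weighted integrability required for determinacy
  by moments; the exponent is halved because a product is estimated by two squares.\<close>

lemma exp_weighted_integrable:
  assumes "g \<in> L2 M"
  shows "integrable M (\<lambda>x. exp (\<delta> / 2 * \<bar>x\<bar>) * cmod (g x))"
proof -
  have [measurable]: "g \<in> borel_measurable M" by (rule L2_measurable[OF assms])
  show ?thesis
  proof (rule Bochner_Integration.integrable_bound)
    show "integrable M (\<lambda>x. exp (\<delta> * \<bar>x\<bar>) + (cmod (g x))\<^sup>2)"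
      using exp_moment L2D[OF assms] by simp
    have "exp (\<delta> / 2 * \<bar>x\<bar>) * cmod (g x) \<le> exp (\<delta> * \<bar>x\<bar>) + (cmod (g x))\<^sup>2" for x
      using mult_le_sum_squares[of "exp (\<delta> / 2 * \<bar>x\<bar>)" "cmod (g x)"]
      by (simp add: power2_eq_square flip: exp_add)
    then show "AE x in M. norm (exp (\<delta> / 2 * \<bar>x\<bar>) * cmod (g x)) \<le> norm (exp (\<delta> * \<bar>x\<bar>) + (cmod (g x))\<^sup>2)"
      by simp
  qed measurable
qed

lemma exp_weighted_integrable_power:
  fixes h :: "real \<Rightarrow> complex"
  assumes \<epsilon>: "\<epsilon> > 0" and h: "h \<in> borel_measurable M" "integrable M (\<lambda>x. exp (\<epsilon> * \<bar>x\<bar>) * cmod (h x))"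
  shows "integrable M (\<lambda>x. exp (\<epsilon> / 2 * \<bar>x\<bar>) * cmod (x ^ k * h x))"
proof (rule Bochner_Integration.integrable_bound)
  note [measurable] = h(1)
  show "integrable M (\<lambda>x. fact k / (\<epsilon> / 2) ^ k * (exp (\<epsilon> * \<bar>x\<bar>) * cmod (h x)))"
    using h by simp
  show "AE x in M. norm (exp (\<epsilon> / 2 * \<bar>x\<bar>) * cmod (x ^ k * h x)) \<le>
      norm (fact k / (\<epsilon> / 2) ^ k * (exp (\<epsilon> * \<bar>x\<bar>) * cmod (h x)))"
    using mult_right_mono[OF power_mult_exp_le[OF \<epsilon>, of _ k], of "cmod (h _)"] \<epsilon>
    by (auto simp: abs_mult norm_mult norm_power mult_ac)
  show "(\<lambda>x. exp (\<epsilon> / 2 * \<bar>x\<bar>) * cmod (x ^ k * h x)) \<in> borel_measurable M" by measurable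
qed

lemma integrable_mult_\<psi>:
  fixes h :: "real \<Rightarrow> complex"
  assumes \<epsilon>: "\<epsilon> > 0" and h: "h \<in> borel_measurable M" "integrable M (\<lambda>x. exp (\<epsilon> * \<bar>x\<bar>) * cmod (h x))"
  shows "integrable M (\<lambda>x. h x * \<psi> n x)"
proof -
  note [measurable] = h(1)
  obtain C where C: "C \<ge> 0" "\<And>x. cmod (\<psi> n x) \<le> C * exp (\<epsilon> * \<bar>x\<bar>)"
    using \<psi>_growth[of \<epsilon> n] \<epsilon> by auto
  show ?thesis
  proof (rule Bochner_Integration.integrable_bound)
    show "integrable M (\<lambda>x. C * (exp (\<epsilon> * \<bar>x\<bar>) * cmod (h x)))" using h by simp
    show "AE x in M. norm (h x * \<psi> n x) \<le> norm (C * (exp (\<epsilon> * \<bar>x\<bar>) * cmod (h x)))"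
      using mult_left_mono[OF C(2), of "cmod (h _)"] C(1) by (auto simp: norm_mult mult_ac)
  qed measurable
qed

text \<open>The recurrence trades a factor \<open>x\<close> for neighbouring indices, so
  orthogonality to all \<open>\<psi> n\<close> is inherited by \<open>x ^ k * h\<close>; pairing
  with \<open>\<psi> 0 = 1\<close> then gives vanishing moments. Only exponential integrability of
  \<open>h\<close> is assumed, which is what \<open>mult_ident_if_coeffs\<close> relies on.\<close>

lemma AE_eq_0_if_orthogonal:
  fixes h :: "real \<Rightarrow> complex"
  assumes \<epsilon>: "\<epsilon> > 0" and h: "h \<in> borel_measurable M" "integrable M (\<lambda>x. exp (\<epsilon> * \<bar>x\<bar>) * cmod (h x))"
    and zero: "\<And>n. (CLINT x|M. h x * \<psi> n x) = 0"
  shows "AE x in M. h x = 0"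
proof (rule AE_eq_0_if_moments_eq_0[OF finite_measure_axioms sets_M \<epsilon> h])
  fix k
  have int: "integrable M (\<lambda>x. (x ^ k * h x) * \<psi> n x)" for k n
    using \<epsilon> h exp_weighted_integrable_power[OF \<epsilon> h, of k]
    by (intro integrable_mult_\<psi>[of "\<epsilon> / 2"]) auto
  have "(CLINT x|M. (x ^ k * h x) * \<psi> n x) = 0" for n
  proof (induction k arbitrary: n)
    case (Suc k)
    have "(CLINT x|M. (x ^ Suc k * h x) * \<psi> n x) = (CLINT x|M. (x ^ k * h x) * (x * \<psi> n x))"
      by (intro Bochner_Integration.integral_cong) auto
    also have "\<dots> = (CLINT x|M. \<i> * A n * ((x ^ k * h x) * \<psi> (Suc n) x) -
        (if n = 0 then 0 else \<i> * A (n - 1)) * ((x ^ k * h x) * \<psi> (n - 1) x))"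
      unfolding recurrence by (intro Bochner_Integration.integral_cong) (auto simp: algebra_simps)
    also have "\<dots> = \<i> * A n * (CLINT x|M. (x ^ k * h x) * \<psi> (Suc n) x) -
        (if n = 0 then 0 else \<i> * A (n - 1)) * (CLINT x|M. (x ^ k * h x) * \<psi> (n - 1) x)"
      using int[of k "Suc n"] int[of k "n - 1"] by (subst Bochner_Integration.integral_diff) auto
    also have "\<dots> = 0" using Suc[of "Suc n"] Suc[of "n - 1"] by simp
    finally show ?case .
  qed (use zero in simp)
  from this[of 0] show "(CLINT x|M. complex_of_real x ^ k * h x) = 0" by (simp add: \<psi>_0)
qed

lemma L2_complete:
  assumes g: "g \<in> L2 M" and zero: "\<And>n. inner_L2 M (\<psi> n) g = 0"
  shows "AE x in M. g x = 0"
proof -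
  have [measurable]: "g \<in> borel_measurable M" by (rule L2_measurable[OF g])
  have "inner_L2 M g (\<psi> n) = 0" for n using zero by (subst inner_L2_commute) simp
  then have "AE x in M. cnj (g x) = 0"
    using exp_weighted_integrable[OF g] \<delta>
    by (intro AE_eq_0_if_orthogonal[of "\<delta> / 2"]) (auto simp: inner_L2_def)
  then show ?thesis by simp
qed

text \<open>Moving the factor \<open>x\<close> from one side of the inner product to the other
  expresses row \<open>k + 1\<close> of the Gram matrix through rows \<open>k\<close> and
  \<open>k - 1\<close>; row 0 is \<open>integral_\<psi>\<close>.\<close>

lemma inner_L2_\<psi>: "inner_L2 M (\<psi> m) (\<psi> n) = (if m = n then 1 else 0)"
proof (induction m arbitrary: n rule: less_induct)
  case (less m)
  show ?case
  proof (cases m)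
    case 0
    then show ?thesis using integral_\<psi>[of n] by (simp add: inner_L2_def \<psi>_0)
  next
    case (Suc k)
    \<comment> \<open>Since \<open>B 0 = 0\<close>, the recurrence takes one form for all indices
      and the truncated \<open>j - 1\<close> does no harm.\<close>
    define B where "B j = (if j = 0 then 0 else complex_of_real (A (j - 1)))" for j
    have rec: "x * \<psi> j x = \<i> * A j * \<psi> (Suc j) x - \<i> * B j * \<psi> (j - 1) x" for j x
      using recurrence[of x j] by (cases "j = 0") (simp_all add: B_def algebra_simps)
    have lin: "(\<lambda>x. \<i> * A j * \<psi> (Suc j) x) \<in> L2 M" "(\<lambda>x. \<i> * B j * \<psi> (j - 1) x) \<in> L2 M" for j
      by (intro L2_cmult \<psi>_L2)+
    have right: "inner_L2 M (\<psi> i) (\<lambda>x. x * \<psi> j x) = \<i> * A j * inner_L2 M (\<psi> i) (\<psi> (Suc j))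
        - \<i> * B j * inner_L2 M (\<psi> i) (\<psi> (j - 1))" for i j
      unfolding rec inner_L2_diff[OF \<psi>_L2 lin] inner_L2_cmult ..
    have sym: "inner_L2 M (\<psi> i) (\<lambda>x. x * \<psi> j x) = cnj (inner_L2 M (\<psi> j) (\<lambda>x. x * \<psi> i x))" for i j
    proof -
      have "inner_L2 M (\<psi> i) (\<lambda>x. x * \<psi> j x) = inner_L2 M (\<lambda>x. x * \<psi> i x) (\<psi> j)"
        unfolding inner_L2_def by (intro Bochner_Integration.integral_cong) auto
      then show ?thesis by (simp add: inner_L2_commute[of M "\<lambda>x. x * \<psi> i x"])
    qed
    have c: "cnj (inner_L2 M (\<psi> j) (\<psi> i)) = inner_L2 M (\<psi> i) (\<psi> j)" for i j
      by (rule inner_L2_commute[symmetric])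
    have "\<i> * A n * inner_L2 M (\<psi> k) (\<psi> (Suc n)) - \<i> * B n * inner_L2 M (\<psi> k) (\<psi> (n - 1)) =
        - \<i> * A k * inner_L2 M (\<psi> (Suc k)) (\<psi> n) + \<i> * B k * inner_L2 M (\<psi> (k - 1)) (\<psi> n)"
      using sym[of k n] unfolding right by (simp add: c B_def)
    then have "\<i> * (A k * inner_L2 M (\<psi> m) (\<psi> n)) = \<i> * (B k * inner_L2 M (\<psi> (k - 1)) (\<psi> n)
       - A n * inner_L2 M (\<psi> k) (\<psi> (Suc n)) + B n * inner_L2 M (\<psi> k) (\<psi> (n - 1)))"
      unfolding Suc by (simp add: algebra_simps)
    then have *: "A k * inner_L2 M (\<psi> m) (\<psi> n) = B k * inner_L2 M (\<psi> (k - 1)) (\<psi> n)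
       - A n * inner_L2 M (\<psi> k) (\<psi> (Suc n)) + B n * inner_L2 M (\<psi> k) (\<psi> (n - 1))"
      unfolding mult_cancel_left by simp
    \<comment> \<open>By the induction hypothesis the first two terms cancel, both being
      \<open>A (k - 1)\<close> in size when \<open>n = k - 1\<close>; the third equals
      \<open>A k\<close> exactly for \<open>n = k + 1\<close>.\<close>
    have "A k * inner_L2 M (\<psi> m) (\<psi> n) = A k * (if m = n then 1 else 0)"
      unfolding * using less[of k] less[of "k - 1"] Suc by (auto simp: B_def)
    then show ?thesis using A_pos[of k] by simp
  qed
qed

section \<open>Expansions: Bessel, Riesz-Fischer and Parseval\<close>

definition expansion :: "vec \<Rightarrow> nat \<Rightarrow> real \<Rightarrow> complex" where
  "expansion f N x = (\<Sum>n<N. f n * \<psi> n x)"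

definition coeffs :: "(real \<Rightarrow> complex) \<Rightarrow> vec" where
  "coeffs g n = inner_L2 M (\<psi> n) g"

lemma expansion_L2 [simp]: "expansion f N \<in> L2 M"
  unfolding expansion_def by (intro L2_sum L2_cmult \<psi>_L2)

lemma coeffs_expansion: "coeffs (expansion f N) n = (if n < N then f n else 0)"
proof -
  have "coeffs (expansion f N) n = (\<Sum>k<N. f k * inner_L2 M (\<psi> n) (\<psi> k))"
    unfolding coeffs_def expansion_def
    by (subst inner_L2_sum) (auto simp: inner_L2_cmult intro!: L2_cmult)
  also have "\<dots> = (\<Sum>k<N. if k = n then f n else 0)"
    by (intro sum.cong) (auto simp: inner_L2_\<psi>)
  finally show ?thesis by simp
qed

lemma coeffs_diff:
  "f \<in> L2 M \<Longrightarrow> g \<in> L2 M \<Longrightarrow>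
    coeffs (\<lambda>x. f x - g x) = coeffs f - coeffs g"
  by (auto simp: coeffs_def inner_L2_diff fun_eq_iff)

text \<open>Each new term removes one squared coefficient, because coefficient \<open>N\<close> of
  the residual is still that of \<open>g\<close>.\<close>

lemma norm_residual:
  assumes g: "g \<in> L2 M"
  shows "(LINT x|M. (cmod (g x - expansion (coeffs g) N x))\<^sup>2) =
    (LINT x|M. (cmod (g x))\<^sup>2) - (\<Sum>n<N. (cmod (coeffs g n))\<^sup>2)"
proof (induction N)
  case 0
  then show ?case by (simp add: expansion_def)
next
  case (Suc N)
  let ?r = "\<lambda>x. g x - expansion (coeffs g) N x"
  have r: "?r \<in> L2 M"
    by (intro L2_diff g) simp
  have "inner_L2 M (\<psi> N) ?r = coeffs g N"
    using coeffs_diff[OF g expansion_L2, of "coeffs g" N]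
    by (simp add: fun_eq_iff coeffs_expansion) (simp add: coeffs_def)
  then have "(LINT x|M. (cmod (?r x - coeffs g N * \<psi> N x))\<^sup>2) =
      (LINT x|M. (cmod (?r x))\<^sup>2) - (cmod (coeffs g N))\<^sup>2"
    using norm_diff_projection[of "\<psi> N" M ?r] r by (simp add: inner_L2_\<psi>)
  then show ?case using Suc by (simp add: expansion_def algebra_simps)
qed

lemma bessel: "g \<in> L2 M \<Longrightarrow> (\<Sum>n<N. (cmod (coeffs g n))\<^sup>2) \<le> (LINT x|M. (cmod (g x))\<^sup>2)"
  using norm_residual[of g N] Bochner_Integration.integral_nonneg[of M "\<lambda>x. (cmod (g x - expansion (coeffs g) N x))\<^sup>2"]
  by simp

lemma coeffs_ell2: "g \<in> L2 M \<Longrightarrow> coeffs g \<in> ell2"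
  unfolding ell2_def using bessel by (auto intro!: summableI_nonneg_bounded)

lemma coeffs_le: "g \<in> L2 M \<Longrightarrow> (cmod (coeffs g n))\<^sup>2 \<le> (LINT x|M. (cmod (g x))\<^sup>2)"
  using bessel[of g "Suc n"] sum_nonneg[of "{..<n}" "\<lambda>n. (cmod (coeffs g n))\<^sup>2"] by simp

text \<open>Apply \<open>norm_residual\<close> to \<open>expansion f N'\<close> itself, whose
  coefficients are those of \<open>f\<close> cut off at \<open>N'\<close>.\<close>

lemma norm_expansion_diff:
  assumes "N \<le> N'"
  shows "(LINT x|M. (cmod (expansion f N' x - expansion f N x))\<^sup>2) = (\<Sum>n=N..<N'. (cmod (f n))\<^sup>2)"
proof -
  let ?c = "coeffs (expansion f N')"
  have eq: "expansion ?c K = expansion f K" if "K \<le> N'" for K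
    using that by (auto simp: expansion_def fun_eq_iff coeffs_expansion)
  have sums: "(\<Sum>n<K. (cmod (?c n))\<^sup>2) = (\<Sum>n<K. (cmod (f n))\<^sup>2)" if "K \<le> N'" for K
    using that by (auto simp: coeffs_expansion)
  have "(LINT x|M. (cmod (expansion f N' x))\<^sup>2) = (\<Sum>n<N'. (cmod (f n))\<^sup>2)"
    using norm_residual[of "expansion f N'" N'] by (simp add: eq sums)
  then have "(LINT x|M. (cmod (expansion f N' x - expansion f N x))\<^sup>2) =
      (\<Sum>n<N'. (cmod (f n))\<^sup>2) - (\<Sum>n<N. (cmod (f n))\<^sup>2)"
    using norm_residual[of "expansion f N'" N] assms by (simp add: eq sums)
  also have "\<dots> = (\<Sum>n=N..<N'. (cmod (f n))\<^sup>2)"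
    using assms sum_diff_nat_ivl[of 0 N N' "\<lambda>n. (cmod (f n))\<^sup>2"] by (simp add: lessThan_atLeast0)
  finally show ?thesis .
qed

lemma norm_expansion_diff_le:
  assumes "f \<in> ell2" "(\<Sum>n. (cmod (f (n + N)))\<^sup>2) \<le> c" "(\<Sum>n. (cmod (f (n + N')))\<^sup>2) \<le> c"
  shows "(LINT x|M. (cmod (expansion f N' x - expansion f N x))\<^sup>2) \<le> c"
  using assms(2,3)
proof (induction N N' rule: linorder_wlog)
  case (sym N N')
  then show ?case by (simp add: norm_minus_commute)
next
  case (le N N')
  have "(\<Sum>n=N..<N'. (cmod (f n))\<^sup>2) = (\<Sum>n<N' - N. (cmod (f (n + N)))\<^sup>2)"
    using sum.shift_bounds_nat_ivl[of "\<lambda>n. (cmod (f n))\<^sup>2" 0 N "N' - N"] le by (simp add: lessThan_atLeast0)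
  also have "\<dots> \<le> (\<Sum>n. (cmod (f (n + N)))\<^sup>2)"
    using summable_ignore_initial_segment[OF ell2D[OF assms(1)], of N] by (intro sum_le_suminf) auto
  finally show ?case using le by (simp add: norm_expansion_diff)
qed

text \<open>A rapidly converging subsequence of the partial sums converges almost everywhere, and Fatou's
  lemma turns this into convergence in mean square.\<close>

lemma riesz_fischer:
  assumes f: "f \<in> ell2"
  shows "\<exists>g\<in>L2 M. \<exists>N. filterlim N at_top sequentially \<and>
    (\<lambda>k. LINT x|M. (cmod (g x - expansion f (N k) x))\<^sup>2) \<longlonglongrightarrow> 0"
proof -
  \<comment> \<open>Tails of at most \<open>(1 / 4) ^ k\<close> place consecutive chosen partial
    sums at distance at most \<open>(1 / 2) ^ k\<close> in mean square, a summable sequence.\<close>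
  have "\<exists>N\<ge>k. (\<Sum>n. (cmod (f (n + N)))\<^sup>2) \<le> (1 / 4) ^ k" for k
  proof -
    have "eventually (\<lambda>N. (\<Sum>n. (cmod (f (n + N)))\<^sup>2) < (1 / 4) ^ k) sequentially"
      using suminf_exist_split2[OF ell2D[OF f]] by (rule order_tendstoD) simp
    then have "eventually (\<lambda>N. (\<Sum>n. (cmod (f (n + N)))\<^sup>2) < (1 / 4) ^ k \<and> N \<ge> k) sequentially"
      by (intro eventually_conj eventually_ge_at_top)
    then show ?thesis using eventually_happens'[OF sequentially_bot] by (metis (no_types, lifting) less_imp_le)
  qed
  then obtain N where N: "\<And>k. N k \<ge> k" "\<And>k. (\<Sum>n. (cmod (f (n + N k)))\<^sup>2) \<le> (1 / 4) ^ k" by metis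
  have N_lim: "filterlim N at_top sequentially"
    using N(1) by (intro filterlim_at_top_mono[OF filterlim_ident]) auto
  let ?S = "\<lambda>k. expansion f (N k)"
  have [measurable]: "?S k \<in> borel_measurable M" for k
    by (rule L2_measurable) simp
  have close: "(LINT x|M. (cmod (?S j x - ?S k x))\<^sup>2) \<le> (1 / 4) ^ k" if "k \<le> j" for j k
  proof (rule norm_expansion_diff_le[OF f N(2)])
    have "(1 / 4 :: real) ^ j \<le> (1 / 4) ^ k" using that by (intro power_decreasing) auto
    then show "(\<Sum>n. (cmod (f (n + N j)))\<^sup>2) \<le> (1 / 4) ^ k" using N(2)[of j] by linarith
  qed
  define D where "D k x = ?S (Suc k) x - ?S k x" for k x
  have D: "D k \<in> L2 M" for k
    unfolding D_def by (intro L2_diff) auto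
  have [measurable]: "D k \<in> borel_measurable M" for k
    by (rule L2_measurable[OF D])
  have D_int: "integrable M (\<lambda>x. norm (D k x))"
    and D_le: "(LINT x|M. norm (D k x)) \<le> (measure M (space M) + 1) * (1 / 2) ^ k" for k
  proof -
    \<comment> \<open>The factor \<open>2 ^ k\<close> balances the two sides of the inequality:
      after integration both terms are of order \<open>(1 / 2) ^ k\<close>.\<close>
    have pt: "norm (D k x) \<le> (1 / 2) ^ k + 2 ^ k * (cmod (D k x))\<^sup>2" for x
    proof -
      have "2 ^ k * norm (D k x) * 1 \<le> (2 ^ k * norm (D k x))\<^sup>2 + 1\<^sup>2"
        by (intro mult_le_sum_squares) auto
      then show ?thesis by (simp add: power_one_over field_simps power2_eq_square)
    qed
    have int: "integrable M (\<lambda>x. (1 / 2) ^ k + 2 ^ k * (cmod (D k x))\<^sup>2)"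
      using L2D[OF D[of k]] by simp
    show 1: "integrable M (\<lambda>x. norm (D k x))"
      using pt by (intro Bochner_Integration.integrable_bound[OF int]) (auto intro!: AE_I2 order_trans[OF pt abs_ge_self])
    have "(LINT x|M. norm (D k x)) \<le> (LINT x|M. (1 / 2) ^ k + 2 ^ k * (cmod (D k x))\<^sup>2)"
      by (intro integral_mono 1 int pt)
    also have "\<dots> = (1 / 2) ^ k * measure M (space M) + 2 ^ k * (LINT x|M. (cmod (D k x))\<^sup>2)"
      using L2D[OF D[of k]] by simp
    also have "\<dots> \<le> (1 / 2) ^ k * measure M (space M) + 2 ^ k * (1 / 4) ^ k"
      using close[of k "Suc k"] by (simp add: D_def)
    also have "2 ^ k * (1 / 4) ^ k = (1 / 2 :: real) ^ k"
      by (simp flip: power_mult_distrib)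
    finally show "(LINT x|M. norm (D k x)) \<le> (measure M (space M) + 1) * (1 / 2) ^ k"
      by (simp add: algebra_simps)
  qed
  have "AE x in M. (\<Sum>k. ennreal (norm (D k x))) \<noteq> \<infinity>"
  proof (rule nn_integral_PInf_AE)
    have "(\<integral>\<^sup>+x. (\<Sum>k. ennreal (norm (D k x))) \<partial>M) = (\<Sum>k. \<integral>\<^sup>+x. ennreal (norm (D k x)) \<partial>M)"
      by (intro nn_integral_suminf) measurable
    also have "\<dots> = (\<Sum>k. ennreal (LINT x|M. norm (D k x)))"
      using D_int by (intro suminf_cong nn_integral_eq_integral) auto
    also have "\<dots> \<le> (\<Sum>k. ennreal ((measure M (space M) + 1) * (1 / 2) ^ k))"
      using D_le by (intro suminf_le) (auto intro: ennreal_leI)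
    also have "\<dots> = ennreal (\<Sum>k. (measure M (space M) + 1) * (1 / 2) ^ k)"
      by (intro suminf_ennreal2 summable_mult) (auto simp: summable_geometric)
    also have "\<dots> < \<infinity>" by simp
    finally show "(\<integral>\<^sup>+x. (\<Sum>k. ennreal (norm (D k x))) \<partial>M) \<noteq> \<infinity>" by simp
  qed measurable
  then have conv: "AE x in M. convergent (\<lambda>k. ?S k x)"
  proof eventually_elim
    fix x assume "(\<Sum>k. ennreal (norm (D k x))) \<noteq> \<infinity>"
    then have "summable (\<lambda>k. norm (D k x))"
      by (intro summable_suminf_not_top) auto
    then have "summable (\<lambda>k. D k x)" by (rule summable_norm_cancel)
    then have "convergent (\<lambda>k. ?S 0 x + (\<Sum>j<k. D j x))"
      by (intro convergent_add convergent_const) (simp add: summable_iff_convergent)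
    moreover have "?S 0 x + (\<Sum>j<k. D j x) = ?S k x" for k
      unfolding D_def using sum_lessThan_telescope[of "\<lambda>k. ?S k x" k] by simp
    ultimately show "convergent (\<lambda>k. ?S k x)" by simp
  qed
  \<comment> \<open>Off the null set of divergence \<open>lim\<close> has a fixed unspecified value,
    which the almost everywhere arguments never see.\<close>
  define g where "g x = lim (\<lambda>k. ?S k x)" for x
  have [measurable]: "g \<in> borel_measurable M"
    unfolding g_def by measurable
  have bound: "(\<integral>\<^sup>+x. ennreal ((cmod (g x - ?S k x))\<^sup>2) \<partial>M) \<le> ennreal ((1 / 4) ^ k)" for k
  proof -
    have "(\<integral>\<^sup>+x. ennreal ((cmod (g x - ?S k x))\<^sup>2) \<partial>M) =
        (\<integral>\<^sup>+x. liminf (\<lambda>j. ennreal ((cmod (?S j x - ?S k x))\<^sup>2)) \<partial>M)"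
    proof (rule nn_integral_cong_AE)
      show "AE x in M. ennreal ((cmod (g x - ?S k x))\<^sup>2) = liminf (\<lambda>j. ennreal ((cmod (?S j x - ?S k x))\<^sup>2))"
        using conv
      proof eventually_elim
        fix x assume "convergent (\<lambda>k. ?S k x)"
        then have "(\<lambda>j. ?S j x) \<longlonglongrightarrow> g x" by (simp add: g_def convergent_LIMSEQ_iff)
        then have "(\<lambda>j. ennreal ((cmod (?S j x - ?S k x))\<^sup>2)) \<longlonglongrightarrow> ennreal ((cmod (g x - ?S k x))\<^sup>2)"
          by (intro tendsto_intros)
        then show "ennreal ((cmod (g x - ?S k x))\<^sup>2) = liminf (\<lambda>j. ennreal ((cmod (?S j x - ?S k x))\<^sup>2))"
          by (intro lim_imp_Liminf[symmetric]) auto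
      qed
    qed
    also have "\<dots> \<le> liminf (\<lambda>j. \<integral>\<^sup>+x. ennreal ((cmod (?S j x - ?S k x))\<^sup>2) \<partial>M)"
      by (intro nn_integral_liminf) measurable
    also have "\<dots> \<le> ennreal ((1 / 4) ^ k)"
    proof (rule Liminf_le)
      have "(\<integral>\<^sup>+x. ennreal ((cmod (?S j x - ?S k x))\<^sup>2) \<partial>M) \<le> ennreal ((1 / 4) ^ k)" if "k \<le> j" for j
        using close[OF that] L2D[OF L2_diff, of "?S j" M "?S k"]
        by (subst nn_integral_eq_integral) (auto intro: ennreal_leI)
      then show "\<forall>\<^sub>F j in sequentially. (\<integral>\<^sup>+x. ennreal ((cmod (?S j x - ?S k x))\<^sup>2) \<partial>M) \<le> ennreal ((1 / 4) ^ k)"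
        by (rule eventually_sequentiallyI)
    qed simp
    finally show ?thesis .
  qed
  have diff: "(\<lambda>x. g x - ?S k x) \<in> L2 M" for k
  proof -
    have "integrable M (\<lambda>x. (cmod (g x - ?S k x))\<^sup>2)"
      using bound[of k] by (intro integrableI_bounded) (auto simp: less_top[symmetric] top_unique)
    then show ?thesis by (simp add: L2_def)
  qed
  have g: "g \<in> L2 M"
    using L2_add[OF diff[of 0] expansion_L2[of f "N 0"]] by simp
  have "(LINT x|M. (cmod (g x - ?S k x))\<^sup>2) \<le> (1 / 4) ^ k" for k
    using bound[of k] L2D[OF diff[of k]]
    by (subst (asm) nn_integral_eq_integral) auto
  then have "(\<lambda>k. LINT x|M. (cmod (g x - ?S k x))\<^sup>2) \<longlonglongrightarrow> 0"
    by (intro tendsto_sandwich[OF _ _ tendsto_const LIMSEQ_realpow_zero[of "1 / 4"]] always_eventually allI) simp_all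
  then show ?thesis using g N_lim by blast
qed

text \<open>Coefficients are continuous in mean square, and coefficient \<open>n\<close> of the
  partial sums is constant once \<open>N k > n\<close>. The norm comes from passing to the limit in
  \<open>norm_residual\<close>.\<close>

lemma coeffs_surj:
  assumes f: "f \<in> ell2"
  shows "\<exists>g\<in>L2 M. coeffs g = f \<and> (LINT x|M. (cmod (g x))\<^sup>2) = (\<Sum>n. (cmod (f n))\<^sup>2)"
proof -
  obtain g N where g: "g \<in> L2 M" and N: "filterlim N at_top sequentially"
    and lim: "(\<lambda>k. LINT x|M. (cmod (g x - expansion f (N k) x))\<^sup>2) \<longlonglongrightarrow> 0"
    using riesz_fischer[OF f] by blast
  have coeffs: "coeffs g n = f n" for n
  proof -
    have sq: "(\<lambda>k. (cmod (coeffs g n - coeffs (expansion f (N k)) n))\<^sup>2) \<longlonglongrightarrow> 0"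
    proof (rule tendsto_sandwich[OF _ _ tendsto_const lim])
      have "(cmod (coeffs g n - coeffs (expansion f (N k)) n))\<^sup>2 \<le>
          (LINT x|M. (cmod (g x - expansion f (N k) x))\<^sup>2)" for k
        using coeffs_le[OF L2_diff[OF g expansion_L2[of f "N k"]], of n]
        unfolding coeffs_diff[OF g expansion_L2] by simp
      then show "\<forall>\<^sub>F k in sequentially. (cmod (coeffs g n - coeffs (expansion f (N k)) n))\<^sup>2 \<le>
          (LINT x|M. (cmod (g x - expansion f (N k) x))\<^sup>2)"
        by simp
    qed auto
    have "\<forall>\<^sub>F k in sequentially. N k > n"
      by (rule eventually_compose_filterlim[OF eventually_gt_at_top N])
    then have "\<forall>\<^sub>F k in sequentially. (cmod (coeffs g n - coeffs (expansion f (N k)) n))\<^sup>2 = (cmod (coeffs g n - f n))\<^sup>2"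
      by eventually_elim (simp add: coeffs_expansion)
    with sq have "(\<lambda>_. (cmod (coeffs g n - f n))\<^sup>2) \<longlonglongrightarrow> 0"
      by (rule Lim_transform_eventually)
    then show ?thesis by (simp add: LIMSEQ_const_iff)
  qed
  then have coeffs': "coeffs g = f" by auto
  have "(\<lambda>k. (LINT x|M. (cmod (g x))\<^sup>2) - (\<Sum>n<N k. (cmod (f n))\<^sup>2)) \<longlonglongrightarrow> 0"
    using lim norm_residual[OF g] by (simp add: coeffs')
  moreover have "(\<lambda>k. (LINT x|M. (cmod (g x))\<^sup>2) - (\<Sum>n<N k. (cmod (f n))\<^sup>2)) \<longlonglongrightarrow>
      (LINT x|M. (cmod (g x))\<^sup>2) - (\<Sum>n. (cmod (f n))\<^sup>2)"
    by (intro tendsto_intros filterlim_compose[OF _ N] summable_LIMSEQ ell2D f)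
  ultimately have "(LINT x|M. (cmod (g x))\<^sup>2) - (\<Sum>n. (cmod (f n))\<^sup>2) = 0"
    by (rule LIMSEQ_unique[symmetric])
  then show ?thesis using g coeffs' by auto
qed

lemma coeffs_inj:
  assumes "g \<in> L2 M" "h \<in> L2 M" "coeffs g = coeffs h"
  shows "AE x in M. g x = h x"
proof -
  have "AE x in M. g x - h x = 0"
    using assms(3) coeffs_diff[OF assms(1,2)] L2_diff[OF assms(1,2)]
    by (intro L2_complete) (auto simp: coeffs_def fun_eq_iff)
  then show ?thesis by simp
qed

text \<open>By completeness \<open>g\<close> agrees almost everywhere with the function that
  \<open>coeffs_surj\<close> produces from its coefficients, and for that one the norm is
  known.\<close>

lemma parseval_norm:
  assumes g: "g \<in> L2 M"
  shows "(LINT x|M. (cmod (g x))\<^sup>2) = (\<Sum>n. (cmod (coeffs g n))\<^sup>2)"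
proof -
  obtain h where h: "h \<in> L2 M" "coeffs h = coeffs g"
    "(LINT x|M. (cmod (h x))\<^sup>2) = (\<Sum>n. (cmod (coeffs g n))\<^sup>2)"
    using coeffs_surj[OF coeffs_ell2[OF g]] by auto
  have [measurable]: "g \<in> borel_measurable M" "h \<in> borel_measurable M"
    using g h by (auto dest: L2_measurable)
  have "AE x in M. g x = h x" using g h by (intro coeffs_inj) auto
  then have "(LINT x|M. (cmod (g x))\<^sup>2) = (LINT x|M. (cmod (h x))\<^sup>2)"
    by (intro integral_cong_AE) auto
  then show ?thesis using h(3) by simp
qed

section \<open>Multiplication by the coordinate, seen on coefficients\<close>

lemma mult_ident_coeffs:
  fixes u :: "real \<Rightarrow> complex"
  assumes u: "u \<in> L2 M" "(\<lambda>x. x * u x) \<in> L2 M"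
  shows "coeffs (\<lambda>x. x * u x) n = \<i> * ((if n = 0 then 0 else A (n - 1) * coeffs u (n - 1)) - A n * coeffs u (Suc n))"
proof -
  have "coeffs (\<lambda>x. x * u x) n = (CLINT x|M. cnj (x * \<psi> n x) * u x)"
    unfolding coeffs_def inner_L2_def by (intro Bochner_Integration.integral_cong) auto
  also have "\<dots> = (CLINT x|M. (if n = 0 then 0 else \<i> * A (n - 1)) * (cnj (\<psi> (n - 1) x) * u x) -
      (\<i> * A n) * (cnj (\<psi> (Suc n) x) * u x))"
    unfolding recurrence by (intro Bochner_Integration.integral_cong) (auto simp: algebra_simps)
  also have "\<dots> = (if n = 0 then 0 else \<i> * A (n - 1)) * coeffs u (n - 1) - (\<i> * A n) * coeffs u (Suc n)"
    unfolding coeffs_def inner_L2_def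
    using L2_prod[OF \<psi>_L2 u(1)]
    by (subst Bochner_Integration.integral_diff) auto
  finally show ?thesis by (auto simp: algebra_simps)
qed

text \<open>Nothing ensures in advance that \<open>x * u\<close> is in \<open>L2 M\<close>, so
  \<open>L2_complete\<close> cannot be applied to the difference. It is integrable against a small
  exponential, however, and \<open>AE_eq_0_if_orthogonal\<close> asks no more.\<close>

lemma mult_ident_if_coeffs:
  fixes u v :: "real \<Rightarrow> complex"
  assumes u: "u \<in> L2 M" and v: "v \<in> L2 M"
    and eq: "\<And>n. coeffs v n = \<i> * ((if n = 0 then 0 else A (n - 1) * coeffs u (n - 1)) - A n * coeffs u (Suc n))"
  shows "AE x in M. v x = x * u x"
proof -
  have [measurable]: "u \<in> borel_measurable M" "v \<in> borel_measurable M"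
    using u v by (auto dest: L2_measurable)
  \<comment> \<open>Conjugated, because \<open>AE_eq_0_if_orthogonal\<close> pairs \<open>h\<close>
    with \<open>\<psi> n\<close> itself whereas \<open>coeffs\<close> pairs with its
    conjugate.\<close>
  define h where "h x = cnj (v x) - x * cnj (u x)" for x
  have [measurable]: "h \<in> borel_measurable M" unfolding h_def by measurable
  \<comment> \<open>The exponent \<open>\<delta> / 2\<close> available for square-integrable
    functions is halved once more to pay for the factor \<open>x\<close>; \<open>wv\<close> takes
    the power 0 only to reach the same exponent.\<close>
  have wu: "integrable M (\<lambda>x. exp (\<delta> / 2 / 2 * \<bar>x\<bar>) * cmod (x ^ 1 * cnj (u x)))"
    using exp_weighted_integrable[OF u] \<delta> by (intro exp_weighted_integrable_power) auto
  have wv: "integrable M (\<lambda>x. exp (\<delta> / 2 / 2 * \<bar>x\<bar>) * cmod (x ^ 0 * cnj (v x)))"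
    using exp_weighted_integrable[OF v] \<delta> by (intro exp_weighted_integrable_power) auto
  have int: "integrable M (\<lambda>x. exp (\<delta> / 4 * \<bar>x\<bar>) * cmod (h x))"
  proof (rule Bochner_Integration.integrable_bound)
    show "integrable M (\<lambda>x. exp (\<delta> / 4 * \<bar>x\<bar>) * cmod (v x) + exp (\<delta> / 4 * \<bar>x\<bar>) * cmod (x * u x))"
      using wu wv by (simp add: norm_mult)
    have "exp (\<delta> / 4 * \<bar>x\<bar>) * cmod (h x) \<le> exp (\<delta> / 4 * \<bar>x\<bar>) * (cmod (v x) + cmod (x * u x))" for x
      unfolding h_def using norm_triangle_ineq4[of "cnj (v x)" "x * cnj (u x)"]
      by (intro mult_left_mono) (auto simp: norm_mult)
    then show "AE x in M. norm (exp (\<delta> / 4 * \<bar>x\<bar>) * cmod (h x)) \<le>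
        norm (exp (\<delta> / 4 * \<bar>x\<bar>) * cmod (v x) + exp (\<delta> / 4 * \<bar>x\<bar>) * cmod (x * u x))"
      by (auto simp: distrib_left)
  qed measurable
  have "(CLINT x|M. h x * \<psi> n x) = 0" for n
  proof -
    have "cnj (h x * \<psi> n x) = cnj (\<psi> n x) * v x - (cnj (x * \<psi> n x) * u x)" for x
      by (simp add: h_def algebra_simps)
    also have "\<dots> x = cnj (\<psi> n x) * v x - ((if n = 0 then 0 else \<i> * A (n - 1)) * (cnj (\<psi> (n - 1) x) * u x) -
      (\<i> * A n) * (cnj (\<psi> (Suc n) x) * u x))" for x
      unfolding recurrence by (auto simp: algebra_simps)
    finally have pt: "cnj (h x * \<psi> n x) = cnj (\<psi> n x) * v x - ((if n = 0 then 0 else \<i> * A (n - 1)) * (cnj (\<psi> (n - 1) x) * u x) -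
      (\<i> * A n) * (cnj (\<psi> (Suc n) x) * u x))" for x .
    have "(CLINT x|M. cnj (h x * \<psi> n x)) = coeffs v n - ((if n = 0 then 0 else \<i> * A (n - 1)) * coeffs u (n - 1) - (\<i> * A n) * coeffs u (Suc n))"
      unfolding pt coeffs_def inner_L2_def
      using L2_prod[OF \<psi>_L2 u(1)] L2_prod[OF \<psi>_L2 v]
      by (subst Bochner_Integration.integral_diff; simp)+
    also have "\<dots> = 0" unfolding eq by (auto simp: algebra_simps)
    finally have "cnj (CLINT x|M. h x * \<psi> n x) = 0"
      unfolding Bochner_Integration.integral_cnj .
    then show ?thesis by simp
  qed
  then have "AE x in M. h x = 0"
    using int \<delta> by (intro AE_eq_0_if_orthogonal[of "\<delta> / 4"]) auto
  then show ?thesis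
  proof eventually_elim
    fix x assume "h x = 0"
    then have "cnj (h x) = 0" by simp
    then show "v x = x * u x" by (simp add: h_def)
  qed
qed

end

subsection \<open>Operators equivalent to multiplication by the coordinate\<close>

text \<open>\<open>\<Phi>\<close> is a unitary map onto \<open>W\<close>, presented on functions:
  \<open>\<Phi>_norm\<close> makes it blind to null sets. Self-adjointness of \<open>A\<close> is an
  assumption because the Jacobi side supplies it, and \<open>open_interval_pos\<close> says that the
  support of \<open>M\<close> is the whole line.\<close>

locale multiplication_model = finite_measure M for M :: "real measure" +
  fixes W :: "vec set" and A :: oper and \<Phi> :: "(real \<Rightarrow> complex) \<Rightarrow> vec"
  assumes sets_M [measurable_cong, simp]: "sets M = sets borel"
    and open_interval_pos: "a < b \<Longrightarrow> measure M {a<..<b} > 0"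
    and W_closed: "W \<subseteq> ell2" "l2_closure W \<subseteq> W"
    and \<Phi>_in: "u \<in> L2 M \<Longrightarrow> \<Phi> u \<in> W"
    and \<Phi>_surj: "f \<in> W \<Longrightarrow> \<exists>u\<in>L2 M. \<Phi> u = f"
    and \<Phi>_add: "u \<in> L2 M \<Longrightarrow> v \<in> L2 M \<Longrightarrow> \<Phi> (\<lambda>x. u x + v x) = \<Phi> u + \<Phi> v"
    and \<Phi>_cmult: "u \<in> L2 M \<Longrightarrow> \<Phi> (\<lambda>x. c * u x) = cscale c (\<Phi> u)"
    and \<Phi>_norm: "u \<in> L2 M \<Longrightarrow> (l2norm (\<Phi> u))\<^sup>2 = (LINT x|M. (cmod (u x))\<^sup>2)"
    and A_eq: "A = {(\<Phi> u, \<Phi> (\<lambda>x. complex_of_real x * u x)) | u.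
      u \<in> L2 M \<and> (\<lambda>x. complex_of_real x * u x) \<in> L2 M}"
    and A_selfadjoint: "selfadjoint_in W A"
begin

lemma \<Phi>_ell2: "u \<in> L2 M \<Longrightarrow> \<Phi> u \<in> ell2"
  using \<Phi>_in W_closed by blast

lemma \<Phi>_diff:
  assumes "u \<in> L2 M" "v \<in> L2 M"
  shows "\<Phi> (\<lambda>x. u x - v x) = \<Phi> u - \<Phi> v"
  using \<Phi>_add[OF assms(1) L2_cmult[OF assms(2), of "-1"]] \<Phi>_cmult[OF assms(2), of "-1"]
  by (simp add: diff_conv_cscale)

lemma \<Phi>_eq_iff:
  assumes u: "u \<in> L2 M" and v: "v \<in> L2 M"
  shows "\<Phi> u = \<Phi> v \<longleftrightarrow> (AE x in M. u x = v x)"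
proof -
  have d: "(\<lambda>x. u x - v x) \<in> L2 M" using u v by (rule L2_diff)
  have "\<Phi> u = \<Phi> v \<longleftrightarrow> \<Phi> (\<lambda>x. u x - v x) = 0"
    by (simp add: \<Phi>_diff[OF u v])
  also have "\<dots> \<longleftrightarrow> (LINT x|M. (cmod (u x - v x))\<^sup>2) = 0"
    using l2norm_eq_0[OF \<Phi>_ell2[OF d]] \<Phi>_norm[OF d] by (metis zero_eq_power2)
  also have "\<dots> \<longleftrightarrow> (AE x in M. (cmod (u x - v x))\<^sup>2 = 0)"
    by (rule integral_nonneg_eq_0_iff_AE[OF L2D[OF d]]) auto
  finally show ?thesis by simp
qed

text \<open>Polarization: the norm of a sum determines the real part of the inner product, and
  replacing \<open>v\<close> by \<open>\<i> * v\<close> yields the imaginary part.\<close>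

lemma ip_\<Phi>:
  assumes u: "u \<in> L2 M" and v: "v \<in> L2 M"
  shows "ip (\<Phi> u) (\<Phi> v) = inner_L2 M u v"
proof -
  have Re: "Re (ip (\<Phi> u) (\<Phi> v)) = Re (inner_L2 M u v)"
    if u: "u \<in> L2 M" and v: "v \<in> L2 M" for u v
  proof -
    let ?s = "\<lambda>x. u x + v x"
    have s: "?s \<in> L2 M" using u v by (rule L2_add)
    note in_ell2 = \<Phi>_ell2[OF u] \<Phi>_ell2[OF v]
    have self: "ip (\<Phi> w) (\<Phi> w) = inner_L2 M w w" if "w \<in> L2 M" for w
      using ip_self[OF \<Phi>_ell2[OF that]] \<Phi>_norm[OF that] by (simp add: inner_L2_self)
    have left: "inner_L2 M ?s w = inner_L2 M u w + inner_L2 M v w" if "w \<in> L2 M" for w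
      using inner_L2_add[OF that u v] by (metis complex_cnj_add inner_L2_commute)
    have "ip (\<Phi> u) (\<Phi> u) + ip (\<Phi> u) (\<Phi> v) + (cnj (ip (\<Phi> u) (\<Phi> v)) + ip (\<Phi> v) (\<Phi> v)) = ip (\<Phi> ?s) (\<Phi> ?s)"
      unfolding \<Phi>_add[OF u v] using in_ell2
      by (simp add: ip_add_right ip_add_left ip_commute[of "\<Phi> u" "\<Phi> v"])
    also have "\<dots> = inner_L2 M u u + inner_L2 M u v + (cnj (inner_L2 M u v) + inner_L2 M v v)"
      unfolding self[OF s] left[OF s] inner_L2_add[OF u u v] inner_L2_add[OF v u v]
      by (simp add: inner_L2_commute[of M v u])
    finally have "ip (\<Phi> u) (\<Phi> v) + cnj (ip (\<Phi> u) (\<Phi> v)) = inner_L2 M u v + cnj (inner_L2 M u v)"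
      by (simp add: self[OF u] self[OF v])
    then show ?thesis by (simp add: complex_add_cnj)
  qed
  have iv: "(\<lambda>x. \<i> * v x) \<in> L2 M" using v by (rule L2_cmult)
  have "Re (\<i> * ip (\<Phi> u) (\<Phi> v)) = Re (\<i> * inner_L2 M u v)"
    using Re[OF u iv] \<Phi>_ell2[OF u] \<Phi>_ell2[OF v]
    by (simp only: \<Phi>_cmult[OF v] ip_cscale_right inner_L2_cmult)
  then show ?thesis using Re[OF u v] by (simp add: complex_eq_iff)
qed

lemma W_add:
  assumes "f \<in> W" "g \<in> W"
  shows "f + g \<in> W"
proof -
  obtain u v where u: "u \<in> L2 M" "\<Phi> u = f" and v: "v \<in> L2 M" "\<Phi> v = g"
    using assms[THEN \<Phi>_surj] by blast
  show ?thesis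
    using \<Phi>_in[OF L2_add[OF u(1) v(1)]] unfolding \<Phi>_add[OF u(1) v(1)] u(2) v(2) .
qed

lemma W_cscale:
  assumes "f \<in> W"
  shows "cscale c f \<in> W"
proof -
  obtain u where u: "u \<in> L2 M" "\<Phi> u = f"
    using \<Phi>_surj[OF assms] by blast
  show ?thesis
    using \<Phi>_in[OF L2_cmult[OF u(1)]] unfolding \<Phi>_cmult[OF u(1)] u(2) .
qed

section \<open>Resolvent and spectrum of multiplication by the coordinate\<close>

lemma L2_1: "(\<lambda>_. 1) \<in> L2 M"
  by (simp add: L2_def)

lemma L2_bounded_mult:
  assumes u: "u \<in> L2 M" and "b \<in> borel_measurable borel" "\<And>x. cmod (b x) \<le> C"
  shows "(\<lambda>x. b x * u x) \<in> L2 M"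
proof (rule L2_mono[OF L2_cmult[OF u, of "complex_of_real C"]])
  have [measurable]: "u \<in> borel_measurable M" using L2_measurable[OF u] .
  note [measurable] = assms(2)
  show "(\<lambda>x. b x * u x) \<in> borel_measurable M" by measurable
  fix x
  have "cmod (b x) \<le> \<bar>C\<bar>" using assms(3)[of x] by linarith
  then show "cmod (b x * u x) \<le> cmod (complex_of_real C * u x)"
    by (simp add: norm_mult mult_right_mono)
qed

text \<open>The inverse of \<open>A - z\<close> is multiplication by \<open>1 / (x - z)\<close>,
  bounded by \<open>1 / \<bar>Im z\<bar>\<close> on the real line.\<close>

lemma spectrum_nonreal:
  assumes z: "Im z \<noteq> 0"
  shows "z \<in> resolvent_set W A"
proof -
  define r where "r x = 1 / (complex_of_real x - z)" for x
  have nz: "complex_of_real x - z \<noteq> 0" for x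
    using z by (auto simp: complex_eq_iff)
  have im: "\<bar>Im z\<bar> \<le> cmod (complex_of_real x - z)" for x
    using abs_Im_le_cmod[of "complex_of_real x - z"] by simp
  have r: "r \<in> borel_measurable borel" "cmod (r x) \<le> 1 / \<bar>Im z\<bar>" for x
  proof -
    show "r \<in> borel_measurable borel" unfolding r_def by measurable
    show "cmod (r x) \<le> 1 / \<bar>Im z\<bar>"
      unfolding r_def norm_divide using im[of x] z by (intro frac_le) auto
  qed
  have "\<exists>!f. (f, h + cscale z f) \<in> A" if h: "h \<in> W" for h
  proof -
    obtain u where u: "u \<in> L2 M" "\<Phi> u = h" using \<Phi>_surj[OF h] by blast
    define v where "v x = r x * u x" for x
    have v: "v \<in> L2 M"
      unfolding v_def using u(1) r by (rule L2_bounded_mult)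
    have xv: "x * v x = u x + z * v x" for x
      using nz[of x] by (simp add: v_def r_def field_simps)
    have zv: "(\<lambda>x. z * v x) \<in> L2 M" using v by (rule L2_cmult)
    have "(\<lambda>x. x * v x) \<in> L2 M"
      unfolding xv using u(1) zv by (rule L2_add)
    moreover have "\<Phi> (\<lambda>x. x * v x) = h + cscale z (\<Phi> v)"
      unfolding xv \<Phi>_add[OF u(1) zv] \<Phi>_cmult[OF v] u(2) ..
    ultimately have ex: "(\<Phi> v, h + cscale z (\<Phi> v)) \<in> A"
      unfolding A_eq using v by force
    show ?thesis
    proof (intro ex1I[where a = "\<Phi> v"])
      show "(\<Phi> v, h + cscale z (\<Phi> v)) \<in> A" by (fact ex)
    next
      fix f assume "(f, h + cscale z f) \<in> A"
      then obtain w :: "real \<Rightarrow> complex" where w: "w \<in> L2 M" "(\<lambda>x. x * w x) \<in> L2 M"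
        "f = \<Phi> w" "h + cscale z f = \<Phi> (\<lambda>x. x * w x)"
        unfolding A_eq by auto
      have zw: "(\<lambda>x. z * w x) \<in> L2 M" using w(1) by (rule L2_cmult)
      have "\<Phi> (\<lambda>x. x * w x) = \<Phi> (\<lambda>x. u x + z * w x)"
        unfolding \<Phi>_add[OF u(1) zw] \<Phi>_cmult[OF w(1)] using w u by simp
      then have "AE x in M. x * w x = u x + z * w x"
        by (subst (asm) \<Phi>_eq_iff[OF w(2) L2_add[OF u(1) zw]])
      then have "AE x in M. w x = v x"
      proof eventually_elim
        fix x assume "x * w x = u x + z * w x"
        then have "(complex_of_real x - z) * w x = u x" by (simp add: algebra_simps)
        then show "w x = v x" using nz[of x] by (auto simp: v_def r_def field_simps)
      qed
      then show "f = \<Phi> v" using w(3) \<Phi>_eq_iff[OF w(1) v] by simp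
    qed
  qed
  moreover have "l2norm f \<le> (1 / \<bar>Im z\<bar>) * l2norm (g - cscale z f)" if fg: "(f, g) \<in> A" for f g
  proof -
    obtain u :: "real \<Rightarrow> complex" where u: "u \<in> L2 M" "(\<lambda>x. x * u x) \<in> L2 M"
      "f = \<Phi> u" "g = \<Phi> (\<lambda>x. x * u x)"
      using fg unfolding A_eq by auto
    have zu: "(\<lambda>x. z * u x) \<in> L2 M" using u(1) by (rule L2_cmult)
    have d: "(\<lambda>x. x * u x - z * u x) \<in> L2 M" using u(2) zu by (rule L2_diff)
    have gd: "g - cscale z f = \<Phi> (\<lambda>x. x * u x - z * u x)"
      unfolding u(3,4) \<Phi>_diff[OF u(2) zu] \<Phi>_cmult[OF u(1)] ..
    have pt: "(\<bar>Im z\<bar>)\<^sup>2 * (cmod (u x))\<^sup>2 \<le> (cmod (x * u x - z * u x))\<^sup>2" for x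
    proof -
      have "cmod (x * u x - z * u x) = cmod (complex_of_real x - z) * cmod (u x)"
        by (simp add: norm_mult flip: left_diff_distrib)
      then show ?thesis
        using im[of x] by (simp only: power_mult_distrib) (intro mult_right_mono power_mono, auto)
    qed
    have "(\<bar>Im z\<bar>)\<^sup>2 * (l2norm f)\<^sup>2 = (LINT x|M. (\<bar>Im z\<bar>)\<^sup>2 * (cmod (u x))\<^sup>2)"
      unfolding u(3) \<Phi>_norm[OF u(1)] by simp
    also have "\<dots> \<le> (LINT x|M. (cmod (x * u x - z * u x))\<^sup>2)"
      using L2D[OF u(1)] L2D[OF d] pt by (intro integral_mono) auto
    also have "\<dots> = (l2norm (g - cscale z f))\<^sup>2" unfolding gd \<Phi>_norm[OF d] ..
    finally have "(\<bar>Im z\<bar> * l2norm f)\<^sup>2 \<le> (l2norm (g - cscale z f))\<^sup>2"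
      by (simp add: power_mult_distrib)
    then have "\<bar>Im z\<bar> * l2norm f \<le> l2norm (g - cscale z f)"
      by (rule power2_le_imp_le) (simp add: gd \<Phi>_ell2[OF d])
    then show ?thesis using z by (simp add: field_simps)
  qed
  ultimately show ?thesis
    unfolding resolvent_set_def by blast
qed

text \<open>The indicator of a short interval around \<open>E\<close> is an approximate eigenvector:
  its norm is positive, and \<open>A - E\<close> shrinks it by the factor \<open>\<epsilon>\<close>.
  Being a statement about the graph alone, it also excludes a bounded inverse for every larger
  operator.\<close>

lemma no_bounded_inverse_real:
  fixes E :: real
  shows "\<not> (\<forall>(f, g)\<in>A. l2norm f \<le> C * l2norm (g - cscale (complex_of_real E) f))"
proof
  assume bound: "\<forall>(f, g)\<in>A. l2norm f \<le> C * l2norm (g - cscale (complex_of_real E) f)"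
  \<comment> \<open>Chosen so that \<open>\<bar>C\<bar> * \<epsilon> < 1\<close>; adding 1 keeps the
    denominator positive for every \<open>C\<close>.\<close>
  define \<epsilon> where "\<epsilon> = 1 / (\<bar>C\<bar> + 1)"
  have \<epsilon>: "\<epsilon> > 0" "\<bar>C\<bar> * \<epsilon> < 1" by (auto simp: \<epsilon>_def field_simps)
  let ?I = "{E - \<epsilon><..<E + \<epsilon>}"
  define u :: "real \<Rightarrow> complex" where "u x = indicator ?I x" for x
  have b: "u \<in> borel_measurable borel" "cmod (u x) \<le> 1" for x
    unfolding u_def by (auto split: split_indicator)
  have u: "u \<in> L2 M"
    using L2_bounded_mult[OF L2_1 b] by simp
  have xu: "(\<lambda>x. x * u x) \<in> L2 M"
  proof (rule L2_mono[OF L2_cmult[OF L2_1, of "complex_of_real (\<bar>E\<bar> + \<epsilon>)"]])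
    note [measurable] = b(1)
    show "(\<lambda>x. x * u x) \<in> borel_measurable M" by measurable
    have "cmod (x * u x) \<le> \<bar>E\<bar> + \<epsilon>" for x
      using \<epsilon> by (auto simp: u_def norm_mult split: split_indicator)
    then show "cmod (x * u x) \<le> cmod (complex_of_real (\<bar>E\<bar> + \<epsilon>) * 1)" for x
      unfolding mult_1_right norm_of_real using \<epsilon> by (metis abs_ge_self order_trans)
  qed
  have Eu: "(\<lambda>x. E * u x) \<in> L2 M" using u by (rule L2_cmult)
  have d: "(\<lambda>x. x * u x - E * u x) \<in> L2 M" using xu Eu by (rule L2_diff)
  have gd: "\<Phi> (\<lambda>x. x * u x) - cscale (complex_of_real E) (\<Phi> u) = \<Phi> (\<lambda>x. x * u x - E * u x)"
    unfolding \<Phi>_diff[OF xu Eu] \<Phi>_cmult[OF u] ..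
  have "(\<Phi> u, \<Phi> (\<lambda>x. x * u x)) \<in> A" unfolding A_eq using u xu by blast
  with bound have le: "l2norm (\<Phi> u) \<le> C * l2norm (\<Phi> (\<lambda>x. x * u x - E * u x))"
    by (auto simp: gd)
  have "(l2norm (\<Phi> u))\<^sup>2 = measure M ?I"
  proof -
    have "(cmod (u x))\<^sup>2 = indicator ?I x" for x by (simp add: u_def split: split_indicator)
    then show ?thesis by (simp add: \<Phi>_norm[OF u])
  qed
  then have pos: "l2norm (\<Phi> u) > 0"
    using open_interval_pos[of "E - \<epsilon>" "E + \<epsilon>"] \<epsilon> l2norm_nonneg[OF \<Phi>_ell2[OF u]]
    by (cases "l2norm (\<Phi> u) = 0") auto
  have "(l2norm (\<Phi> (\<lambda>x. x * u x - E * u x)))\<^sup>2 = (LINT x|M. (cmod (x * u x - E * u x))\<^sup>2)"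
    by (rule \<Phi>_norm[OF d])
  also have "\<dots> \<le> (LINT x|M. \<epsilon>\<^sup>2 * (cmod (u x))\<^sup>2)"
  proof (rule integral_mono)
    show "(cmod (x * u x - E * u x))\<^sup>2 \<le> \<epsilon>\<^sup>2 * (cmod (u x))\<^sup>2" for x
    proof -
      have "cmod (x * u x - E * u x) = \<bar>x - E\<bar> * cmod (u x)"
        by (simp add: norm_mult flip: left_diff_distrib of_real_diff)
      also have "\<dots> \<le> \<epsilon> * cmod (u x)"
        by (auto simp: u_def split: split_indicator)
      finally have "(cmod (x * u x - E * u x))\<^sup>2 \<le> (\<epsilon> * cmod (u x))\<^sup>2" by (intro power_mono) auto
      then show ?thesis by (simp add: power_mult_distrib)
    qed
  qed (use L2D[OF u] L2D[OF d] in auto)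
  also have "\<dots> = (\<epsilon> * l2norm (\<Phi> u))\<^sup>2" by (simp add: power_mult_distrib \<Phi>_norm[OF u])
  finally have d_le: "l2norm (\<Phi> (\<lambda>x. x * u x - E * u x)) \<le> \<epsilon> * l2norm (\<Phi> u)"
    by (rule power2_le_imp_le) (use \<epsilon> pos in auto)
  have "l2norm (\<Phi> u) \<le> \<bar>C\<bar> * l2norm (\<Phi> (\<lambda>x. x * u x - E * u x))"
    using le mult_right_mono[OF abs_ge_self[of C] l2norm_nonneg[OF \<Phi>_ell2[OF d]]] by linarith
  also have "\<dots> \<le> \<bar>C\<bar> * (\<epsilon> * l2norm (\<Phi> u))" using d_le by (intro mult_left_mono) auto
  also have "\<dots> < 1 * l2norm (\<Phi> u)"
    using mult_strict_right_mono[OF \<epsilon>(2) pos] by (simp add: mult.assoc)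
  finally show False by simp
qed

lemma spectrum_eq_Reals: "spectrum W A = \<real>"
proof -
  have "z \<in> resolvent_set W A \<longleftrightarrow> z \<notin> \<real>" for z
  proof
    assume z: "z \<in> resolvent_set W A"
    show "z \<notin> \<real>"
    proof
      assume "z \<in> \<real>"
      then obtain E where "z = complex_of_real E" by (auto elim: Reals_cases)
      then show False using z no_bounded_inverse_real[of _ E] unfolding resolvent_set_def by blast
    qed
  next
    assume "z \<notin> \<real>"
    then show "z \<in> resolvent_set W A" using spectrum_nonreal complex_is_Real_iff by blast
  qed
  then show ?thesis unfolding spectrum_def by auto
qed

section \<open>Spectral projections and the cyclic vector\<close>

definition \<Psi> :: "vec \<Rightarrow> real \<Rightarrow> complex" where
  "\<Psi> f = (SOME u. u \<in> L2 M \<and> \<Phi> u = f)"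

definition proj :: "real set \<Rightarrow> vec \<Rightarrow> vec" where
  "proj B f = \<Phi> (\<lambda>x. indicator B x * \<Psi> f x)"

lemma \<Psi>:
  assumes "f \<in> W" shows "\<Psi> f \<in> L2 M" "\<Phi> (\<Psi> f) = f"
proof -
  have "\<exists>u. u \<in> L2 M \<and> \<Phi> u = f" using \<Phi>_surj[OF assms] by blast
  then have "\<Psi> f \<in> L2 M \<and> \<Phi> (\<Psi> f) = f" unfolding \<Psi>_def by (rule someI_ex)
  then show "\<Psi> f \<in> L2 M" "\<Phi> (\<Psi> f) = f" by auto
qed

lemma indicator_mult:
  assumes "B \<in> sets borel" "u \<in> L2 M"
  shows "(\<lambda>x. indicator B x * u x) \<in> L2 M"
proof (rule L2_bounded_mult[OF assms(2), where C = 1])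
  show "(indicator B :: real \<Rightarrow> complex) \<in> borel_measurable borel"
    using assms(1) by simp
  show "cmod (indicator B x) \<le> 1" for x
    by (simp split: split_indicator)
qed

text \<open>Frees \<open>proj\<close> from the representative chosen by \<open>\<Psi>\<close>: any
  two differ on a null set only, and \<open>\<Phi>\<close> does not see it.\<close>

lemma proj_\<Phi>:
  assumes B: "B \<in> sets borel" and u: "u \<in> L2 M"
  shows "proj B (\<Phi> u) = \<Phi> (\<lambda>x. indicator B x * u x)"
proof -
  note \<Psi>' = \<Psi>[OF \<Phi>_in[OF u]]
  have "AE x in M. \<Psi> (\<Phi> u) x = u x"
    using \<Phi>_eq_iff[OF \<Psi>'(1) u] \<Psi>'(2) by simp
  then have "AE x in M. indicator B x * \<Psi> (\<Phi> u) x = indicator B x * u x" by auto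
  then show ?thesis
    unfolding proj_def by (subst \<Phi>_eq_iff) (auto intro!: indicator_mult B u \<Psi>')
qed

lemma orthogonal_projection_proj:
  assumes B: "B \<in> sets borel"
  shows "orthogonal_projection_in W (proj B)"
  unfolding orthogonal_projection_in_def
proof (intro conjI ballI allI)
  fix f assume "f \<in> W"
  then obtain u where u: "u \<in> L2 M" "f = \<Phi> u" using \<Phi>_surj by blast
  show "proj B f \<in> W" unfolding u(2) proj_\<Phi>[OF B u(1)] by (intro \<Phi>_in indicator_mult B u)
  show "proj B (proj B f) = proj B f"
    unfolding u(2) proj_\<Phi>[OF B u(1)] proj_\<Phi>[OF B indicator_mult[OF B u(1)]]
    by (simp flip: mult.assoc indicator_inter_arith)
  show "proj B (cscale z f) = cscale z (proj B f)" for z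
    unfolding u(2) proj_\<Phi>[OF B u(1)] \<Phi>_cmult[OF u(1), symmetric] proj_\<Phi>[OF B L2_cmult[OF u(1)]]
      \<Phi>_cmult[OF indicator_mult[OF B u(1)], symmetric] by (simp add: mult.left_commute)
  fix g assume "g \<in> W"
  then obtain v where v: "v \<in> L2 M" "g = \<Phi> v" using \<Phi>_surj by blast
  show "proj B (f + g) = proj B f + proj B g"
    unfolding u(2) v(2) \<Phi>_add[OF u(1) v(1), symmetric] proj_\<Phi>[OF B u(1)] proj_\<Phi>[OF B v(1)]
      proj_\<Phi>[OF B L2_add[OF u(1) v(1)]]
      \<Phi>_add[OF indicator_mult[OF B u(1)] indicator_mult[OF B v(1)], symmetric]
    by (simp add: distrib_left)
  show "ip (proj B f) g = ip f (proj B g)"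
    unfolding u(2) v(2) proj_\<Phi>[OF B u(1)] proj_\<Phi>[OF B v(1)]
      ip_\<Phi>[OF indicator_mult[OF B u(1)] v(1)] ip_\<Phi>[OF u(1) indicator_mult[OF B v(1)]]
    unfolding inner_L2_def by (intro Bochner_Integration.integral_cong) (auto split: split_indicator)
qed

lemma \<Phi>_sum:
  assumes "\<And>i. i \<in> I \<Longrightarrow> u i \<in> L2 M"
  shows "\<Phi> (\<lambda>x. \<Sum>i\<in>I. u i x) = (\<Sum>i\<in>I. \<Phi> (u i))"
  using assms
proof (induction I rule: infinite_finite_induct)
  case (insert i I)
  have "\<Phi> (\<lambda>x. \<Sum>j\<in>insert i I. u j x) = \<Phi> (\<lambda>x. u i x + (\<Sum>j\<in>I. u j x))"
    using insert(1,2) by simp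
  also have "\<dots> = \<Phi> (u i) + \<Phi> (\<lambda>x. \<Sum>j\<in>I. u j x)"
    using insert by (intro \<Phi>_add L2_sum) auto
  finally show ?case using insert by simp
qed (use \<Phi>_cmult[OF L2_1, of 0] in \<open>simp_all add: cscale_simps\<close>)

text \<open>Dominated convergence in mean square, carried over by \<open>\<Phi>_norm\<close>; it
  serves both countable additivity and the density of simple functions.\<close>

lemma \<Phi>_tendsto:
  assumes u: "\<And>k. u k \<in> L2 M" "v \<in> L2 M" and w: "w \<in> L2 M"
    and bound: "\<And>k x. cmod (u k x - v x) \<le> cmod (w x)" and lim: "\<And>x. (\<lambda>k. u k x) \<longlonglongrightarrow> v x"
  shows "(\<lambda>k. l2norm (\<Phi> (u k) - \<Phi> v)) \<longlonglongrightarrow> 0"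
proof -
  have d: "(\<lambda>x. u k x - v x) \<in> L2 M" for k using u by (rule L2_diff)
  have [measurable]: "u k \<in> borel_measurable M" "v \<in> borel_measurable M" for k
    using u L2_measurable by auto
  have "(\<lambda>k. LINT x|M. (cmod (u k x - v x))\<^sup>2) \<longlonglongrightarrow> (LINT x|M. 0)"
  proof (rule integral_dominated_convergence[OF _ _ L2D[OF w]])
    have "(\<lambda>k. cmod (u k x - v x)) \<longlonglongrightarrow> 0" for x
      using lim[of x] by (simp add: tendsto_norm_zero_iff LIM_zero_iff)
    then show "AE x in M. (\<lambda>k. (cmod (u k x - v x))\<^sup>2) \<longlonglongrightarrow> 0" by simp
    show "AE x in M. norm ((cmod (u k x - v x))\<^sup>2) \<le> (cmod (w x))\<^sup>2" for k
      using bound by (auto intro!: power_mono)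
  qed measurable
  then have "(\<lambda>k. (l2norm (\<Phi> (u k) - \<Phi> v))\<^sup>2) \<longlonglongrightarrow> 0"
    by (simp add: \<Phi>_norm[OF d] \<Phi>_diff[OF u, symmetric])
  then show ?thesis by simp
qed

lemma projection_valued_measure_proj: "projection_valued_measure W proj"
  unfolding projection_valued_measure_def
proof (intro conjI ballI allI impI)
  fix f assume "f \<in> W"
  then show "proj UNIV f = f" using \<Psi> by (simp add: proj_def)
next
  fix B :: "nat \<Rightarrow> real set" and f
  assume B: "range B \<subseteq> sets borel" "disjoint_family B" and "f \<in> W"
  then obtain u where u: "u \<in> L2 M" "f = \<Phi> u" using \<Phi>_surj by blast
  have [simp]: "B i \<in> sets borel" for i using B by auto
  have UB: "(\<Union>i. B i) \<in> sets borel" "(\<Union>i<k. B i) \<in> sets borel" for k by auto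
  have eq: "(\<Sum>i<k. proj (B i) f) = \<Phi> (\<lambda>x. indicator (\<Union>i<k. B i) x * u x)" for k
  proof -
    have "indicator (\<Union>i<k. B i) x = (\<Sum>i<k. indicator (B i) x :: complex)" for x
      using B(2) by (intro indicator_UN_disjoint) (auto simp: disjoint_family_on_def)
    then have "\<Phi> (\<lambda>x. indicator (\<Union>i<k. B i) x * u x) = \<Phi> (\<lambda>x. \<Sum>i<k. indicator (B i) x * u x)"
      by (simp add: sum_distrib_right)
    also have "\<dots> = (\<Sum>i<k. proj (B i) f)"
      unfolding u(2) using u(1) by (subst \<Phi>_sum) (auto simp: proj_\<Phi> indicator_mult)
    finally show ?thesis ..
  qed
  show "(\<lambda>k. l2norm ((\<Sum>i<k. proj (B i) f) - proj (\<Union>i. B i) f)) \<longlonglongrightarrow> 0"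
    unfolding eq unfolding u(2) proj_\<Phi>[OF UB(1) u(1)]
  proof (rule \<Phi>_tendsto[OF indicator_mult[OF UB(2) u(1)] indicator_mult[OF UB(1) u(1)] u(1)])
    show "cmod (indicator (\<Union>i<k. B i) x * u x - indicator (\<Union>i. B i) x * u x) \<le> cmod (u x)" for k x
      by (auto split: split_indicator)
    show "(\<lambda>k. indicator (\<Union>i<k. B i) x * u x) \<longlonglongrightarrow> indicator (\<Union>i. B i) x * u x" for x
      by (intro tendsto_mult_right LIMSEQ_indicator_UN)
  qed
qed (rule orthogonal_projection_proj)

text \<open>\<open>measure_of\<close> has the intended values only for a set function that is a
  measure; agreement with the density on all Borel sets secures this.\<close>

lemma scalar_measure_proj:
  assumes u: "u \<in> L2 M"
  shows "scalar_measure proj (\<Phi> u) = density M (\<lambda>x. ennreal ((cmod (u x))\<^sup>2))"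
proof -
  have [measurable]: "u \<in> borel_measurable M" using L2_measurable[OF u] .
  let ?D = "density M (\<lambda>x. ennreal ((cmod (u x))\<^sup>2))"
  have eq: "ennreal ((l2norm (proj B (\<Phi> u)))\<^sup>2) = emeasure ?D B" if "B \<in> sets borel" for B
  proof -
    note iu = indicator_mult[OF that u]
    have "ennreal ((l2norm (proj B (\<Phi> u)))\<^sup>2) = ennreal (LINT x|M. (cmod (indicator B x * u x))\<^sup>2)"
      unfolding proj_\<Phi>[OF that u] \<Phi>_norm[OF iu] ..
    also have "\<dots> = (\<integral>\<^sup>+x. ennreal ((cmod (indicator B x * u x))\<^sup>2) \<partial>M)"
      using L2D[OF iu] by (intro nn_integral_eq_integral[symmetric]) auto
    also have "\<dots> = (\<integral>\<^sup>+x. ennreal ((cmod (u x))\<^sup>2) * indicator B x \<partial>M)"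
      by (intro nn_integral_cong) (auto split: split_indicator)
    also have "\<dots> = emeasure ?D B"
      using that by (subst emeasure_density) auto
    finally show ?thesis .
  qed
  have "sigma_sets UNIV (sets borel) = sets (borel :: real measure)"
    using sets.sigma_sets_eq[of "borel :: real measure"] by simp
  then have "scalar_measure proj (\<Phi> u) = measure_of UNIV (sets borel) (emeasure ?D)"
    unfolding scalar_measure_def by (intro measure_of_eq) (auto simp: eq)
  also have "\<dots> = ?D"
    using measure_of_of_measure[of ?D] sets_eq_imp_space_eq[OF sets_M] by simp
  finally show ?thesis .
qed

text \<open>Against the density \<open>(cmod (u x))\<^sup>2\<close>, integrability of
  \<open>t\<^sup>2\<close> says exactly that \<open>x * u\<close> is square integrable, which is the
  domain in \<open>A_eq\<close>; the quadratic form is the first moment of the same density.\<close>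

lemma spectral_measure_proj: "spectral_measure_of W A proj"
  unfolding spectral_measure_of_def
proof (intro conjI)
  have int_iff: "integrable (scalar_measure proj (\<Phi> u)) (\<lambda>t. t\<^sup>2) \<longleftrightarrow> (\<lambda>x. x * u x) \<in> L2 M"
    if u: "u \<in> L2 M" for u :: "real \<Rightarrow> complex"
  proof -
    have [measurable]: "u \<in> borel_measurable M" using L2_measurable[OF u] .
    have "integrable (scalar_measure proj (\<Phi> u)) (\<lambda>t. t\<^sup>2) \<longleftrightarrow> integrable M (\<lambda>x. (cmod (u x))\<^sup>2 * x\<^sup>2)"
      unfolding scalar_measure_proj[OF u] by (subst integrable_real_density) auto
    also have "(\<lambda>x. (cmod (u x))\<^sup>2 * x\<^sup>2) = (\<lambda>x. (cmod (x * u x))\<^sup>2)"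
      by (auto simp: norm_mult power_mult_distrib)
    finally show ?thesis by (auto simp: L2_def)
  qed
  show "Domain A = {f \<in> W. integrable (scalar_measure proj f) (\<lambda>t. t\<^sup>2)}"
  proof (intro set_eqI iffI)
    fix f assume "f \<in> Domain A"
    then show "f \<in> {f \<in> W. integrable (scalar_measure proj f) (\<lambda>t. t\<^sup>2)}"
      unfolding A_eq by (auto simp: int_iff \<Phi>_in)
  next
    fix f assume "f \<in> {f \<in> W. integrable (scalar_measure proj f) (\<lambda>t. t\<^sup>2)}"
    then obtain u where "u \<in> L2 M" "\<Phi> u = f" "integrable (scalar_measure proj f) (\<lambda>t. t\<^sup>2)"
      using \<Phi>_surj by auto
    then show "f \<in> Domain A"
      unfolding A_eq using int_iff[of u] by blast
  qed
  show "\<forall>(f, g)\<in>A. ip f g = complex_of_real (LINT t|scalar_measure proj f. t)"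
  proof (clarify)
    fix f g assume "(f, g) \<in> A"
    then obtain u :: "real \<Rightarrow> complex" where u: "u \<in> L2 M" "(\<lambda>x. x * u x) \<in> L2 M"
      "f = \<Phi> u" "g = \<Phi> (\<lambda>x. x * u x)"
      unfolding A_eq by auto
    have [measurable]: "u \<in> borel_measurable M" using L2_measurable[OF u(1)] .
    have "ip f g = (CLINT x|M. complex_of_real ((cmod (u x))\<^sup>2 * x))"
      unfolding u(3,4) ip_\<Phi>[OF u(1,2)] inner_L2_def
      by (intro Bochner_Integration.integral_cong) (auto simp: complex_norm_square mult_ac simp del: of_real_power)
    then have 1: "ip f g = complex_of_real (LINT x|M. (cmod (u x))\<^sup>2 * x)"
      unfolding integral_complex_of_real .
    have 2: "(LINT t|scalar_measure proj f. t) = (LINT x|M. (cmod (u x))\<^sup>2 * x)"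
      unfolding u(3) scalar_measure_proj[OF u(1)] by (rule integral_real_density) auto
    show "ip f g = complex_of_real (LINT t|scalar_measure proj f. t)"
      unfolding 1 2 ..
  qed
  show "selfadjoint_in W A" by (fact A_selfadjoint)
  show "projection_valued_measure W proj" by (fact projection_valued_measure_proj)
qed

text \<open>The projections of the constant 1 are the images of indicators, so their span contains
  the images of all simple functions, and these are dense.\<close>

lemma closed_span_proj_1: "closed_span {proj B (\<Phi> (\<lambda>_. 1)) | B. B \<in> sets borel} = W"
proof (rule equalityI)
  let ?S = "{proj B (\<Phi> (\<lambda>_. 1)) | B. B \<in> sets borel}"
  have proj_1: "proj B (\<Phi> (\<lambda>_. 1)) = \<Phi> (indicator B)" if "B \<in> sets borel" for B
    using proj_\<Phi>[OF that L2_1] by simp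
  have ind: "indicator B \<in> L2 M" if "B \<in> sets borel" for B
    using indicator_mult[OF that L2_1] by simp
  have "(\<Sum>v\<in>F. cscale (c v) v) \<in> W" if "finite F" "F \<subseteq> ?S" for F c
    using that
  proof (induction F rule: finite_induct)
    case empty
    show ?case
      using W_cscale[OF \<Phi>_in[OF L2_1], of 0] unfolding sum.empty cscale_simps .
  next
    case (insert v F)
    then have "v \<in> W" using proj_1 ind \<Phi>_in by auto
    then have "cscale (c v) v + (\<Sum>v\<in>F. cscale (c v) v) \<in> W"
      using insert by (intro W_add W_cscale) auto
    moreover have "(\<Sum>v\<in>insert v F. cscale (c v) v) = cscale (c v) v + (\<Sum>v\<in>F. cscale (c v) v)"
      using insert by (intro sum.insert)
    ultimately show ?case by metis
  qed
  then have "lin_span ?S \<subseteq> W" by (auto simp: lin_span_def)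
  then have "closed_span ?S \<subseteq> l2_closure W" unfolding closed_span_def l2_closure_def by blast
  then show "closed_span ?S \<subseteq> W" using W_closed(2) by blast
  show "W \<subseteq> closed_span ?S"
  proof
    fix f assume f: "f \<in> W"
    then obtain u where u: "u \<in> L2 M" "f = \<Phi> u" using \<Phi>_surj by blast
    obtain s where s: "\<And>i. simple_function M (s i)" "\<And>x. x \<in> space M \<Longrightarrow> (\<lambda>i. s i x) \<longlonglongrightarrow> u x"
      "\<And>i x. x \<in> space M \<Longrightarrow> dist (s i x) 0 \<le> 2 * dist (u x) 0"
      using borel_measurable_implies_sequence_metric[OF L2_measurable[OF u(1)], of 0] by blast
    have space: "space M = UNIV" using sets_eq_imp_space_eq[OF sets_M] by simp
    have s_sq: "s i \<in> L2 M" for i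
    proof (rule L2_mono[OF L2_cmult[OF u(1), of 2]])
      show "s i \<in> borel_measurable M" using s(1) by (rule borel_measurable_simple_function)
      show "cmod (s i x) \<le> cmod (2 * u x)" for x
        using s(3)[of x i] by (simp add: space norm_mult)
    qed
    \<comment> \<open>The approximants satisfy \<open>\<bar>s\<bar> \<le> 2 * \<bar>u\<bar>\<close>,
      so the error is dominated by \<open>3 * \<bar>u\<bar>\<close>.\<close>
    have "(\<lambda>i. l2norm (\<Phi> (s i) - \<Phi> u)) \<longlonglongrightarrow> 0"
    proof (rule \<Phi>_tendsto[OF s_sq u(1) L2_cmult[OF u(1), of 3]])
      show "cmod (s i x - u x) \<le> cmod (3 * u x)" for i x
        using s(3)[of x i] norm_triangle_ineq4[of "s i x" "u x"] by (simp add: space norm_mult)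
      show "(\<lambda>i. s i x) \<longlonglongrightarrow> u x" for x using s(2) by (simp add: space)
    qed
    moreover have "\<Phi> (s i) \<in> lin_span ?S" for i
    proof -
      have fin: "finite (range (s i))" and B: "s i -` {y} \<in> sets borel" for y
      proof -
        show "finite (range (s i))" using simple_functionD(1)[OF s(1), of i] by (simp add: space)
        show "s i -` {y} \<in> sets borel" using simple_functionD(2)[OF s(1), of i "{y}"] by (simp add: space)
      qed
      have "s i = (\<lambda>x. \<Sum>y\<in>range (s i). y * indicator (s i -` {y}) x)"
      proof
        fix x
        have "(\<Sum>y\<in>range (s i). y * indicator (s i -` {y}) x) = (\<Sum>y\<in>range (s i). if s i x = y then y else 0)"
          by (intro sum.cong) (auto split: split_indicator)
        then show "s i x = (\<Sum>y\<in>range (s i). y * indicator (s i -` {y}) x)" using fin by simp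
      qed
      then have "\<Phi> (s i) = \<Phi> (\<lambda>x. \<Sum>y\<in>range (s i). y * indicator (s i -` {y}) x)" by simp
      also have "\<dots> = (\<Sum>y\<in>range (s i). \<Phi> (\<lambda>x. y * indicator (s i -` {y}) x))"
        using ind[OF B] by (intro \<Phi>_sum L2_cmult)
      also have "\<dots> = (\<Sum>y\<in>range (s i). cscale y (proj (s i -` {y}) (\<Phi> (\<lambda>_. 1))))"
        by (intro sum.cong refl) (simp add: proj_1[OF B] \<Phi>_cmult[OF ind[OF B]])
      also have "\<dots> \<in> lin_span ?S"
        using B by (intro lin_span_sum lin_span_base) blast
      finally show ?thesis .
    qed
    ultimately show "f \<in> closed_span ?S"
      unfolding closed_span_def l2_closure_def using f W_closed(1) u(2)
      by (auto intro!: exI[of _ "\<lambda>i. \<Phi> (s i)"])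
  qed
qed

lemma simple_spectrum: "simple_spectrum W A"
  unfolding simple_spectrum_def
proof (intro conjI exI bexI)
  show "selfadjoint_in W A" by (fact A_selfadjoint)
  show "spectral_measure_of W A proj" by (fact spectral_measure_proj)
  show "closed_span {proj M (\<Phi> (\<lambda>_. 1)) | M. M \<in> sets borel} = W" by (fact closed_span_proj_1)
  show "\<Phi> (\<lambda>_. 1) \<in> W" by (intro \<Phi>_in L2_1)
qed

end

subsection \<open>Decay of the Gamma function and contour shift\<close>

text \<open>Dividing by \<open>u * v\<close>: a larger real part lowers the relative weight of the
  imaginary part. This is the single-factor case of the comparison of Pochhammer products.\<close>

lemma mult_norm_add_imaginary_mono:
  fixes u v y :: real
  assumes "0 < u" "u \<le> v"
  shows "u * cmod (v + \<i> * y) \<le> v * cmod (u + \<i> * y)"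
proof (rule power2_le_imp_le)
  have "u\<^sup>2 * y\<^sup>2 \<le> v\<^sup>2 * y\<^sup>2"
    using assms by (intro mult_right_mono power_mono) auto
  then show "(u * cmod (v + \<i> * y))\<^sup>2 \<le> (v * cmod (u + \<i> * y))\<^sup>2"
    by (simp add: power_mult_distrib cmod_power2 algebra_simps)
qed (use assms in auto)

lemma pochhammer_norm_mono:
  fixes u v y :: real
  assumes "0 < u" "u \<le> v"
  shows "pochhammer u n * cmod (pochhammer (v + \<i> * y) n) \<le> pochhammer v n * cmod (pochhammer (u + \<i> * y) n)"
proof (induction n)
  case (Suc n)
  have shift: "complex_of_real x + \<i> * y + of_nat n = complex_of_real (x + real n) + \<i> * y" for x
    by simp
  have "(pochhammer u n * cmod (pochhammer (v + \<i> * y) n)) * ((u + n) * cmod (complex_of_real (v + real n) + \<i> * y)) \<le>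
      (pochhammer v n * cmod (pochhammer (u + \<i> * y) n)) * ((v + n) * cmod (complex_of_real (u + real n) + \<i> * y))"
    using assms pochhammer_pos[of u n] pochhammer_pos[of v n]
    by (intro mult_mono Suc mult_norm_add_imaginary_mono) auto
  then show ?case
    unfolding pochhammer_Suc shift norm_mult by (simp only: mult_ac)
qed auto

text \<open>Termwise comparison in Euler's limit formula.\<close>

lemma norm_Gamma_mono:
  fixes u v y :: real
  assumes "0 < u" "u \<le> v"
  shows "cmod (Gamma (u + \<i> * y)) * Gamma v \<le> Gamma u * cmod (Gamma (v + \<i> * y))"
proof (rule LIMSEQ_le)
  show "(\<lambda>n. cmod (Gamma_series (u + \<i> * y) n) * Gamma_series v n) \<longlonglongrightarrow> cmod (Gamma (u + \<i> * y)) * Gamma v"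
    "(\<lambda>n. Gamma_series u n * cmod (Gamma_series (v + \<i> * y) n)) \<longlonglongrightarrow> Gamma u * cmod (Gamma (v + \<i> * y))"
    by (intro tendsto_intros)+
  have norm: "cmod (Gamma_series (x + \<i> * y) n) = fact n * exp (x * ln (real n)) / cmod (pochhammer (x + \<i> * y) (n + 1))"
    for x :: real and n
    by (simp add: Gamma_series_def norm_mult norm_divide del: pochhammer_Suc)
  have nz: "pochhammer (x + \<i> * y) n \<noteq> 0" if "x > 0" for x :: real and n
  proof
    assume "pochhammer (x + \<i> * y) n = 0"
    then obtain k where "x + \<i> * y = - of_nat k" by (auto simp: pochhammer_eq_0_iff)
    then have "Re (x + \<i> * y) = Re (- of_nat k)" by (rule arg_cong)
    then show False using that by simp
  qed
  have "cmod (Gamma_series (u + \<i> * y) n) * Gamma_series v n \<le> Gamma_series u n * cmod (Gamma_series (v + \<i> * y) n)" for n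
  proof -
    \<comment> \<open>The numerators of the two Euler products agree on both sides of the
      inequality, so only the Pochhammer denominators have to be compared.\<close>
    let ?c = "fact n * exp (u * ln (real n)) * (fact n * exp (v * ln (real n)))"
    let ?p = "\<lambda>x. pochhammer x (n + 1)" and ?q = "\<lambda>x. cmod (pochhammer (complex_of_real x + \<i> * y) (n + 1))"
    have pos: "?p u > 0" "?p v > 0" "?q u > 0" "?q v > 0"
      using assms pochhammer_pos[of u "n + 1"] pochhammer_pos[of v "n + 1"] nz[of u "n + 1"] nz[of v "n + 1"] by auto
    have "?c / (?q u * ?p v) \<le> ?c / (?p u * ?q v)"
      using pochhammer_norm_mono[OF assms, of "n + 1" y] pos
      by (intro divide_left_mono mult_nonneg_nonneg mult_pos_pos) (auto simp: mult.commute)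
    then show ?thesis
      unfolding norm Gamma_series_def[of u] Gamma_series_def[of v] by (simp add: mult_ac)
  qed
  then show "\<exists>N. \<forall>n\<ge>N. cmod (Gamma_series (u + \<i> * y) n) * Gamma_series v n \<le> Gamma_series u n * cmod (Gamma_series (v + \<i> * y) n)"
    by blast
qed

text \<open>On Re z = 1/2 conjugation is \<open>z \<mapsto> 1 - z\<close>, so the reflection formula
  evaluates the squared modulus exactly, as \<open>pi / cosh (pi * y)\<close>.\<close>

lemma norm_Gamma_half_line: "(cmod (Gamma (1 / 2 + \<i> * y)))\<^sup>2 \<le> 2 * pi * exp (- pi * \<bar>y\<bar>)" for y :: real
proof -
  let ?z = "1 / 2 + \<i> * y"
  have "cnj ?z = 1 - ?z" by (simp add: complex_eq_iff)
  then have "complex_of_real ((cmod (Gamma ?z))\<^sup>2) = Gamma ?z * Gamma (1 - ?z)"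
    by (simp only: complex_norm_square cnj_Gamma)
  also have "\<dots> = of_real pi / sin (of_real pi * ?z)" by (rule Gamma_reflection_complex)
  also have "sin (of_real pi * ?z) = of_real (cosh (pi * y))"
  proof -
    have "of_real pi * ?z = \<i> * of_real (pi * y) + of_real pi / 2"
      by (simp add: algebra_simps)
    then have "sin (of_real pi * ?z) = cos (\<i> * of_real (pi * y))"
      by (simp add: sin_add)
    also have "\<dots> = (exp (- of_real (pi * y)) + exp (of_real (pi * y))) / 2"
      unfolding cos_exp_eq by (simp add: mult.assoc[symmetric])
    also have "\<dots> = of_real (cosh (pi * y))"
    proof -
      have "(exp (- complex_of_real t) + exp (of_real t)) / 2 = of_real (cosh t)" for t
        by (simp add: cosh_field_def flip: exp_of_real)
      then show ?thesis .
    qed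
    finally show ?thesis .
  qed
  also have "complex_of_real pi / of_real (cosh (pi * y)) = of_real (pi / cosh (pi * y))" by simp
  finally have "(cmod (Gamma ?z))\<^sup>2 = pi / cosh (pi * y)" unfolding of_real_eq_iff .
  also have "\<dots> \<le> pi / (exp (pi * \<bar>y\<bar>) / 2)"
  proof (intro divide_left_mono)
    have "exp (pi * \<bar>y\<bar>) / 2 \<le> cosh (pi * \<bar>y\<bar>)" by (simp add: cosh_field_def)
    then show "exp (pi * \<bar>y\<bar>) / 2 \<le> cosh (pi * y)" by (cases "y \<ge> 0") auto
  qed auto
  also have "\<dots> = 2 * pi * exp (- pi * \<bar>y\<bar>)" by (simp add: exp_minus field_simps)
  finally show ?thesis .
qed

lemma Gamma_plus1_Re_pos: "Re z > 0 \<Longrightarrow> Gamma (z + 1) = z * Gamma z" for z :: complex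
  by (rule Gamma_plus1) (auto elim!: nonpos_Ints_cases)

text \<open>The functional equation passes from one line to the next, each step costing a factor
  linear in \<open>\<bar>y\<bar>\<close>.\<close>

lemma norm_Gamma_half_integer_line:
  "\<exists>C\<ge>0. \<forall>y. cmod (Gamma (of_real (real N + 1 / 2) + \<i> * of_real y)) \<le> C * (1 + \<bar>y\<bar>) ^ N * exp (- (pi / 2) * \<bar>y\<bar>)"
proof (induction N)
  case 0
  have "cmod (Gamma (1 / 2 + \<i> * y)) \<le> sqrt (2 * pi) * exp (- (pi / 2) * \<bar>y\<bar>)" for y :: real
  proof (rule power2_le_imp_le)
    have "(sqrt (2 * pi) * exp (- (pi / 2) * \<bar>y\<bar>))\<^sup>2 = 2 * pi * exp (- pi * \<bar>y\<bar>)"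
      by (simp add: power_mult_distrib flip: exp_double)
    then show "(cmod (Gamma (1 / 2 + \<i> * y)))\<^sup>2 \<le> (sqrt (2 * pi) * exp (- (pi / 2) * \<bar>y\<bar>))\<^sup>2"
      using norm_Gamma_half_line[of y] by simp
  qed auto
  then show ?case by (intro exI[of _ "sqrt (2 * pi)"]) auto
next
  case (Suc N)
  then obtain C where C: "C \<ge> 0"
    "\<And>y. cmod (Gamma (of_real (real N + 1 / 2) + \<i> * of_real y)) \<le> C * (1 + \<bar>y\<bar>) ^ N * exp (- (pi / 2) * \<bar>y\<bar>)" by blast
  have "cmod (Gamma (of_real (real (Suc N) + 1 / 2) + \<i> * of_real y)) \<le>
      ((real N + 1) * C) * (1 + \<bar>y\<bar>) ^ Suc N * exp (- (pi / 2) * \<bar>y\<bar>)" for y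
  proof -
    let ?z = "complex_of_real (real N + 1 / 2) + \<i> * of_real y"
    have "cmod ?z \<le> \<bar>Re ?z\<bar> + \<bar>Im ?z\<bar>" by (rule cmod_le)
    also have "\<dots> \<le> (real N + 1) * (1 + \<bar>y\<bar>)" by (simp add: algebra_simps)
    finally have z: "cmod ?z \<le> (real N + 1) * (1 + \<bar>y\<bar>)" .
    have shift: "of_real (real (Suc N) + 1 / 2) + \<i> * of_real y = ?z + 1" by simp
    have "Re ?z > 0" by simp
    then have "cmod (Gamma (of_real (real (Suc N) + 1 / 2) + \<i> * of_real y)) = cmod ?z * cmod (Gamma ?z)"
      unfolding shift by (simp only: Gamma_plus1_Re_pos norm_mult)
    also have "\<dots> \<le> ((real N + 1) * (1 + \<bar>y\<bar>)) * (C * (1 + \<bar>y\<bar>) ^ N * exp (- (pi / 2) * \<bar>y\<bar>))"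
      by (intro mult_mono z C) auto
    finally show ?thesis by (simp add: mult_ac)
  qed
  then show ?case using C(1) by (intro exI[of _ "(real N + 1) * C"]) auto
qed

lemma power_1_plus_abs_le: "(1 + \<bar>y\<bar>) ^ N \<le> 4 ^ N * fact N * exp (1 / 4) * exp (\<bar>y\<bar> / 4)" for y :: real
proof -
  have "((1 + \<bar>y\<bar>) / 4) ^ N / fact N \<le> exp ((1 + \<bar>y\<bar>) / 4)"
    by (rule power_div_fact_le_exp) auto
  also have "\<dots> = exp (1 / 4) * exp (\<bar>y\<bar> / 4)" by (simp add: add_divide_distrib exp_add)
  finally show ?thesis by (simp add: power_divide field_simps)
qed

text \<open>\<open>norm_Gamma_mono\<close> compares each point of the strip with the point of equal
  height on a half-integer line to its right; Gamma is bounded on the compact real interval. The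
  rate 1/2 is deliberately weaker than \<open>pi / 2\<close>: the slack absorbs the polynomial
  factor.\<close>

lemma norm_Gamma_strip_decay:
  assumes "0 < x0"
  shows "\<exists>C\<ge>0. \<forall>x y. x0 \<le> x \<longrightarrow> x \<le> x1 \<longrightarrow> cmod (Gamma (of_real x + \<i> * of_real y)) \<le> C * exp (- (\<bar>y\<bar> / 2))"
proof -
  obtain N where N: "x1 \<le> real N" using real_arch_simple by blast
  define X where "X = real N + 1 / 2"
  have X: "x1 \<le> X" "X > 0" using N by (auto simp: X_def)
  obtain C where C: "C \<ge> 0"
    "\<And>y. cmod (Gamma (of_real X + \<i> * of_real y)) \<le> C * (1 + \<bar>y\<bar>) ^ N * exp (- (pi / 2) * \<bar>y\<bar>)"
    using norm_Gamma_half_integer_line[of N] unfolding X_def by blast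
  define D where "D = C * (4 ^ N * fact N * exp (1 / 4))"
  have D: "cmod (Gamma (of_real X + \<i> * of_real y)) \<le> D * exp (- (\<bar>y\<bar> / 2))" for y
  proof -
    have "C * (1 + \<bar>y\<bar>) ^ N * exp (- (pi / 2) * \<bar>y\<bar>) \<le>
        C * (4 ^ N * fact N * exp (1 / 4) * exp (\<bar>y\<bar> / 4)) * exp (- (pi / 2) * \<bar>y\<bar>)"
      using C(1) by (intro mult_right_mono mult_left_mono power_1_plus_abs_le) auto
    also have "\<dots> = D * exp (\<bar>y\<bar> / 4 - (pi / 2) * \<bar>y\<bar>)"
      using exp_add[of "\<bar>y\<bar> / 4" "- (pi / 2) * \<bar>y\<bar>"] by (simp add: D_def mult_ac)
    also have "\<dots> \<le> D * exp (- (\<bar>y\<bar> / 2))"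
    proof -
      have "1 * \<bar>y\<bar> \<le> (pi / 2) * \<bar>y\<bar>" using pi_ge_two by (intro mult_right_mono) auto
      then show ?thesis using C(1) by (intro mult_left_mono) (auto simp: D_def)
    qed
    finally show ?thesis using C(2)[of y] by linarith
  qed
  have "continuous_on {x0..x1} (Gamma :: real \<Rightarrow> real)"
    using assms by (intro continuous_on_Gamma) (auto elim!: nonpos_Ints_cases)
  then have "bounded (Gamma ` {x0..x1})"
    by (intro compact_imp_bounded compact_continuous_image) auto
  then obtain B where "\<forall>x\<in>{x0..x1}. \<bar>Gamma x\<bar> \<le> B"
    unfolding bounded_iff by auto
  then have B: "\<bar>Gamma x\<bar> \<le> B" if "x0 \<le> x" "x \<le> x1" for x
    using that by auto
  have "cmod (Gamma (of_real x + \<i> * of_real y)) \<le> (\<bar>B\<bar> * D / Gamma X) * exp (- (\<bar>y\<bar> / 2))"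
    if x: "x0 \<le> x" "x \<le> x1" for x y
  proof -
    have "cmod (Gamma (of_real x + \<i> * of_real y)) * Gamma X \<le> Gamma x * cmod (Gamma (of_real X + \<i> * of_real y))"
      using x X assms by (intro norm_Gamma_mono) auto
    also have "\<dots> \<le> \<bar>B\<bar> * (D * exp (- (\<bar>y\<bar> / 2)))"
      using B[OF x] D[of y] by (intro mult_mono) auto
    finally show ?thesis using Gamma_real_pos[OF X(2)] by (simp add: field_simps)
  qed
  moreover have "\<bar>B\<bar> * D / Gamma X \<ge> 0"
    using C(1) Gamma_real_pos[OF X(2)] by (auto simp: D_def intro!: divide_nonneg_pos mult_nonneg_nonneg)
  ultimately show ?thesis by blast
qed

section \<open>Exponentially decaying integrands and shifts of vertical lines\<close>

lemma integrable_exp_neg_abs: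
  fixes c :: real
  assumes "c > 0"
  shows "integrable lborel (\<lambda>x. exp (- (c * \<bar>x\<bar>)))"
proof (rule Bochner_Integration.integrable_bound)
  have "einterval (-\<infinity>) \<infinity> = UNIV" by (auto simp: einterval_def)
  then have "integrable lborel (\<lambda>x::real. inverse (1 + x\<^sup>2))"
    using integrable_inverse_1_plus_square by (simp add: set_integrable_def)
  then show "integrable lborel (\<lambda>x::real. (1 + 2 / c\<^sup>2) * inverse (1 + x\<^sup>2))" by simp
  have "exp (- (c * \<bar>x\<bar>)) \<le> (1 + 2 / c\<^sup>2) * inverse (1 + x\<^sup>2)" for x
  proof -
    have "(c * \<bar>x\<bar>)\<^sup>2 / fact 2 \<le> exp (c * \<bar>x\<bar>)"
      using assms by (intro power_div_fact_le_exp) auto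
    then have "x\<^sup>2 \<le> 2 / c\<^sup>2 * exp (c * \<bar>x\<bar>)"
      using assms by (simp add: power_mult_distrib field_simps)
    moreover have "1 \<le> exp (c * \<bar>x\<bar>)" using assms by simp
    ultimately have "1 + x\<^sup>2 \<le> (1 + 2 / c\<^sup>2) * exp (c * \<bar>x\<bar>)"
      unfolding distrib_right by linarith
    moreover have "1 + x\<^sup>2 > 0" by (simp add: add_pos_nonneg)
    ultimately show ?thesis by (simp add: exp_minus divide_simps mult.commute)
  qed
  then show "AE x in lborel. norm (exp (- (c * \<bar>x\<bar>))) \<le> norm ((1 + 2 / c\<^sup>2) * inverse (1 + x\<^sup>2))"
    by (auto intro!: order_trans[OF _ abs_ge_self])
qed measurable

lemma integrable_if_exp_decay:
  fixes f :: "real \<Rightarrow> 'a :: {banach, second_countable_topology}"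
  assumes "c > 0" "f \<in> borel_measurable borel" "\<And>x. norm (f x) \<le> C * exp (- (c * \<bar>x\<bar>))"
  shows "integrable lborel f"
proof (rule Bochner_Integration.integrable_bound)
  show "integrable lborel (\<lambda>x. C * exp (- (c * \<bar>x\<bar>)))"
    using integrable_exp_neg_abs[OF assms(1)] by simp
qed (use assms in \<open>auto intro!: order_trans[OF assms(3) abs_ge_self]\<close>)

text \<open>Shifting a vertical line of integration: the difference of a primitive on the two lines vanishes
  at both ends.\<close>

lemma integral_vertical_line_shift:
  fixes F :: "complex \<Rightarrow> complex"
  assumes F: "F holomorphic_on {z. l < Re z \<and> Re z < r}"
    and b: "l < b0" "b0 \<le> b1" "b1 < r" and c: "c > 0"
    and decay: "\<And>x y. b0 \<le> x \<Longrightarrow> x \<le> b1 \<Longrightarrow> cmod (F (of_real x + \<i> * of_real y)) \<le> C * exp (- (c * \<bar>y\<bar>))"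
  shows "b0 \<le> x \<Longrightarrow> x \<le> b1 \<Longrightarrow> integrable lborel (\<lambda>y. F (of_real x + \<i> * of_real y))"
    and "(CLINT y|lborel. F (of_real b1 + \<i> * of_real y)) = (CLINT y|lborel. F (of_real b0 + \<i> * of_real y))"
proof -
  let ?S = "{z. l < Re z \<and> Re z < r}"
  have S: "open ?S" "convex ?S"
    using open_halfspace_Re_gt[of l] open_halfspace_Re_lt[of r] convex_halfspace_Re_gt[of l] convex_halfspace_Re_lt[of r]
    by (simp_all add: Collect_conj_eq open_Int convex_Int)
  have cont: "continuous_on UNIV (\<lambda>y. F (of_real x + \<i> * of_real y))" if "l < x" "x < r" for x
    using that
    by (intro continuous_on_compose2[OF holomorphic_on_imp_continuous_on[OF F]] continuous_intros) auto
  have int: "integrable lborel (\<lambda>y. F (of_real x + \<i> * of_real y))" if "b0 \<le> x" "x \<le> b1" for x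
    using that b decay[OF that] by (intro integrable_if_exp_decay[OF c] borel_measurable_continuous_onI cont) auto
  then show "b0 \<le> x \<Longrightarrow> x \<le> b1 \<Longrightarrow> integrable lborel (\<lambda>y. F (of_real x + \<i> * of_real y))" .
  obtain P where P: "\<And>z. z \<in> ?S \<Longrightarrow> (P has_field_derivative F z) (at z within ?S)"
    using holomorphic_convex_primitive'[OF S(2,1) F] by blast
  have P_at: "(P has_field_derivative F z) (at z)" if "z \<in> ?S" for z
    using P[OF that] at_within_open[OF that S(1)] by simp
  define D where "D y = P (of_real b1 + \<i> * of_real y) - P (of_real b0 + \<i> * of_real y)" for y
  define d where "d y = \<i> * F (of_real b1 + \<i> * of_real y) - \<i> * F (of_real b0 + \<i> * of_real y)" for y
  have line: "((\<lambda>y. P (of_real x + \<i> * of_real y)) has_vector_derivative \<i> * F (of_real x + \<i> * of_real y)) (at y)"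
    if "l < x" "x < r" for x y
  proof -
    have "((\<lambda>y. of_real x + \<i> * of_real y) has_vector_derivative \<i>) (at y)"
      by (auto intro!: derivative_eq_intros)
    moreover have "(P has_field_derivative F (of_real x + \<i> * of_real y)) (at (of_real x + \<i> * of_real y))"
      using that by (intro P_at) auto
    ultimately show ?thesis
      using field_vector_diff_chain_at[of "\<lambda>y. of_real x + \<i> * of_real y" \<i> y P] by (simp add: o_def)
  qed
  have D_deriv: "(D has_vector_derivative d y) (at y)" for y
    unfolding D_def d_def using b by (intro has_vector_derivative_diff line) auto
  \<comment> \<open>Mean value inequality along the horizontal segment between the two lines, where
    \<open>F\<close> is uniformly small.\<close>
  have D_bound: "cmod (D y) \<le> C * exp (- (c * \<bar>y\<bar>)) * (b1 - b0)" for y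
  proof -
    let ?z0 = "of_real b0 + \<i> * of_real y" and ?z1 = "of_real b1 + \<i> * of_real y"
    have seg: "z \<in> ?S" "cmod (F z) \<le> C * exp (- (c * \<bar>y\<bar>))" if "z \<in> closed_segment ?z0 ?z1" for z
    proof -
      have "Im z = y" "b0 \<le> Re z" "Re z \<le> b1"
        using that b(2) by (auto simp: closed_segment_same_Im closed_segment_eq_real_ivl)
      then show "z \<in> ?S" "cmod (F z) \<le> C * exp (- (c * \<bar>y\<bar>))"
        using b decay[of "Re z" y] complex_eq[of z] by auto
    qed
    have "norm (P ?z1 - P ?z0) \<le> (C * exp (- (c * \<bar>y\<bar>))) * norm (?z1 - ?z0)"
      using seg P_at
      by (intro field_differentiable_bound[of "closed_segment ?z0 ?z1" P F])
         (auto intro: has_field_derivative_at_within)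
    moreover have "norm (?z1 - ?z0) = b1 - b0"
    proof -
      have "?z1 - ?z0 = of_real (b1 - b0)" by simp
      then show ?thesis using b(2) by (simp only: norm_of_real)
    qed
    ultimately show ?thesis by (simp add: D_def)
  qed
  have lim: "(D \<longlongrightarrow> 0) G" if "filterlim (\<lambda>y::real. \<bar>y\<bar>) at_top G" for G
  proof (rule Lim_null_comparison)
    show "\<forall>\<^sub>F y in G. norm (D y) \<le> C * exp (- (c * \<bar>y\<bar>)) * (b1 - b0)" using D_bound by simp
    have "filterlim (\<lambda>y. c * \<bar>y\<bar>) at_top G"
      by (intro filterlim_tendsto_pos_mult_at_top[OF tendsto_const c that])
    then have "((\<lambda>y. exp (- (c * \<bar>y\<bar>))) \<longlongrightarrow> 0) G"
      by (intro filterlim_compose[OF exp_at_bot] filterlim_uminus_at_bot_at_top[THEN filterlim_compose])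
    then show "((\<lambda>y. C * exp (- (c * \<bar>y\<bar>)) * (b1 - b0)) \<longlongrightarrow> 0) G"
      by (auto intro!: tendsto_mult_left_zero tendsto_mult_right_zero)
  qed
  have d_int: "integrable lborel d"
    unfolding d_def using int[of b0] int[of b1] b(2) by simp
  have d_cont: "isCont d y" for y
  proof -
    have "continuous_on UNIV d"
      unfolding d_def using cont[of b0] cont[of b1] b by (intro continuous_intros) auto
    then show ?thesis by (simp add: continuous_on_eq_continuous_at)
  qed
  have "(LBINT y=-\<infinity>..\<infinity>. d y) = 0 - 0"
  proof (rule interval_integral_FTC_integrable)
    show "(D has_vector_derivative d y) (at y)" for y by (rule D_deriv)
    show "set_integrable lborel (einterval (-\<infinity>) \<infinity>) d"
      using d_int by (simp add: set_integrable_def einterval_def)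
    show "((D \<circ> real_of_ereal) \<longlongrightarrow> 0) (at_right (-\<infinity>))"
    proof -
      have "filterlim (\<lambda>y::real. \<bar>y\<bar>) at_top at_bot"
        unfolding filterlim_at_bot_mirror using filterlim_abs_real by simp
      then show ?thesis by (simp add: ereal_tendsto_simps lim)
    qed
    show "((D \<circ> real_of_ereal) \<longlongrightarrow> 0) (at_left \<infinity>)"
      by (simp add: ereal_tendsto_simps lim filterlim_abs_real)
  qed (use d_cont in auto)
  then have "integral\<^sup>L lborel d = 0"
    by (simp add: interval_lebesgue_integral_def set_lebesgue_integral_def einterval_def)
  then have "\<i> * (CLINT y|lborel. F (of_real b1 + \<i> * of_real y)) - \<i> * (CLINT y|lborel. F (of_real b0 + \<i> * of_real y)) = 0"
    unfolding d_def using int[of b0] int[of b1] b(2) by simp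
  then show "(CLINT y|lborel. F (of_real b1 + \<i> * of_real y)) = (CLINT y|lborel. F (of_real b0 + \<i> * of_real y))"
    by simp
qed

subsection \<open>Meixner-Pollaczek polynomials and their weight\<close>

text \<open>\<open>(-n)_k / k!\<close> is a signed binomial coefficient. In this form the degree
  enters only through binomials, on which both the recurrence and the alternating sum over
  \<open>k\<close> operate.\<close>

lemma hyp2F1_neg_2_eq:
  "hyp2F1_neg n b c 2 = (\<Sum>k\<le>n. of_nat (n choose k) * ((- 2) ^ k * pochhammer b k / pochhammer c k))"
  unfolding hyp2F1_neg_def
proof (intro sum.cong refl)
  fix k
  have "complex_of_nat (n choose k) = (- 1) ^ k * pochhammer (- of_nat n) k / fact k"
    by (simp add: binomial_gbinomial gbinomial_pochhammer)
  moreover have "(- 1) ^ k * (- 1) ^ k = (1 :: complex)" by (simp flip: power_mult_distrib)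
  ultimately have p: "pochhammer (- complex_of_nat n) k = (- 1) ^ k * of_nat (n choose k) * fact k"
    by (simp flip: mult.assoc)
  have two: "(- 2) ^ k = (- 1) ^ k * (2 :: complex) ^ k" by (simp flip: power_mult_distrib)
  \<comment> \<open>The case \<open>Z = 0\<close> is covered, both sides then being 0, so
    \<open>c\<close> may be arbitrary.\<close>
  have cancel: "X * fact k * Y / (Z * fact k) = X * (Y / Z)" for X Y Z :: complex
    by (cases "Z = 0") (auto simp: field_simps)
  show "pochhammer (- complex_of_nat n) k * pochhammer b k / (pochhammer c k * fact k) * 2 ^ k =
      of_nat (n choose k) * ((- 2) ^ k * pochhammer b k / pochhammer c k)"
    unfolding p two cancel by (simp add: mult_ac)
qed

text \<open>At \<open>z = 2\<close> the coefficients \<open>t k\<close> satisfy \<open>(c + k) t (k + 1) = -2 (b + k) t k\<close>; this absorbs the factor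
  \<open>2 b\<close>, after which the relation holds coefficientwise.\<close>

lemma hyp2F1_neg_2_recurrence:
  assumes c: "\<And>k. c + of_nat k \<noteq> (0 :: complex)"
  shows "(c + of_nat m) * hyp2F1_neg (Suc m) b c 2 =
    (c - 2 * b) * hyp2F1_neg m b c 2 + of_nat m * hyp2F1_neg (m - 1) b c 2"
proof -
  define t where "t k = (- 2) ^ k * pochhammer b k / pochhammer c k" for k
  define B where "B n k = complex_of_nat (n choose k)" for n k
  have pc: "pochhammer c k \<noteq> 0" for k
    using c by (auto simp: pochhammer_eq_0_iff add_eq_0_iff2)
  have t_Suc: "2 * b * t k = - 2 * of_nat k * t k - (c + of_nat k) * t (Suc k)" for k
  proof -
    have "(c + of_nat k) * t (Suc k) =
        (c + of_nat k) * ((- 2) ^ Suc k * (pochhammer b k * (b + of_nat k))) / ((c + of_nat k) * pochhammer c k)"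
      by (simp only: t_def pochhammer_Suc mult.commute[of "pochhammer c k"] times_divide_eq_right)
    also have "\<dots> = ((- 2) ^ Suc k * (pochhammer b k * (b + of_nat k))) / pochhammer c k"
      by (rule mult_divide_mult_cancel_left[OF c])
    also have "\<dots> = - 2 * (b + of_nat k) * t k"
      by (simp only: t_def power_Suc times_divide_eq_right mult_ac)
    finally have R: "(c + of_nat k) * t (Suc k) = - 2 * (b + of_nat k) * t k" .
    show ?thesis unfolding R by (simp add: algebra_simps)
  qed
  \<comment> \<open>Extending every sum to \<open>k \<le> Suc m\<close> adds only vanishing
    binomials and lets the three degrees be compared termwise.\<close>
  have F: "hyp2F1_neg n b c 2 = (\<Sum>k\<le>Suc m. B n k * t k)" if "n \<le> Suc m" for n
    unfolding hyp2F1_neg_2_eq B_def t_def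
    using that by (intro sum.mono_neutral_left) auto
  have "2 * b * hyp2F1_neg m b c 2 = (\<Sum>k\<le>Suc m. B m k * (2 * b * t k))"
    by (simp add: F sum_distrib_left mult_ac del: sum.atMost_Suc)
  also have "\<dots> = (\<Sum>k\<le>Suc m. - 2 * of_nat k * B m k * t k) - (\<Sum>k\<le>Suc m. B m k * (c + of_nat k) * t (Suc k))"
    unfolding t_Suc by (simp add: algebra_simps flip: sum_subtractf del: sum.atMost_Suc)
  also have "(\<Sum>k\<le>Suc m. B m k * (c + of_nat k) * t (Suc k)) = (\<Sum>k\<le>m. B m k * (c + of_nat k) * t (Suc k))"
    by (simp add: B_def)
  also have "\<dots> = (\<Sum>k\<le>Suc m. (case k of 0 \<Rightarrow> 0 | Suc j \<Rightarrow> B m j * (c + of_nat j)) * t k)"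
    by (subst sum.atMost_Suc_shift) simp
  finally have 2: "2 * b * hyp2F1_neg m b c 2 = (\<Sum>k\<le>Suc m. (- 2 * of_nat k * B m k -
      (case k of 0 \<Rightarrow> 0 | Suc j \<Rightarrow> B m j * (c + of_nat j))) * t k)"
    by (simp add: left_diff_distrib sum_subtractf del: sum.atMost_Suc)
  \<comment> \<open>The total coefficient of \<open>t k\<close>. It vanishes by Pascal's rule and
    two absorption identities; for \<open>m = 0\<close> the truncated \<open>m - 1\<close> is
    multiplied by 0.\<close>
  have coeff: "(c + of_nat m) * B (Suc m) k - c * B m k - of_nat m * B (m - 1) k +
      (- 2 * of_nat k * B m k - (case k of 0 \<Rightarrow> 0 | Suc j \<Rightarrow> B m j * (c + of_nat j))) = 0" for k
  proof (cases k)
    case 0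
    then show ?thesis by (simp add: B_def)
  next
    case (Suc j)
    have pascal: "B (Suc m) (Suc j) = B m j + B m (Suc j)"
      by (simp add: B_def)
    have "(m - Suc j) * (m choose Suc j) = m * ((m - 1) choose Suc j)"
      by (rule binomial_absorb_comp)
    then have "complex_of_nat ((m - Suc j) * (m choose Suc j)) = of_nat m * B (m - 1) (Suc j)"
      by (simp add: B_def)
    then have comp: "(of_nat m - of_nat (Suc j)) * B m (Suc j) = of_nat m * B (m - 1) (Suc j)"
      by (cases "Suc j \<le> m") (auto simp: B_def of_nat_diff binomial_eq_0)
    have "Suc j * (m choose Suc j) = (m - j) * (m choose j)"
      unfolding binomial_absorb_comp[of m j] by (rule binomial_absorption)
    then have "complex_of_nat (Suc j * (m choose Suc j)) = of_nat ((m - j) * (m choose j))"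
      by (simp only:)
    then have absorb: "of_nat (Suc j) * B m (Suc j) = (of_nat m - of_nat j) * B m j"
      by (cases "j \<le> m") (auto simp: B_def of_nat_diff binomial_eq_0 distrib_right)
    show ?thesis
      unfolding Suc pascal comp[symmetric] using absorb by (simp add: algebra_simps)
  qed
  have "(c + of_nat m) * hyp2F1_neg (Suc m) b c 2 - c * hyp2F1_neg m b c 2 - of_nat m * hyp2F1_neg (m - 1) b c 2
      + 2 * b * hyp2F1_neg m b c 2 = (\<Sum>k\<le>Suc m. ((c + of_nat m) * B (Suc m) k - c * B m k - of_nat m * B (m - 1) k +
      (- 2 * of_nat k * B m k - (case k of 0 \<Rightarrow> 0 | Suc j \<Rightarrow> B m j * (c + of_nat j)))) * t k)"
    unfolding 2 by (simp add: F sum_distrib_left sum_distrib_right left_diff_distrib distrib_right sum_subtractf sum.distrib mult.assoc del: sum.atMost_Suc)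
  also have "\<dots> = 0" unfolding coeff by simp
  finally show ?thesis by (simp add: algebra_simps)
qed

text \<open>Up to the phase i^n, the orthonormal Meixner-Pollaczek polynomial with parameter
  \<open>a / 2\<close> and angle \<open>pi / 2\<close>, evaluated at \<open>E / 2\<close>. It is the
  coefficient of the eigenvector without the prefactor that does not depend on
  \<open>n\<close>.\<close>

definition mp_poly :: "real \<Rightarrow> real \<Rightarrow> nat \<Rightarrow> complex" where
  "mp_poly a E n = (- 1) ^ n * complex_of_real (sqrt (pochhammer a n / fact n)) *
     hyp2F1_neg n ((of_real a + \<i> * of_real E) / 2) (of_real a) 2"

definition mp_coeff :: "real \<Rightarrow> nat \<Rightarrow> real" where
  "mp_coeff a n = sqrt ((real n + 1) * (real n + a))"

lemma mp_poly_0: "mp_poly a E 0 = 1"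
  by (simp add: mp_poly_def hyp2F1_neg_def)

text \<open>The square roots symmetrise the hypergeometric recurrence: \<open>up\<close> and
  \<open>down\<close> turn its unequal coefficients \<open>a + n\<close> and \<open>n\<close> into
  values of \<open>mp_coeff\<close>. The remaining coefficient \<open>a - 2 * b\<close> is
  \<open>- \<i> * E\<close>.\<close>

lemma mp_poly_recurrence:
  assumes "a > 0"
  shows "of_real E * mp_poly a E n =
    \<i> * ((if n = 0 then 0 else mp_coeff a (n - 1) * mp_poly a E (n - 1)) - mp_coeff a n * mp_poly a E (Suc n))"
proof -
  define F where "F n = hyp2F1_neg n ((of_real a + \<i> * of_real E) / 2) (of_real a) 2" for n
  define r where "r n = sqrt (pochhammer a n / fact n)" for n
  have poly: "mp_poly a E n = (- 1) ^ n * complex_of_real (r n) * F n" for n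
    by (simp add: mp_poly_def F_def r_def)
  have r_Suc: "r (Suc n) = r n * sqrt ((a + real n) / (real n + 1))" for n
    by (simp add: r_def pochhammer_Suc add.commute flip: real_sqrt_mult)
  have up: "mp_coeff a n * r (Suc n) = (a + n) * r n" for n
  proof -
    have "sqrt ((real n + 1) * (real n + a)) * sqrt ((a + real n) / (real n + 1)) = sqrt ((a + n)\<^sup>2)"
      using assms by (simp add: power2_eq_square add.commute flip: real_sqrt_mult)
    also have "\<dots> = a + n" using assms by simp
    finally show ?thesis by (simp add: mp_coeff_def r_Suc mult_ac)
  qed
  have down: "mp_coeff a n * r n = (real n + 1) * r (Suc n)" for n
  proof -
    have cancel: "x\<^sup>2 * (y / x) = x * y" if "x \<noteq> 0" for x y :: real
      using that by (simp add: power2_eq_square)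
    have "(real n + 1) * sqrt ((a + real n) / (real n + 1)) = sqrt ((real n + 1)\<^sup>2) * sqrt ((a + real n) / (real n + 1))"
      by simp
    also have "\<dots> = sqrt ((real n + 1)\<^sup>2 * ((a + real n) / (real n + 1)))" by (simp only: real_sqrt_mult)
    also have "\<dots> = sqrt ((real n + 1) * (real n + a))"
      by (subst cancel) (simp_all add: add.commute)
    finally show ?thesis unfolding mp_coeff_def r_Suc by (simp only: mult_ac)
  qed
  have "of_real a + of_nat k \<noteq> (0 :: complex)" for k
  proof -
    have "Re (of_real a + of_nat k) \<noteq> 0" using assms by simp
    then show ?thesis by (metis zero_complex.simps(1))
  qed
  moreover have "of_real a - 2 * ((of_real a + \<i> * of_real E) / 2) = - \<i> * complex_of_real E"
    by (simp add: field_simps)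
  ultimately have rec: "(of_real a + of_nat n) * F (Suc n) = - \<i> * of_real E * F n + of_nat n * F (n - 1)"
    unfolding F_def by (subst hyp2F1_neg_2_recurrence) (auto simp only:)
  have "complex_of_real (mp_coeff a n) * mp_poly a E (Suc n) = - ((- 1) ^ n * of_real (mp_coeff a n * r (Suc n)) * F (Suc n))"
    by (simp add: poly)
  also have "\<dots> = - ((- 1) ^ n * of_real (r n) * ((of_real a + of_nat n) * F (Suc n)))"
    unfolding up by simp
  finally have 1: "complex_of_real (mp_coeff a n) * mp_poly a E (Suc n) =
     - ((- 1) ^ n * of_real (r n) * (- \<i> * of_real E * F n + of_nat n * F (n - 1)))"
    unfolding rec .
  have 2: "(if n = 0 then 0 else mp_coeff a (n - 1) * mp_poly a E (n - 1)) = - ((- 1) ^ n * of_real (r n) * of_nat n * F (n - 1))"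
  proof (cases n)
    case (Suc k)
    have "complex_of_real (mp_coeff a k) * mp_poly a E k = (- 1) ^ k * of_real (mp_coeff a k * r k) * F k"
      by (simp add: poly)
    also have "\<dots> = (- 1) ^ k * of_real (r (Suc k)) * of_nat (Suc k) * F k"
      unfolding down by simp
    finally show ?thesis by (simp add: Suc)
  qed auto
  show ?thesis
    unfolding 1 2 poly[of n] by (simp add: algebra_simps)
qed

section \<open>The weight and its Pochhammer moments\<close>

definition mp_weight :: "real \<Rightarrow> real \<Rightarrow> real" where
  "mp_weight a E = (cmod (Gamma ((of_real a + \<i> * of_real E) / 2)))\<^sup>2"

definition mp_mass :: "real \<Rightarrow> real" where
  "mp_mass a = (LINT E|lborel. mp_weight a E)"

lemma half_line_eq: "(of_real a + \<i> * of_real E) / 2 = complex_of_real (a / 2) + \<i> * of_real (E / 2)"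
  by simp

lemma Re_pos_not_nonpos_Int: "Re z > 0 \<Longrightarrow> z \<notin> \<int>\<^sub>\<le>\<^sub>0" for z :: complex
  by (auto elim!: nonpos_Ints_cases)

lemma mp_weight_pos: "a > 0 \<Longrightarrow> mp_weight a E > 0"
  using Re_pos_not_nonpos_Int[of "(of_real a + \<i> * of_real E) / 2"]
  by (simp add: mp_weight_def Gamma_eq_zero_iff)

lemma mp_weight_decay:
  assumes "a > 0"
  shows "\<exists>C. \<forall>E. mp_weight a E \<le> C * exp (- (1 / 2 * \<bar>E\<bar>))"
proof -
  obtain C where C: "C \<ge> 0" "\<And>y. cmod (Gamma (of_real (a / 2) + \<i> * of_real y)) \<le> C * exp (- (\<bar>y\<bar> / 2))"
    using norm_Gamma_strip_decay[of "a / 2" "a / 2"] assms by fastforce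
  have "mp_weight a E \<le> C\<^sup>2 * exp (- (1 / 2 * \<bar>E\<bar>))" for E
  proof -
    have "mp_weight a E \<le> (C * exp (- (\<bar>E / 2\<bar> / 2)))\<^sup>2"
      unfolding mp_weight_def half_line_eq by (intro power_mono C(2)) auto
    also have "\<dots> = C\<^sup>2 * exp (- (1 / 2 * \<bar>E\<bar>))"
      by (simp add: power_mult_distrib flip: exp_double)
    finally show ?thesis .
  qed
  then show ?thesis by blast
qed

lemma mp_weight_measurable:
  assumes "a > 0" shows "mp_weight a \<in> borel_measurable borel"
proof -
  have "continuous_on UNIV (\<lambda>E. (cmod (Gamma ((of_real a + \<i> * of_real E) / 2)))\<^sup>2)"
    using assms
    by (intro continuous_intros continuous_on_compose2[OF continuous_on_Gamma[of "{z. Re z > 0}"]])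
       (auto dest: Re_pos_not_nonpos_Int)
  then show ?thesis unfolding mp_weight_def[abs_def] by (rule borel_measurable_continuous_onI)
qed

lemma mp_weight_integrable:
  assumes "a > 0" shows "integrable lborel (mp_weight a)"
proof -
  obtain C where "\<And>E. mp_weight a E \<le> C * exp (- (1 / 2 * \<bar>E\<bar>))"
    using mp_weight_decay[OF assms] by blast
  then show ?thesis
    using mp_weight_measurable[OF assms] mp_weight_pos[OF assms]
    by (intro integrable_if_exp_decay[of "1 / 2" _ C]) (auto simp: abs_of_pos)
qed

lemma mp_mass_pos:
  assumes "a > 0" shows "mp_mass a > 0"
proof -
  have "mp_mass a \<noteq> 0"
  proof
    assume "mp_mass a = 0"
    then have "AE E in lborel. mp_weight a E = 0"
      unfolding mp_mass_def using mp_weight_integrable[OF assms] mp_weight_pos[OF assms]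
      by (subst (asm) integral_nonneg_eq_0_iff_AE) (auto intro: less_imp_le)
    then have "AE E in (lborel :: real measure). False"
      by eventually_elim (metis assms less_irrefl mp_weight_pos)
    then show False
      using AE_iff_measurable[of UNIV "lborel :: real measure" "\<lambda>_. False"] by simp
  qed
  moreover have "mp_mass a \<ge> 0"
    unfolding mp_mass_def using mp_weight_pos[OF assms] by (intro Bochner_Integration.integral_nonneg) (auto intro: less_imp_le)
  ultimately show ?thesis by simp
qed

text \<open>The contour shift applied to \<open>\<Gamma>(\<zeta>/2 + k) \<Gamma>(a + 1 - \<zeta>/2)\<close> between the lines \<open>Re \<zeta> = a\<close> and \<open>Re \<zeta> = a + 2\<close>.\<close>

lemma mp_weight_pochhammer:
  fixes b :: "real \<Rightarrow> complex"
  assumes "a > 0" and b: "\<And>E. b E = (of_real a + \<i> * of_real E) / 2"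
  shows "integrable lborel (\<lambda>E. pochhammer (b E) k * of_real (mp_weight a E))"
    and "(CLINT E|lborel. pochhammer (b E) k * of_real (mp_weight a E)) =
      pochhammer (of_real a) k / 2 ^ k * of_real (mp_mass a)"
proof -
  \<comment> \<open>The variable is \<open>\<zeta> = 2 * b\<close>, so that both lines are
    parametrised by \<open>E\<close> itself. The extra 1 in the second factor produces
    \<open>a - b\<close> on the left line and is cancelled on the right line, where \<open>b\<close>
    becomes \<open>b + 1\<close>.\<close>
  define G :: "nat \<Rightarrow> complex \<Rightarrow> complex" where "G k \<zeta> = Gamma (\<zeta> / 2 + of_nat k) * Gamma (of_real a + 1 - \<zeta> / 2)" for k \<zeta>
  \<comment> \<open>In this strip both arguments of Gamma have positive real part, so no pole lies
    between the lines.\<close>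
  have holo: "G k holomorphic_on {z. 0 < Re z \<and> Re z < 2 * a + 2}" for k
    unfolding G_def
    by (intro holomorphic_intros) (auto dest!: Re_pos_not_nonpos_Int[rotated] simp: Re_pos_not_nonpos_Int)
  have decay: "\<exists>C. \<forall>x y. a \<le> x \<longrightarrow> x \<le> a + 2 \<longrightarrow> cmod (G k (of_real x + \<i> * of_real y)) \<le> C * exp (- (1 / 2 * \<bar>y\<bar>))" for k
  proof -
    obtain C where C: "C \<ge> 0" "\<And>x y. a / 2 + k \<le> x \<Longrightarrow> x \<le> a / 2 + 1 + k \<Longrightarrow>
        cmod (Gamma (of_real x + \<i> * of_real y)) \<le> C * exp (- (\<bar>y\<bar> / 2))"
      using norm_Gamma_strip_decay[of "a / 2 + k" "a / 2 + 1 + k"] assms by (auto simp: add_pos_nonneg)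
    \<comment> \<open>The map \<open>x / 2 \<mapsto> a + 1 - x / 2\<close> sends the interval from
      \<open>a / 2\<close> to \<open>a / 2 + 1\<close> onto itself.\<close>
    obtain D where D: "D \<ge> 0" "\<And>x y. a / 2 \<le> x \<Longrightarrow> x \<le> a / 2 + 1 \<Longrightarrow>
        cmod (Gamma (of_real x + \<i> * of_real y)) \<le> D * exp (- (\<bar>y\<bar> / 2))"
      using norm_Gamma_strip_decay[of "a / 2" "a / 2 + 1"] assms by auto
    have "cmod (G k (of_real x + \<i> * of_real y)) \<le> (C * D) * exp (- (1 / 2 * \<bar>y\<bar>))"
      if x: "a \<le> x" "x \<le> a + 2" for x y
    proof -
      have eq: "(complex_of_real x + \<i> * of_real y) / 2 + of_nat k = of_real (x / 2 + k) + \<i> * of_real (y / 2)"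
        "complex_of_real a + 1 - (of_real x + \<i> * of_real y) / 2 = of_real (a + 1 - x / 2) + \<i> * of_real (- y / 2)"
        by (simp_all add: add_divide_distrib)
      have "cmod (G k (of_real x + \<i> * of_real y)) \<le> (C * exp (- (\<bar>y / 2\<bar> / 2))) * (D * exp (- (\<bar>- y / 2\<bar> / 2)))"
        unfolding G_def norm_mult eq using x C(1) by (intro mult_mono C(2) D(2)) auto
      also have "\<dots> = (C * D) * exp (- (1 / 2 * \<bar>y\<bar>))"
        by (simp flip: exp_add)
      finally show ?thesis .
    qed
    then show ?thesis by blast
  qed
  have Re_b: "Re (b E) = a / 2" for E by (simp add: b)
  have cnj_b: "cnj (b E) = of_real a - b E" for E by (simp add: b complex_eq_iff)
  have w: "complex_of_real (mp_weight a E) = Gamma (b E) * Gamma (of_real a - b E)" for E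
    unfolding mp_weight_def b[symmetric] complex_norm_square cnj_Gamma cnj_b ..
  have Gamma_b: "Gamma (b E + of_nat k) = pochhammer (b E) k * Gamma (b E)" for E k
    using pochhammer_Gamma[of "b E" k] Re_pos_not_nonpos_Int[of "b E"] assms(1)
    by (simp add: Re_b Gamma_eq_zero_iff field_simps)
  have low: "G k (of_real a + \<i> * of_real E) = pochhammer (b E) k * (of_real a - b E) * of_real (mp_weight a E)" for k E
  proof -
    have "Gamma (of_real a + 1 - b E) = (of_real a - b E) * Gamma (of_real a - b E)"
      using Gamma_plus1_Re_pos[of "of_real a - b E"] assms(1) by (simp add: Re_b algebra_simps)
    then show ?thesis by (simp add: G_def b[symmetric] Gamma_b w)
  qed
  have high: "G k (of_real (a + 2) + \<i> * of_real E) = pochhammer (b E) (Suc k) * of_real (mp_weight a E)" for k E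
  proof -
    have 1: "(of_real (a + 2) + \<i> * of_real E) / 2 = b E + 1" by (simp add: b add_divide_distrib)
    have 2: "b E + 1 + of_nat k = b E + of_nat (Suc k)" by simp
    show ?thesis unfolding G_def 1 2 Gamma_b w by (simp add: mult_ac)
  qed
  have shift: "integrable lborel (\<lambda>E. pochhammer (b E) (Suc k) * of_real (mp_weight a E))"
    "(CLINT E|lborel. pochhammer (b E) (Suc k) * of_real (mp_weight a E)) =
      (CLINT E|lborel. pochhammer (b E) k * (of_real a - b E) * of_real (mp_weight a E))" for k
  proof -
    obtain C where C: "\<And>x y. a \<le> x \<Longrightarrow> x \<le> a + 2 \<Longrightarrow> cmod (G k (of_real x + \<i> * of_real y)) \<le> C * exp (- (1 / 2 * \<bar>y\<bar>))"
      using decay[of k] by blast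
    have ord: "0 < a" "a \<le> a + 2" "a + 2 < 2 * a + 2" "(0::real) < 1 / 2" using assms(1) by auto
    show "integrable lborel (\<lambda>E. pochhammer (b E) (Suc k) * of_real (mp_weight a E))"
      using integral_vertical_line_shift(1)[OF holo[of k] ord C, of "a + 2"] unfolding high by simp
    show "(CLINT E|lborel. pochhammer (b E) (Suc k) * of_real (mp_weight a E)) =
      (CLINT E|lborel. pochhammer (b E) k * (of_real a - b E) * of_real (mp_weight a E))"
      using integral_vertical_line_shift(2)[OF holo[of k] ord C] unfolding high low by simp
  qed
  have int: "integrable lborel (\<lambda>E. pochhammer (b E) k * of_real (mp_weight a E))" for k
    using shift(1) mp_weight_integrable[OF assms(1)] by (cases k) auto
  then show "integrable lborel (\<lambda>E. pochhammer (b E) k * of_real (mp_weight a E))" .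
  show "(CLINT E|lborel. pochhammer (b E) k * of_real (mp_weight a E)) =
      pochhammer (of_real a) k / 2 ^ k * of_real (mp_mass a)"
  proof (induction k)
    case (Suc k)
    let ?I = "\<lambda>k. (CLINT E|lborel. pochhammer (b E) k * of_real (mp_weight a E))"
    \<comment> \<open>Writing \<open>a - b\<close> as \<open>(a + k) - (b + k)\<close> makes the
      unknown integral reappear on the right, and the equation can be solved for it.\<close>
    have "pochhammer (b E) k * (of_real a - b E) * of_real (mp_weight a E) =
        (of_real a + of_nat k) * (pochhammer (b E) k * of_real (mp_weight a E)) - pochhammer (b E) (Suc k) * of_real (mp_weight a E)" for E
      by (simp add: pochhammer_Suc algebra_simps)
    then have "?I (Suc k) = (of_real a + of_nat k) * ?I k - ?I (Suc k)"
      using shift(2)[of k] int[of k] int[of "Suc k"] by simp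
    then have "2 * ?I (Suc k) = (of_real a + of_nat k) * ?I k" by (simp add: algebra_simps)
    then have "?I (Suc k) = (of_real a + of_nat k) * ?I k / 2"
      by (metis nonzero_mult_div_cancel_left zero_neq_numeral)
    then show ?case unfolding Suc by (simp add: pochhammer_Suc mult_ac)
  qed (simp add: mp_mass_def)
qed

text \<open>The moments cancel the denominators \<open>pochhammer a k\<close>, and their powers of 2
  reduce \<open>(- 2) ^ k\<close> to \<open>(- 1) ^ k\<close>.\<close>

lemma mp_weight_hyp2F1:
  assumes "a > 0"
  shows "(CLINT E|lborel. hyp2F1_neg n ((of_real a + \<i> * of_real E) / 2) (of_real a) 2 * of_real (mp_weight a E)) =
    (if n = 0 then of_real (mp_mass a) else 0)"
proof -
  define b where "b E = (complex_of_real a + \<i> * of_real E) / 2" for E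
  note mom = mp_weight_pochhammer[OF assms b_def]
  have nz: "pochhammer (complex_of_real a) k \<noteq> 0" for k
    using pochhammer_pos[OF assms, of k] by (metis of_real_eq_0_iff less_irrefl pochhammer_of_real)
  have "(CLINT E|lborel. hyp2F1_neg n (b E) (of_real a) 2 * of_real (mp_weight a E)) =
      (CLINT E|lborel. \<Sum>k\<le>n. (of_nat (n choose k) * (- 2) ^ k / pochhammer (of_real a) k) * (pochhammer (b E) k * of_real (mp_weight a E)))"
    unfolding hyp2F1_neg_2_eq sum_distrib_right
    by (intro Bochner_Integration.integral_cong sum.cong refl) (simp add: mult_ac)
  also have "\<dots> = (\<Sum>k\<le>n. (of_nat (n choose k) * (- 2) ^ k / pochhammer (of_real a) k) * (pochhammer (of_real a) k / 2 ^ k * complex_of_real (mp_mass a)))"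
    unfolding mom(2)[symmetric] using mom(1)
    by (subst Bochner_Integration.integral_sum) auto
  also have "\<dots> = (\<Sum>k\<le>n. ((- 1) ^ k * of_nat (n choose k)) * complex_of_real (mp_mass a))"
  proof (intro sum.cong refl)
    fix k
    have "(- 2) ^ k = (- 1) ^ k * (2 :: complex) ^ k" by (simp flip: power_mult_distrib)
    then show "(of_nat (n choose k) * (- 2) ^ k / pochhammer (of_real a) k) * (pochhammer (of_real a) k / 2 ^ k * complex_of_real (mp_mass a))
        = ((- 1) ^ k * of_nat (n choose k)) * complex_of_real (mp_mass a)"
      using nz[of k] by (simp add: field_simps)
  qed
  also have "\<dots> = (\<Sum>k\<le>n. (- 1) ^ k * of_nat (n choose k)) * of_real (mp_mass a)"
    by (simp add: sum_distrib_right)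
  also have "\<dots> = (if n = 0 then of_real (mp_mass a) else 0)"
    using choose_alternating_sum[of n, where 'a = complex] by auto
  finally show ?thesis unfolding b_def .
qed

section \<open>The normalised orthogonality measure\<close>

definition mp_measure :: "real \<Rightarrow> real measure" where
  "mp_measure a = density lborel (\<lambda>E. ennreal (mp_weight a E / mp_mass a))"

lemma mp_measure_integral:
  fixes f :: "real \<Rightarrow> complex"
  assumes "a > 0" "f \<in> borel_measurable borel"
  shows "(CLINT E|mp_measure a. f E) = (CLINT E|lborel. f E * of_real (mp_weight a E)) / of_real (mp_mass a)"
proof -
  have [measurable]: "mp_weight a \<in> borel_measurable borel" by (rule mp_weight_measurable[OF assms(1)])
  have "(CLINT E|mp_measure a. f E) =
      (CLINT E|lborel. (mp_weight a E / mp_mass a) *\<^sub>R f E)"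
    unfolding mp_measure_def
    using assms mp_weight_pos[OF assms(1)] mp_mass_pos[OF assms(1)]
    by (intro integral_density) (auto intro!: divide_nonneg_pos less_imp_le)
  also have "\<dots> = (CLINT E|lborel. (f E * of_real (mp_weight a E)) / of_real (mp_mass a))"
    by (simp add: scaleR_conv_of_real mult.commute)
  finally show ?thesis by simp
qed

lemma mp_poly_measurable: "(\<lambda>E. mp_poly a E n) \<in> borel_measurable borel"
proof -
  have "continuous_on UNIV (\<lambda>E. pochhammer ((complex_of_real a + \<i> * of_real E) / 2) k)" for k
    by (induction k) (auto simp: pochhammer_Suc intro!: continuous_intros)
  then have [measurable]: "(\<lambda>E. pochhammer ((complex_of_real a + \<i> * of_real E) / 2) k) \<in> borel_measurable borel" for k
    by (rule borel_measurable_continuous_onI)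
  show ?thesis unfolding mp_poly_def hyp2F1_neg_2_eq by measurable
qed

lemma finite_mp_measure:
  assumes "a > 0" shows "finite_measure (mp_measure a)"
proof
  have "emeasure (mp_measure a) (space (mp_measure a)) =
      (\<integral>\<^sup>+E. ennreal (mp_weight a E / mp_mass a) \<partial>lborel)"
    using mp_weight_measurable[OF assms] by (simp add: mp_measure_def emeasure_density)
  also have "\<dots> < \<infinity>"
  proof -
    have "integrable lborel (\<lambda>E. mp_weight a E / mp_mass a)"
      using mp_weight_integrable[OF assms] by simp
    moreover have "norm (mp_weight a E / mp_mass a) = mp_weight a E / mp_mass a" for E
      using mp_weight_pos[OF assms, of E] mp_mass_pos[OF assms] by simp
    ultimately show ?thesis unfolding integrable_iff_bounded by simp
  qed
  finally show "emeasure (mp_measure a) (space (mp_measure a)) \<noteq> \<infinity>" by simp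
qed

lemma sets_mp_measure: "sets (mp_measure a) = sets borel"
  by (simp add: mp_measure_def)

lemma mp_measure_interval_pos:
  assumes "a > 0" "l < u" shows "measure (mp_measure a) {l<..<u} > 0"
proof -
  interpret finite_measure "mp_measure a" by (rule finite_mp_measure[OF assms(1)])
  have [measurable]: "mp_weight a \<in> borel_measurable borel" by (rule mp_weight_measurable[OF assms(1)])
  let ?f = "\<lambda>E. ennreal (mp_weight a E / mp_mass a)"
  have pos: "?f E > 0" for E
    using mp_weight_pos[OF assms(1), of E] mp_mass_pos[OF assms(1)] by simp
  have "emeasure (mp_measure a) {l<..<u} \<noteq> 0"
  proof
    assume "emeasure (mp_measure a) {l<..<u} = 0"
    then have "(\<integral>\<^sup>+E. ?f E * indicator {l<..<u} E \<partial>lborel) = 0"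
      by (simp add: mp_measure_def emeasure_density)
    then have "AE E in lborel. ?f E * indicator {l<..<u} E = 0"
      by (subst (asm) nn_integral_0_iff_AE) auto
    then have "AE E in lborel. E \<notin> {l<..<u}"
    proof eventually_elim
      fix E assume "?f E * indicator {l<..<u} E = 0"
      then show "E \<notin> {l<..<u}" using pos[of E] by (auto split: split_indicator_asm)
    qed
    then have "emeasure lborel {l<..<u} = 0"
      by (subst (asm) AE_iff_measurable[of "{l<..<u}"]) auto
    then show False using assms(2) by simp
  qed
  then show ?thesis by (simp add: emeasure_eq_measure zero_less_measure_iff)
qed

text \<open>The weight decays at rate 1/2; half of that rate is taken as the exponential moment and
  the other half secures integrability. Conjugating the eigenvector equation gives the recurrence
  with the sign that the locale expects.\<close>

lemma jacobi_measure_mp: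
  assumes "a > 0"
  shows "jacobi_measure (mp_measure a) (1 / 4) (\<lambda>n E. cnj (mp_poly a E n)) (mp_coeff a)"
proof (intro jacobi_measure.intro finite_mp_measure[OF assms] jacobi_measure_axioms.intro)
  have [measurable]: "mp_weight a \<in> borel_measurable borel" by (rule mp_weight_measurable[OF assms])
  let ?I = "mp_mass a"
  have I: "?I > 0" by (rule mp_mass_pos[OF assms])
  show "sets (mp_measure a) = sets borel" by (rule sets_mp_measure)
  show "integrable (mp_measure a) (\<lambda>x. exp (1 / 4 * \<bar>x\<bar>))"
  proof -
    obtain C where C: "\<And>E. mp_weight a E \<le> C * exp (- (1 / 2 * \<bar>E\<bar>))"
      using mp_weight_decay[OF assms] by blast
    have "integrable lborel (\<lambda>x. mp_weight a x / ?I * exp (1 / 4 * \<bar>x\<bar>))"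
    proof (rule integrable_if_exp_decay[of "1 / 4" _ "C / ?I"])
      fix x
      have "norm (mp_weight a x / ?I * exp (1 / 4 * \<bar>x\<bar>)) = mp_weight a x / ?I * exp (1 / 4 * \<bar>x\<bar>)"
        using mp_weight_pos[OF assms, of x] I by simp
      also have "\<dots> \<le> C * exp (- (1 / 2 * \<bar>x\<bar>)) / ?I * exp (1 / 4 * \<bar>x\<bar>)"
        using C[of x] I by (intro mult_right_mono divide_right_mono) auto
      also have "\<dots> = C / ?I * exp (- (1 / 4 * \<bar>x\<bar>))"
        using exp_add[of "- (1 / 2 * \<bar>x\<bar>)" "1 / 4 * \<bar>x\<bar>"] by (simp add: mult_ac)
      finally show "norm (mp_weight a x / ?I * exp (1 / 4 * \<bar>x\<bar>)) \<le> C / ?I * exp (- (1 / 4 * \<bar>x\<bar>))" .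
    qed auto
    moreover have "AE x in lborel. 0 \<le> mp_weight a x / ?I"
      using mp_weight_pos[OF assms] I by (auto intro!: divide_nonneg_pos less_imp_le)
    ultimately show ?thesis
      unfolding mp_measure_def by (subst integrable_real_density) auto
  qed
  show "mp_coeff a n > 0" for n using assms by (simp add: mp_coeff_def)
  show "cnj (mp_poly a x 0) = 1" for x by (simp add: mp_poly_0)
  show "complex_of_real x * cnj (mp_poly a x n) = \<i> * (complex_of_real (mp_coeff a n) * cnj (mp_poly a x (Suc n)) -
      (if n = 0 then 0 else complex_of_real (mp_coeff a (n - 1)) * cnj (mp_poly a x (n - 1))))" for x n
  proof -
    have "complex_of_real x * cnj (mp_poly a x n) = cnj (of_real x * mp_poly a x n)" by simp
    also have "\<dots> = \<i> * (complex_of_real (mp_coeff a n) * cnj (mp_poly a x (Suc n)) -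
      (if n = 0 then 0 else complex_of_real (mp_coeff a (n - 1)) * cnj (mp_poly a x (n - 1))))"
      unfolding mp_poly_recurrence[OF assms] by (simp add: algebra_simps)
    finally show ?thesis .
  qed
  show "(CLINT x|mp_measure a. cnj (mp_poly a x n)) = (if n = 0 then 1 else 0)" for n
  proof -
    have "(CLINT x|mp_measure a. mp_poly a x n) =
        (CLINT E|lborel. mp_poly a E n * of_real (mp_weight a E)) / of_real ?I"
      by (rule mp_measure_integral[OF assms mp_poly_measurable])
    also have "(CLINT E|lborel. mp_poly a E n * of_real (mp_weight a E)) =
        (- 1) ^ n * complex_of_real (sqrt (pochhammer a n / fact n)) *
        (CLINT E|lborel. hyp2F1_neg n ((of_real a + \<i> * of_real E) / 2) (of_real a) 2 * of_real (mp_weight a E))"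
      unfolding mp_poly_def mult.assoc by (simp only: integral_mult_right_zero)
    finally show ?thesis
      unfolding mp_weight_hyp2F1[OF assms] Bochner_Integration.integral_cnj using I by simp
  qed
qed auto

subsection \<open>Decomposition by parity\<close>

lemma l2norm_mono:
  assumes "g \<in> ell2" "\<And>m. cmod (f m) \<le> cmod (g m)"
  shows "l2norm f \<le> l2norm g"
proof (rule l2norm_leI(2))
  fix n
  have "L2_set (\<lambda>i. cmod (f i)) {..<n} \<le> L2_set (\<lambda>i. cmod (g i)) {..<n}"
    using assms(2) by (intro L2_set_mono) auto
  then show "L2_set (\<lambda>i. cmod (f i)) {..<n} \<le> l2norm g"
    using L2_set_le_l2norm[OF assms(1), of n] by linarith
qed

lemma l2_closure_ell2_on: "l2_closure (ell2_on K) \<subseteq> ell2_on K"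
proof
  fix f assume "f \<in> l2_closure (ell2_on K)"
  then obtain s where f: "f \<in> ell2" and s: "\<And>k. s k \<in> ell2_on K" and lim: "(\<lambda>k. l2norm (s k - f)) \<longlonglongrightarrow> 0"
    by (auto simp: l2_closure_def)
  have "f m = 0" if "m \<notin> K" for m
    using component_tendsto[OF ell2_on_ell2[OF s] f lim, of m] s that
    by (simp add: ell2_on_def LIMSEQ_const_iff)
  then show "f \<in> ell2_on K" using f by (simp add: ell2_on_def)
qed

section \<open>Spreading a sequence over one parity class\<close>

definition spread :: "nat \<Rightarrow> vec \<Rightarrow> vec" where
  "spread j f = (\<lambda>m. if m mod 2 = j then f (m div 2) else 0)"

lemma spread_simps:
  "spread j (f + g) = spread j f + spread j g"
  "spread j (cscale z f) = cscale z (spread j f)"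
  by (auto simp: spread_def cscale_def)

lemma spread_apply: "j < 2 \<Longrightarrow> spread j f (2 * n + j) = f n"
  by (auto simp: spread_def)

lemma spread_sums:
  fixes F :: "complex \<Rightarrow> real"
  assumes "j < 2" "F 0 = 0"
  shows "summable (\<lambda>m. F (spread j f m)) \<longleftrightarrow> summable (\<lambda>n. F (f n))"
    and "(\<Sum>m. F (spread j f m)) = (\<Sum>n. F (f n))"
proof -
  have mono: "strict_mono (\<lambda>n. 2 * n + j)" by (simp add: strict_mono_def)
  have zero: "F (spread j f m) = 0" if "m \<notin> range (\<lambda>n. 2 * n + j)" for m
  proof -
    have "m mod 2 \<noteq> j"
    proof
      assume "m mod 2 = j"
      then have "m = 2 * (m div 2) + j" by presburger
      then show False using that by blast
    qed
    then show ?thesis using assms(2) by (simp add: spread_def)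
  qed
  show "summable (\<lambda>m. F (spread j f m)) \<longleftrightarrow> summable (\<lambda>n. F (f n))"
    using summable_mono_reindex[OF mono, of "\<lambda>m. F (spread j f m)"] zero by (simp add: spread_apply assms(1))
  show "(\<Sum>m. F (spread j f m)) = (\<Sum>n. F (f n))"
    using suminf_mono_reindex[OF mono, of "\<lambda>m. F (spread j f m)"] zero by (simp add: spread_apply assms(1))
qed

lemma spread_ell2:
  assumes "j < 2"
  shows "f \<in> ell2 \<Longrightarrow> spread j f \<in> ell2_on (residue_class j)" "l2norm (spread j f) = l2norm f"
proof -
  note sums = spread_sums[OF assms, of "\<lambda>z. (cmod z)\<^sup>2" f]
  show "f \<in> ell2 \<Longrightarrow> spread j f \<in> ell2_on (residue_class j)"
    using sums(1) by (auto simp: ell2_on_def ell2_def) (simp add: spread_def)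
  show "l2norm (spread j f) = l2norm f"
    using sums(2) by (simp add: l2norm_def)
qed

lemma spread_surj:
  assumes "j < 2" "g \<in> ell2_on (residue_class j)"
  shows "\<exists>f\<in>ell2. spread j f = g"
proof
  let ?f = "\<lambda>n. g (2 * n + j)"
  show eq: "spread j ?f = g"
  proof
    fix m
    show "spread j ?f m = g m"
    proof (cases "m mod 2 = j")
      case True
      then have "2 * (m div 2) + j = m" by presburger
      then show ?thesis using True by (simp add: spread_def)
    next
      case False
      then show ?thesis using assms by (simp add: spread_def ell2_on_def)
    qed
  qed
  show "?f \<in> ell2"
    using spread_sums(1)[OF assms(1), of "\<lambda>z. (cmod z)\<^sup>2" ?f] assms(2)
    unfolding eq by (simp add: ell2_def ell2_on_def)
qed

lemma spread_inject: "j < 2 \<Longrightarrow> spread j f = spread j g \<longleftrightarrow> f = g"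
  using spread_apply[of j] by (metis ext)

text \<open>For \<open>j = 1\<close> the radicand containing \<open>a\<close> belongs to the next
  pair, \<open>n + 1\<close>, and this raises the parameter from \<open>a\<close> to
  \<open>a + 1\<close>.\<close>

lemma jacobi_weight_eq:
  assumes "j < 2"
  shows "jacobi_weight a (2 * n + j) = mp_coeff (a + real j) n"
proof -
  have half: "sqrt (2 * x) * sqrt (2 * y) / 2 = sqrt (y * x)" for x y :: real
  proof -
    have "sqrt (2 * x) * sqrt (2 * y) = sqrt (2\<^sup>2 * (y * x))"
      by (simp add: power2_eq_square mult_ac flip: real_sqrt_mult)
    then show ?thesis by (simp only: real_sqrt_mult[of "2\<^sup>2"]) simp
  qed
  have even: "ladder_coeff a (2 * k) = sqrt (2 * (real k + a))"
    and odd: "ladder_coeff a (Suc (2 * k)) = sqrt (2 * (real k + 1))" for k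
    by (simp_all add: ladder_coeff_def)
  consider "j = 0" | "j = 1" using assms by linarith
  then show ?thesis
  proof cases
    case 1
    have "jacobi_weight a (2 * n) = sqrt ((real n + 1) * (real n + a))"
      unfolding jacobi_weight_def even odd half ..
    then show ?thesis by (simp add: 1 mp_coeff_def)
  next
    case 2
    have "Suc (Suc (2 * n)) = 2 * Suc n" by simp
    then have "jacobi_weight a (Suc (2 * n)) = sqrt ((real (Suc n) + a) * (real n + 1))"
      unfolding jacobi_weight_def by (simp only: even odd half)
    then show ?thesis by (simp add: 2 mp_coeff_def add_ac mult.commute)
  qed
qed

lemma jacobi_op_spread:
  assumes "j < 2"
  shows "jacobi_op a (spread j f) = spread j (\<lambda>n. \<i> *
    ((if n = 0 then 0 else complex_of_real (mp_coeff (a + real j) (n - 1)) * f (n - 1)) -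
      complex_of_real (mp_coeff (a + real j) n) * f (Suc n)))"
    (is "_ = spread j ?g")
proof
  fix m
  show "jacobi_op a (spread j f) m = spread j ?g m"
  proof (cases "m mod 2 = j")
    case True
    define n where "n = m div 2"
    have m: "m = 2 * n + j" using True unfolding n_def by presburger
    have up: "2 * n + j + 2 = 2 * Suc n + j" by simp
    have "jacobi_op a (spread j f) (2 * n + j) = ?g n"
    proof (cases n)
      case 0
      then have "2 * n + j < 2" using assms by simp
      then show ?thesis
        unfolding jacobi_op_def up spread_apply[OF assms] jacobi_weight_eq[OF assms] by (simp add: 0)
    next
      case (Suc k)
      then have down: "2 * n + j - 2 = 2 * k + j" "\<not> 2 * n + j < 2" by simp_all
      show ?thesis
        unfolding jacobi_op_def up down(1) spread_apply[OF assms] jacobi_weight_eq[OF assms]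
        using down(2) by (simp add: Suc)
    qed
    then show ?thesis unfolding m spread_apply[OF assms] .
  next
    case False
    have "(m + 2) mod 2 = m mod 2" by simp
    moreover have "(m - 2) mod 2 = m mod 2" if "\<not> m < 2" using that by presburger
    ultimately show ?thesis using False by (auto simp: jacobi_op_def spread_def)
  qed
qed

lemma jacobi_op_spread_mp_poly:
  assumes "a > 0" "j < 2"
  shows "jacobi_op a (spread j (mp_poly (a + real j) E)) = cscale E (spread j (mp_poly (a + real j) E))"
proof -
  have "a + real j > 0" using assms by simp
  then show ?thesis
    unfolding jacobi_op_spread[OF assms(2)] spread_simps(2)[symmetric]
    by (intro arg_cong[where f = "spread j"] ext) (simp only: cscale_def mp_poly_recurrence)
qed

lemma formal_eigenvector_spread:
  assumes "a > 0" "j < 2" "K \<noteq> 0" "c = cscale K (spread j (mp_poly (a + real j) E))"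
  shows "formal_eigenvector (H_b a) (complex_of_real E) c"
proof (rule formal_eigenvector_H_b)
  have "c (2 * 0 + j) = K"
    unfolding assms(4) cscale_def spread_apply[OF assms(2)] by (simp add: mp_poly_0)
  then show "c \<noteq> 0" using assms(3) by auto
  show "jacobi_op a c = cscale (complex_of_real E) c"
    unfolding assms(4) jacobi_op_simps jacobi_op_spread_mp_poly[OF assms(1,2)] cscale_simps(3)
    by (simp add: mult.commute)
qed

lemma norm_Gamma_factor_nonzero:
  assumes "a > 0" "Re z > 0"
  shows "complex_of_real (cmod (Gamma z) / sqrt (2 powr x * pi * Gamma a)) \<noteq> 0"
  using assms Gamma_real_pos[of a] Re_pos_not_nonpos_Int[of z] by (auto simp: Gamma_eq_zero_iff)

lemma formal_eigenvector_u0: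
  assumes "a > 0" shows "formal_eigenvector (H_b a) (complex_of_real E) (u0 a E)"
proof (rule formal_eigenvector_spread[OF assms, of 0])
  let ?K = "complex_of_real (cmod (Gamma ((a + \<i> * E) / 2)) / sqrt (2 powr (2 - a) * pi * Gamma a))"
  show "?K \<noteq> 0" by (rule norm_Gamma_factor_nonzero) (use assms in auto)
  show "u0 a E = cscale ?K (spread 0 (mp_poly (a + real 0) E))"
    by (auto simp: u0_def cscale_def spread_def alpha_even_def mp_poly_def fun_eq_iff even_iff_mod_2_eq_zero)
qed simp

lemma formal_eigenvector_u1:
  assumes "a > 0" shows "formal_eigenvector (H_b a) (complex_of_real E) (u1 a E)"
proof (rule formal_eigenvector_spread[OF assms, of 1])
  let ?K = "complex_of_real (cmod (Gamma ((a + 1 + \<i> * E) / 2)) / sqrt (2 powr (1 - a) * pi * Gamma (a + 1)))"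
  show "?K \<noteq> 0" by (rule norm_Gamma_factor_nonzero) (use assms in auto)
  show "u1 a E = cscale ?K (spread 1 (mp_poly (a + real 1) E))"
    by (auto simp: u1_def cscale_def spread_def alpha_odd_def mp_poly_def fun_eq_iff odd_iff_mod_2_eq_one)
qed simp

text \<open>The domain of the maximal operator asks only for a square-summable image. Surjectivity
  turns that image into a function \<open>v\<close>, and \<open>mult_ident_if_coeffs\<close>
  identifies \<open>v\<close> with \<open>x * u\<close>, so the two domains coincide.\<close>

lemma multiplication_model_jacobi_max:
  assumes "a > 0" "j < 2"
  shows "multiplication_model (mp_measure (a + real j)) (ell2_on (residue_class j)) (jacobi_max a (residue_class j))
    (\<lambda>u. spread j (jacobi_measure.coeffs (mp_measure (a + real j)) (\<lambda>n E. cnj (mp_poly (a + real j) E n)) u))"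
proof -
  define c where "c = a + real j"
  have c: "c > 0" using assms by (simp add: c_def)
  interpret J: jacobi_measure "mp_measure c" "1 / 4" "\<lambda>n E. cnj (mp_poly c E n)" "mp_coeff c"
    by (rule jacobi_measure_mp[OF c])
  let ?L = "L2 (mp_measure c)"
  have mult_sq: "(\<lambda>x. x * u x) \<in> ?L"
    if "u \<in> ?L" "v \<in> ?L" "AE x in mp_measure c. v x = x * u x" for u v :: "real \<Rightarrow> complex"
  proof -
    have [measurable]: "u \<in> borel_measurable (mp_measure c)" "v \<in> borel_measurable (mp_measure c)"
      using that by (auto dest: L2_measurable)
    have "integrable (mp_measure c) (\<lambda>x. (cmod (x * u x))\<^sup>2) = integrable (mp_measure c) (\<lambda>x. (cmod (v x))\<^sup>2)"
      using that(3) by (intro integrable_cong_AE) auto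
    then show ?thesis
      using L2D[OF that(2)] by (simp add: L2_def)
  qed
  \<comment> \<open>Stated for an arbitrary \<open>v\<close>, because square integrability of
    \<open>x * u\<close> is a consequence and not yet available.\<close>
  have graph: "jacobi_op a (spread j (J.coeffs u)) = spread j (J.coeffs v) \<longleftrightarrow>
      (AE x in mp_measure c. v x = x * u x)" if u: "u \<in> ?L" and v: "v \<in> ?L" for u v :: "real \<Rightarrow> complex"
  proof
    assume "jacobi_op a (spread j (J.coeffs u)) = spread j (J.coeffs v)"
    then have "J.coeffs v = (\<lambda>n. \<i> * ((if n = 0 then 0 else mp_coeff c (n - 1) * J.coeffs u (n - 1)) - mp_coeff c n * J.coeffs u (Suc n)))"
      unfolding jacobi_op_spread[OF assms(2)] spread_inject[OF assms(2)] c_def[symmetric] by (rule sym)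
    then show "AE x in mp_measure c. v x = x * u x"
      by (intro J.mult_ident_if_coeffs[OF u v]) simp
  next
    assume ae: "AE x in mp_measure c. v x = x * u x"
    have xu: "(\<lambda>x. x * u x) \<in> ?L" by (rule mult_sq[OF u v ae])
    have [measurable]: "u \<in> borel_measurable (mp_measure c)" "v \<in> borel_measurable (mp_measure c)"
      using u v by (auto dest: L2_measurable)
    have "J.coeffs v n = J.coeffs (\<lambda>x. x * u x) n" for n
    proof -
      have [measurable]: "(\<lambda>x. mp_poly c x n) \<in> borel_measurable borel" by (rule mp_poly_measurable)
      show ?thesis
        unfolding J.coeffs_def inner_L2_def using ae by (intro integral_cong_AE) auto
    qed
    then have "J.coeffs v n = \<i> * ((if n = 0 then 0 else mp_coeff c (n - 1) * J.coeffs u (n - 1)) - mp_coeff c n * J.coeffs u (Suc n))" for n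
      using J.mult_ident_coeffs[OF u xu] by simp
    then show "jacobi_op a (spread j (J.coeffs u)) = spread j (J.coeffs v)"
      unfolding jacobi_op_spread[OF assms(2)] spread_inject[OF assms(2)] c_def[symmetric] by (simp add: fun_eq_iff)
  qed
  have surj: "\<exists>u\<in>?L. spread j (J.coeffs u) = f" if f: "f \<in> ell2_on (residue_class j)" for f
  proof -
    obtain h where h: "h \<in> ell2" "spread j h = f" using spread_surj[OF assms(2) f] by blast
    then show ?thesis using J.coeffs_surj[OF h(1)] by blast
  qed
  have in_W: "spread j (J.coeffs u) \<in> ell2_on (residue_class j)" if "u \<in> ?L" for u
    using spread_ell2(1)[OF assms(2) J.coeffs_ell2[OF that]] .
  have "multiplication_model (mp_measure c) (ell2_on (residue_class j)) (jacobi_max a (residue_class j)) (\<lambda>u. spread j (J.coeffs u))"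
  proof (intro multiplication_model.intro J.finite_measure_axioms multiplication_model_axioms.intro)
    show "sets (mp_measure c) = sets borel" by (rule sets_mp_measure)
    show "measure (mp_measure c) {l<..<r} > 0" if "l < r" for l r
      using that by (rule mp_measure_interval_pos[OF c])
    show "ell2_on (residue_class j) \<subseteq> ell2" using ell2_on_ell2 by blast
    show "l2_closure (ell2_on (residue_class j)) \<subseteq> ell2_on (residue_class j)" by (rule l2_closure_ell2_on)
    show "spread j (J.coeffs (\<lambda>x. u x + v x)) = spread j (J.coeffs u) + spread j (J.coeffs v)"
      if "u \<in> ?L" "v \<in> ?L" for u v
    proof -
      have "J.coeffs (\<lambda>x. u x + v x) = J.coeffs u + J.coeffs v"
        by (rule ext) (simp add: J.coeffs_def inner_L2_add[OF J.\<psi>_L2 that])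
      then show ?thesis by (simp only: spread_simps)
    qed
    show "spread j (J.coeffs (\<lambda>x. z * u x)) = cscale z (spread j (J.coeffs u))" for z u
    proof -
      have "J.coeffs (\<lambda>x. z * u x) = cscale z (J.coeffs u)"
        by (rule ext) (simp add: J.coeffs_def inner_L2_cmult cscale_def)
      then show ?thesis by (simp only: spread_simps)
    qed
    show "(l2norm (spread j (J.coeffs u)))\<^sup>2 = (LINT x|mp_measure c. (cmod (u x))\<^sup>2)" if "u \<in> ?L" for u
      unfolding spread_ell2(2)[OF assms(2)] J.parseval_norm[OF that] by (rule l2norm_power2[OF J.coeffs_ell2[OF that]])
    show "jacobi_max a (residue_class j) = {(spread j (J.coeffs u), spread j (J.coeffs (\<lambda>x. complex_of_real x * u x))) |u.
        u \<in> ?L \<and> (\<lambda>x. complex_of_real x * u x) \<in> ?L}" (is "_ = ?R")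
    proof (intro set_eqI iffI; clarify)
      fix f g assume fg: "(f, g) \<in> jacobi_max a (residue_class j)"
      then have f: "f \<in> ell2_on (residue_class j)" and g: "g = jacobi_op a f" by (auto simp: jacobi_max_def)
      have "g \<in> ell2_on (residue_class j)"
        using fg selfadjoint_jacobi_max[OF assms(1) residue_class_add_2] unfolding selfadjoint_in_def by blast
      then obtain v where v: "v \<in> ?L" "spread j (J.coeffs v) = g" using surj by blast
      obtain u where u: "u \<in> ?L" "spread j (J.coeffs u) = f" using surj[OF f] by blast
      have ae: "AE x in mp_measure c. v x = x * u x"
        using graph[OF u(1) v(1)] u(2) v(2) g by simp
      have xu: "(\<lambda>x. x * u x) \<in> ?L" by (rule mult_sq[OF u(1) v(1) ae])
      have "g = spread j (J.coeffs (\<lambda>x. x * u x))"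
        using graph[OF u(1) xu] u(2) g by simp
      then show "\<exists>u. (f, g) = (spread j (J.coeffs u), spread j (J.coeffs (\<lambda>x. complex_of_real x * u x))) \<and>
          u \<in> ?L \<and> (\<lambda>x. complex_of_real x * u x) \<in> ?L"
        using u xu by blast
    next
      fix u assume u: "u \<in> ?L" "(\<lambda>x. complex_of_real x * u x) \<in> ?L"
      then have "jacobi_op a (spread j (J.coeffs u)) = spread j (J.coeffs (\<lambda>x. x * u x))"
        using graph by simp
      then show "(spread j (J.coeffs u), spread j (J.coeffs (\<lambda>x. complex_of_real x * u x))) \<in> jacobi_max a (residue_class j)"
        using in_W[OF u(1)] in_W[OF u(2)] by (auto simp: jacobi_max_def ell2_on_ell2)
    qed
    show "selfadjoint_in (ell2_on (residue_class j)) (jacobi_max a (residue_class j))"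
      by (rule selfadjoint_jacobi_max[OF assms(1) residue_class_add_2])
  qed (use in_W surj in auto)
  then show ?thesis unfolding c_def .
qed

section \<open>Assembling the two parity classes\<close>

lemma restrict_to_simps:
  "restrict_to K (f + g) = restrict_to K f + restrict_to K g"
  "restrict_to K (f - g) = restrict_to K f - restrict_to K g"
  "restrict_to K (cscale z f) = cscale z (restrict_to K f)"
  by (auto simp: restrict_to_def cscale_def fun_eq_iff)

text \<open>The equation is solved on each parity class and the solutions are added; uniqueness
  follows by restricting a solution to the classes.\<close>

lemma resolvent_set_jacobi_max:
  assumes z: "z \<in> resolvent_set (ell2_on (residue_class 0)) (jacobi_max a (residue_class 0))"
    "z \<in> resolvent_set (ell2_on (residue_class 1)) (jacobi_max a (residue_class 1))"
  shows "z \<in> resolvent_set ell2 (jacobi_max a UNIV)"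
proof -
  let ?K = residue_class
  have ex: "\<exists>!f. (f, h + cscale z f) \<in> jacobi_max a (?K j)" if "h \<in> ell2_on (?K j)" "j < 2" for h j
    using z that by (cases "j = 0") (auto simp: resolvent_set_def less_2_cases_iff)
  have "\<exists>!f. (f, h + cscale z f) \<in> jacobi_max a UNIV" if h: "h \<in> ell2" for h
  proof -
    let ?h = "\<lambda>j. restrict_to (?K j) h"
    have hj: "?h j \<in> ell2_on (?K j)" for j using h by (rule restrict_to_ell2_on)
    obtain f0 where f0: "(f0, ?h 0 + cscale z f0) \<in> jacobi_max a (?K 0)" using ex[OF hj, of 0] by auto
    obtain f1 where f1: "(f1, ?h 1 + cscale z f1) \<in> jacobi_max a (?K 1)" using ex[OF hj, of 1] by auto
    have "(f0 + f1, (?h 0 + cscale z f0) + (?h 1 + cscale z f1)) \<in> jacobi_max a UNIV"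
      by (rule jacobi_max_add[OF f0 f1])
    moreover have "(?h 0 + cscale z f0) + (?h 1 + cscale z f1) = (?h 0 + ?h 1) + cscale z (f0 + f1)"
      by (simp only: cscale_simps add_ac)
    ultimately have "(f0 + f1, h + cscale z (f0 + f1)) \<in> jacobi_max a UNIV"
      unfolding restrict_to_residue_class by simp
    moreover have "f = f0 + f1" if f: "(f, h + cscale z f) \<in> jacobi_max a UNIV" for f
    proof -
      have r: "(restrict_to (?K j) f, ?h j + cscale z (restrict_to (?K j) f)) \<in> jacobi_max a (?K j)" for j
        using jacobi_max_restrict_to[OF residue_class_add_2 f, of j] unfolding restrict_to_simps .
      have "restrict_to (?K 0) f = f0" using ex[OF hj, of 0] r[of 0] f0 by auto
      moreover have "restrict_to (?K 1) f = f1" using ex[OF hj, of 1] r[of 1] f1 by auto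
      ultimately show ?thesis using restrict_to_residue_class[of f] by simp
    qed
    ultimately show ?thesis by blast
  qed
  moreover obtain C0 C1 where C: "\<forall>(f, g)\<in>jacobi_max a (?K 0). l2norm f \<le> C0 * l2norm (g - cscale z f)"
    "\<forall>(f, g)\<in>jacobi_max a (?K 1). l2norm f \<le> C1 * l2norm (g - cscale z f)"
    using z by (auto simp: resolvent_set_def)
  \<comment> \<open>Absolute values, since the constants obtained from the resolvent sets may be
    negative.\<close>
  have "l2norm f \<le> (\<bar>C0\<bar> + \<bar>C1\<bar>) * l2norm (g - cscale z f)" if fg: "(f, g) \<in> jacobi_max a UNIV" for f g
  proof -
    let ?r = "g - cscale z f"
    have f: "f \<in> ell2" and r: "?r \<in> ell2" using fg by (auto simp: jacobi_max_def ell2_on_UNIV)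
    have part: "l2norm (restrict_to (?K j) f) \<le> \<bar>C\<bar> * l2norm ?r"
      if "\<forall>(f, g)\<in>jacobi_max a (?K j). l2norm f \<le> C * l2norm (g - cscale z f)" for j C
    proof -
      have "l2norm (restrict_to (?K j) f) \<le> C * l2norm (restrict_to (?K j) ?r)"
        using that jacobi_max_restrict_to[OF residue_class_add_2 fg, of j] by (auto simp: restrict_to_simps)
      also have "\<dots> \<le> \<bar>C\<bar> * l2norm ?r"
      proof (intro mult_mono)
        show "l2norm (restrict_to (?K j) ?r) \<le> l2norm ?r"
          using r by (rule l2norm_mono) (simp add: restrict_to_def)
        show "0 \<le> l2norm (restrict_to (?K j) ?r)"
          using ell2_on_ell2[OF restrict_to_ell2_on[OF r]] by (rule l2norm_nonneg)
      qed auto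
      finally show ?thesis .
    qed
    have "l2norm f \<le> l2norm (restrict_to (?K 0) f) + l2norm (restrict_to (?K 1) f)"
      using l2norm_triangle[of "restrict_to (?K 0) f" "restrict_to (?K 1) f"]
        ell2_on_ell2[OF restrict_to_ell2_on[OF f]] restrict_to_residue_class[of f] by metis
    then show ?thesis
      using part[OF C(1)] part[OF C(2)] unfolding distrib_right by linarith
  qed
  ultimately show ?thesis unfolding resolvent_set_def by blast
qed

text \<open>For real points the even class suffices: its graph is contained in the full one, so a
  bounded inverse of the whole operator would contradict \<open>M0.no_bounded_inverse_real\<close>.
  For nonreal points the two resolvents are combined.\<close>

lemma spectrum_jacobi_max:
  assumes "a > 0"
  shows "spectrum ell2 (jacobi_max a UNIV) = \<real>"
proof -
  interpret M0: multiplication_model "mp_measure (a + real 0)" "ell2_on (residue_class 0)" "jacobi_max a (residue_class 0)"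
    "\<lambda>u. spread 0 (jacobi_measure.coeffs (mp_measure (a + real 0)) (\<lambda>n E. cnj (mp_poly (a + real 0) E n)) u)"
    by (rule multiplication_model_jacobi_max[OF assms]) simp
  interpret M1: multiplication_model "mp_measure (a + real 1)" "ell2_on (residue_class 1)" "jacobi_max a (residue_class 1)"
    "\<lambda>u. spread 1 (jacobi_measure.coeffs (mp_measure (a + real 1)) (\<lambda>n E. cnj (mp_poly (a + real 1) E n)) u)"
    by (rule multiplication_model_jacobi_max[OF assms]) simp
  have "z \<in> resolvent_set ell2 (jacobi_max a UNIV) \<longleftrightarrow> z \<notin> \<real>" for z
  proof
    assume z: "z \<in> resolvent_set ell2 (jacobi_max a UNIV)"
    have "jacobi_max a (residue_class 0) \<subseteq> jacobi_max a UNIV"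
      by (auto simp: jacobi_max_def ell2_on_def)
    then obtain C where "\<forall>(f, g)\<in>jacobi_max a (residue_class 0). l2norm f \<le> C * l2norm (g - cscale z f)"
      using z unfolding resolvent_set_def by blast
    then have "z \<noteq> complex_of_real E" for E
      using M0.no_bounded_inverse_real[of C E] by blast
    then show "z \<notin> \<real>" by (metis Reals_cases)
  next
    assume "z \<notin> \<real>"
    then have "Im z \<noteq> 0" using complex_is_Real_iff by blast
    then show "z \<in> resolvent_set ell2 (jacobi_max a UNIV)"
      by (intro resolvent_set_jacobi_max M0.spectrum_nonreal M1.spectrum_nonreal)
  qed
  then show ?thesis unfolding spectrum_def by auto
qed

lemma spectrum_with_multiplicity_two_H_b:
  assumes "a > 0"
  shows "spectrum_with_multiplicity_two (H_b_closed a) \<real>"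
  unfolding spectrum_with_multiplicity_two_def H_b_closed_eq[OF assms]
proof (intro conjI ballI orthogonal_direct_sum_parity preserves_summands_jacobi_max spectrum_jacobi_max[OF assms])
  show "selfadjoint_in ell2 (jacobi_max a UNIV)"
    using selfadjoint_jacobi_max[OF assms, of UNIV] by (simp add: ell2_on_UNIV)
  have parts: "simple_spectrum (ell2_on (residue_class j)) (part_in (ell2_on (residue_class j)) (jacobi_max a UNIV))"
    "spectrum (ell2_on (residue_class j)) (part_in (ell2_on (residue_class j)) (jacobi_max a UNIV)) = \<real>"
    if j: "j < 2" for j
  proof -
    interpret multiplication_model "mp_measure (a + real j)" "ell2_on (residue_class j)" "jacobi_max a (residue_class j)"
      "\<lambda>u. spread j (jacobi_measure.coeffs (mp_measure (a + real j)) (\<lambda>n E. cnj (mp_poly (a + real j) E n)) u)"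
      by (rule multiplication_model_jacobi_max[OF assms j])
    show "simple_spectrum (ell2_on (residue_class j)) (part_in (ell2_on (residue_class j)) (jacobi_max a UNIV))"
      "spectrum (ell2_on (residue_class j)) (part_in (ell2_on (residue_class j)) (jacobi_max a UNIV)) = \<real>"
      unfolding part_in_jacobi_max[OF residue_class_add_2] by (rule simple_spectrum spectrum_eq_Reals)+
  qed
  fix W assume "W \<in> {V0, V1}"
  moreover have "(0::nat) < 2" "(1::nat) < 2" by simp_all
  ultimately obtain j where j: "j < 2" "W = ell2_on (residue_class j)"
    unfolding V_eq by blast
  show "simple_spectrum W (part_in W (jacobi_max a UNIV))" "spectrum W (part_in W (jacobi_max a UNIV)) = \<real>"
    unfolding j(2) using j(1) by (rule parts)+
qed

theorem theorem2:
  fixes a :: real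
  assumes "a > 0"
  shows "(\<forall>f\<in>fin_span. H_b a f =
            cscale (\<i> / 2) (b_plus a (b_plus a f) - b_minus a (b_minus a f)))
    \<and> (\<forall>E::real. formal_eigenvector (H_b a) (complex_of_real E) (u0 a E)
                \<and> formal_eigenvector (H_b a) (complex_of_real E) (u1 a E))
    \<and> spectrum_with_multiplicity_two (H_b_closed a) \<real>"
  using H_b_conv_ladder formal_eigenvector_u0[OF assms] formal_eigenvector_u1[OF assms]
    spectrum_with_multiplicity_two_H_b[OF assms] by blast

end
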